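(* Let $S$ be a local ring, $f_1,\dots,f_c\in S$ a regular sequence, $R=S/(f_1,\dots,f_c)$, and $M$ a finitely generated $R$-module such that $\operatorname{pd}_S(M)<\infty$. Given $r>0$, we have $\mathbf{I}^r_k(M)=\mathbf{I}^r_{k+2}(M)$ for all $k\gg0$.
   Context: "Local" means commutative Noetherian local. If $(F,d)$ is the minimal $R$-free resolution of $M$, $\mathbf I^r_i(M)$ is the ideal of $R$ generated by the $r\times r$ minors of $d_i:F_i\to F_{i-1}$, taken to be $0$ if $r>\operatorname{rank}F_i$ or $r>\operatorname{rank}F_{i-1}$, except that it is the unit ideal whenever $F_i=0$ or $F_{i-1}=0$. *)

theory Defs
  imports
    "HOL-Algebra.Module"
    "HOL-Algebra.QuotRing"
    "HOL-Algebra.Ring_Divisibility"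
    "HOL-Combinatorics.Permutations"
begin

definition local_noetherian :: "('a, 'e) ring_scheme \<Rightarrow> bool" where
  "local_noetherian R \<longleftrightarrow> cring R \<and> noetherian_ring R \<and> (\<exists>!I. maximalideal I R)"

definition max_ideal :: "('a, 'e) ring_scheme \<Rightarrow> 'a set" where
  "max_ideal R = (THE I. maximalideal I R)"

text \<open>The \<open>i\<close>-th element is a nonzerodivisor modulo its predecessors, and the quotient by the
  whole sequence is nonzero. The empty sequence is allowed.\<close>

definition regular_seq :: "('a, 'e) ring_scheme \<Rightarrow> 'a list \<Rightarrow> bool" where
  "regular_seq S fs \<longleftrightarrow>
     set fs \<subseteq> carrier S \<and>
     genideal S (set fs) \<noteq> carrier S \<and>
     (\<forall>i < length fs.
        let J = genideal S (set (take i fs)); Q = S Quot J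
        in \<forall>y \<in> carrier Q. (J +>\<^bsub>S\<^esub> fs ! i) \<otimes>\<^bsub>Q\<^esub> y = \<zero>\<^bsub>Q\<^esub> \<longrightarrow> y = \<zero>\<^bsub>Q\<^esub>)"

definition mod_hom ::
  "('a, 'e) ring_scheme \<Rightarrow> ('a, 'm) module \<Rightarrow> ('a, 'n) module \<Rightarrow> ('m \<Rightarrow> 'n) set" where
  "mod_hom R M N =
     {h \<in> carrier M \<rightarrow> carrier N.
        (\<forall>x \<in> carrier M. \<forall>y \<in> carrier M. h (x \<oplus>\<^bsub>M\<^esub> y) = h x \<oplus>\<^bsub>N\<^esub> h y) \<and>
        (\<forall>a \<in> carrier R. \<forall>x \<in> carrier M. h (a \<odot>\<^bsub>M\<^esub> x) = a \<odot>\<^bsub>N\<^esub> h x)}"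

definition fin_gen :: "('a, 'e) ring_scheme \<Rightarrow> ('a, 'm) module \<Rightarrow> bool" where
  "fin_gen R M \<longleftrightarrow>
     (\<exists>X \<subseteq> carrier M. finite X \<and> (\<forall>N. submodule N R M \<longrightarrow> X \<subseteq> N \<longrightarrow> N = carrier M))"

text \<open>The ring structure fields \<open>mult\<close> and \<open>one\<close> of a module record carry no meaning.\<close>

definition restrict_scalars :: "('a \<Rightarrow> 'r) \<Rightarrow> ('r, 'm) module \<Rightarrow> ('a, 'm) module" where
  "restrict_scalars h M =
     \<lparr>carrier = carrier M, mult = mult M, one = one M, zero = zero M, add = add M,
      smult = (\<lambda>a x. h a \<odot>\<^bsub>M\<^esub> x)\<rparr>"

text \<open>The free module on the set \<open>X\<close>: finitely supported families of ring elements indexed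
  by \<open>X\<close>, extended by zero outside \<open>X\<close> so that equality of functions is equality of families.
  In particular \<open>R\<^sup>n\<close> is \<open>free_mod R {..<n}\<close>.\<close>

definition free_mod :: "('a, 'e) ring_scheme \<Rightarrow> 'x set \<Rightarrow> ('a, 'x \<Rightarrow> 'a) module" where
  "free_mod R X =
     \<lparr>carrier = {v. (\<forall>x. v x \<in> carrier R) \<and> (\<forall>x. x \<notin> X \<longrightarrow> v x = \<zero>\<^bsub>R\<^esub>) \<and>
                     finite {x. v x \<noteq> \<zero>\<^bsub>R\<^esub>}},
      mult = undefined, one = undefined,
      zero = (\<lambda>_. \<zero>\<^bsub>R\<^esub>), add = (\<lambda>v w x. v x \<oplus>\<^bsub>R\<^esub> w x),
      smult = (\<lambda>a v x. a \<otimes>\<^bsub>R\<^esub> v x)\<rparr>"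

definition unit_vec :: "('a, 'e) ring_scheme \<Rightarrow> 'x \<Rightarrow> 'x \<Rightarrow> 'a" where
  "unit_vec R q = (\<lambda>p. if p = q then \<one>\<^bsub>R\<^esub> else \<zero>\<^bsub>R\<^esub>)"

lemma free_mod_module:
  fixes R :: "('a, 'e) ring_scheme" and X :: "'x set"
  assumes "cring R"
  shows "module R (free_mod R X)"
proof -
  interpret cring R by fact
  have sub: "finite {x. v x \<oplus>\<^bsub>R\<^esub> w x \<noteq> \<zero>\<^bsub>R\<^esub>}"
    if "finite {x. v x \<noteq> \<zero>\<^bsub>R\<^esub>}" "finite {x. w x \<noteq> \<zero>\<^bsub>R\<^esub>}" for v w :: "'x \<Rightarrow> 'a"
    by (rule finite_subset[OF _ finite_UnI[OF that]]) auto
  have sub': "finite {x. a \<otimes>\<^bsub>R\<^esub> v x \<noteq> \<zero>\<^bsub>R\<^esub>}"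
    if "finite {x. v x \<noteq> \<zero>\<^bsub>R\<^esub>}" "a \<in> carrier R" for a and v :: "'x \<Rightarrow> 'a"
    by (rule finite_subset[OF _ that(1)]) (use that in auto)
  have neg: "\<exists>w\<in>carrier (free_mod R X). w \<oplus>\<^bsub>free_mod R X\<^esub> v = \<zero>\<^bsub>free_mod R X\<^esub>"
    if "v \<in> carrier (free_mod R X)" for v
  proof
    have "finite {x. \<ominus>\<^bsub>R\<^esub> v x \<noteq> \<zero>\<^bsub>R\<^esub>}"
      by (rule finite_subset[of _ "{x. v x \<noteq> \<zero>\<^bsub>R\<^esub>}"]) (use that in \<open>auto simp: free_mod_def\<close>)
    then show "(\<lambda>x. \<ominus>\<^bsub>R\<^esub> v x) \<in> carrier (free_mod R X)"
      using that by (auto simp: free_mod_def)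
    show "(\<lambda>x. \<ominus>\<^bsub>R\<^esub> v x) \<oplus>\<^bsub>free_mod R X\<^esub> v = \<zero>\<^bsub>free_mod R X\<^esub>"
      using that by (auto simp: free_mod_def l_neg)
  qed
  have grp: "abelian_group (free_mod R X)"
    by (rule abelian_groupI, rule_tac [6] neg)
      (auto simp: free_mod_def sub a_ac)
  show ?thesis
    by (rule moduleI[OF assms grp])
      (auto simp: free_mod_def sub' l_distr r_distr m_assoc)
qed

text \<open>A module is projective if it is a direct summand of a free module. It is then a summand of
  the free module on its own carrier, so index sets \<open>X\<close> of type \<open>'p set\<close> are enough.\<close>

definition projective :: "('a, 'e) ring_scheme \<Rightarrow> ('a, 'p) module \<Rightarrow> bool" where
  "projective R P \<longleftrightarrow>
     module R P \<and>
     (\<exists>(X :: 'p set) \<iota> \<pi>.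
        \<iota> \<in> mod_hom R P (free_mod R X) \<and> \<pi> \<in> mod_hom R (free_mod R X) P \<and>
        (\<forall>x \<in> carrier P. \<pi> (\<iota> x) = x))"

text \<open>Exactness of \<open>\<dots> \<rightarrow> F 2 \<rightarrow> F 1 \<rightarrow> F 0 \<rightarrow> M \<rightarrow> 0\<close>, where \<open>d i : F i \<rightarrow> F (i - 1)\<close> for
  \<open>i \<ge> 1\<close> and \<open>\<epsilon> : F 0 \<rightarrow> M\<close> is the augmentation. The value \<open>d 0\<close> is not used.\<close>

definition resolution ::
  "('a, 'e) ring_scheme \<Rightarrow> ('a, 'm) module \<Rightarrow> (nat \<Rightarrow> ('a, 'f) module) \<Rightarrow>
   (nat \<Rightarrow> 'f \<Rightarrow> 'f) \<Rightarrow> ('f \<Rightarrow> 'm) \<Rightarrow> bool" where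
  "resolution R M F d \<epsilon> \<longleftrightarrow>
     (\<forall>i. module R (F i)) \<and>
     \<epsilon> \<in> mod_hom R (F 0) M \<and>
     (\<forall>i. d (Suc i) \<in> mod_hom R (F (Suc i)) (F i)) \<and>
     \<epsilon> ` carrier (F 0) = carrier M \<and>
     d 1 ` carrier (F 1) = a_kernel (F 0) M \<epsilon> \<and>
     (\<forall>i. d (Suc (Suc i)) ` carrier (F (Suc (Suc i))) =
            a_kernel (F (Suc i)) (F i) (d (Suc i)))"

text \<open>Existence of a projective resolution of finite length. HOL cannot quantify over the type
  of the elements of the modules in the resolution, so it is a parameter: as a hypothesis with
  \<open>'p\<close> a free type variable, this covers resolutions by modules over any type.\<close>

definition finite_proj_dim ::
  "'p itself \<Rightarrow> ('a, 'e) ring_scheme \<Rightarrow> ('a, 'm) module \<Rightarrow> bool" where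
  "finite_proj_dim (_ :: 'p itself) R M \<longleftrightarrow>
     (\<exists>(P :: nat \<Rightarrow> ('a, 'p) module) \<delta> \<epsilon> n.
        resolution R M P \<delta> \<epsilon> \<and> (\<forall>i. projective R (P i)) \<and>
        (\<forall>i > n. carrier (P i) = {\<zero>\<^bsub>P i\<^esub>}))"

text \<open>The minimal free resolution with chosen bases: \<open>F i = R\<^bsup>b i\<^esup>\<close>, and
  \<open>d i (F i) \<subseteq> \<mm> (F (i - 1))\<close>, i.e. all coordinates of vectors in the image of \<open>d i\<close> lie in the
  maximal ideal \<open>\<mm>\<close>.\<close>

definition minimal_free_resolution ::
  "('a, 'e) ring_scheme \<Rightarrow> ('a, 'm) module \<Rightarrow> (nat \<Rightarrow> nat) \<Rightarrow>
   (nat \<Rightarrow> (nat \<Rightarrow> 'a) \<Rightarrow> (nat \<Rightarrow> 'a)) \<Rightarrow> ((nat \<Rightarrow> 'a) \<Rightarrow> 'm) \<Rightarrow> bool" where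
  "minimal_free_resolution R M b d \<epsilon> \<longleftrightarrow>
     resolution R M (\<lambda>i. free_mod R {..<b i}) d \<epsilon> \<and>
     (\<forall>i. \<forall>v \<in> carrier (free_mod R {..<b (Suc i)}). \<forall>p < b i. d (Suc i) v p \<in> max_ideal R)"

definition det_leibniz :: "('a, 'e) ring_scheme \<Rightarrow> nat \<Rightarrow> (nat \<Rightarrow> nat \<Rightarrow> 'a) \<Rightarrow> 'a" where
  "det_leibniz R r A =
     (\<Oplus>\<^bsub>R\<^esub> \<sigma> \<in> {\<sigma>. \<sigma> permutes {..<r}}.
        if evenperm \<sigma> then (\<Otimes>\<^bsub>R\<^esub> i \<in> {..<r}. A i (\<sigma> i))
        else \<ominus>\<^bsub>R\<^esub> (\<Otimes>\<^bsub>R\<^esub> i \<in> {..<r}. A i (\<sigma> i)))"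

text \<open>The \<open>r \<times> r\<close> minors of an \<open>m \<times> n\<close> matrix; \<open>\<rho>\<close> and \<open>\<gamma>\<close> list the selected rows and columns
  in increasing order.\<close>

definition minors ::
  "('a, 'e) ring_scheme \<Rightarrow> nat \<Rightarrow> nat \<Rightarrow> nat \<Rightarrow> (nat \<Rightarrow> nat \<Rightarrow> 'a) \<Rightarrow> 'a set" where
  "minors R r m n A =
     {det_leibniz R r (\<lambda>i j. A (\<rho> i) (\<gamma> j)) | \<rho> \<gamma>.
        \<rho> \<in> {..<r} \<rightarrow> {..<m} \<and> strict_mono_on {..<r} \<rho> \<and>
        \<gamma> \<in> {..<r} \<rightarrow> {..<n} \<and> strict_mono_on {..<r} \<gamma>}"

text \<open>The ideal \<open>\<^bold>I\<^sup>r\<^sub>i\<close> of a resolution with \<open>F i = R\<^bsup>b i\<^esup>\<close>. The \<open>q\<close>-th column of the matrix of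
  \<open>d i\<close> is the image of the \<open>q\<close>-th standard basis vector. For \<open>i = 0\<close> the target \<open>F (- 1)\<close> is zero,
  so the ideal is the unit ideal.\<close>

definition minor_ideal ::
  "('a, 'e) ring_scheme \<Rightarrow> (nat \<Rightarrow> nat) \<Rightarrow> (nat \<Rightarrow> (nat \<Rightarrow> 'a) \<Rightarrow> (nat \<Rightarrow> 'a)) \<Rightarrow>
   nat \<Rightarrow> nat \<Rightarrow> 'a set" where
  "minor_ideal R b d r i =
     (if i = 0 \<or> b i = 0 \<or> b (i - 1) = 0 then carrier R
      else if r > b i \<or> r > b (i - 1) then {\<zero>\<^bsub>R\<^esub>}
      else genideal R (minors R r (b (i - 1)) (b i) (\<lambda>p q. d i (unit_vec R q) p)))"

end

theory Submission
  imports Defs "HOL-Library.Function_Algebras" "HOL-Computational_Algebra.Polynomial"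
begin

text \<open>Lift the minimal resolution of \<open>M\<close> over \<open>R\<close> to matrices \<open>D\<close> over \<open>S\<close>. Then
  \<open>D\<^sup>2 = \<Sum>l. f l T l\<close>, and modulo \<open>f\<close> the \<open>T l\<close> are chain maps of degree \<open>- 2\<close> that commute up to
  homotopy (Eisenbud). They make \<open>Ext\<^sub>R(M, k)\<close> a Noetherian module: the cone of the last operator is a
  resolution of \<open>M\<close> over the quotient by one element less, so a Hilbert basis argument reduces the
  claim to \<open>Ext\<^sub>S(M, k)\<close>, which vanishes in high degrees because \<open>pd\<^sub>S(M)\<close> is finite.

  Hence the common kernel of the operators on \<open>Ext\<^sub>R(M, k)\<close> lives in bounded degrees, and by McCoy's
  argument the generic combination \<open>t = \<Sum>l. x\<^sup>l T l\<close> over \<open>R[x]\<close> is injective on \<open>Ext\<^sub>R(M, k)[x]\<close> in high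
  degrees; the indeterminate makes an infinite residue field unnecessary. So there are a matrix \<open>C\<close>
  and a polynomial \<open>u\<close> with a unit coefficient such that \<open>t C = u\<close>. From \<open>u d\<^sub>k = d\<^sub>k t C = t d\<^sub>k\<^sub>+\<^sub>2 C\<close>
  it follows that \<open>u\<^sup>r\<close> multiplies the \<open>r\<close>-minors of \<open>d\<^sub>k\<close> into the ideal of the \<open>r\<close>-minors of \<open>d\<^sub>k\<^sub>+\<^sub>2\<close>,
  so the former lie in the latter. Ascending chains of ideals become stationary.\<close>

section \<open>Ideals and matrices over type-class rings\<close>

text \<open>The induction over the \<open>f l\<close> cannot stay with minimal complexes: the block
  \<open>- T\<close> of the cone may have unit entries. Noetherianity is therefore shown for the
  cohomology of arbitrary complexes, and minimality enters afterwards, where it makes all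
  differentials of the dual complex vanish. The inductive step rests on exactness in the middle of
  Ext^(n-2) -> Ext^n -> Ext'^n, where the first map is the last operator and Ext' belongs to the
  quotient by one element less. No quotient of the type-class ring is formed: the residue field k,
  \<open>R\<close> and \<open>R\<close>[x] are represented by that ring or its polynomials, and
  equality means that a difference lies in an ideal. Matrices are functions on numbers with separate
  finite index sets, so that complexes of all ranks, cones included, share one type and the
  induction can run over them. Ext(M, k) consists of row vectors, on which \<open>T l\<close> acts
  from the right. Injectivity of the generic operator on rows thus means full row rank over k(x);
  clearing denominators gives the right inverse up to \<open>u\<close>.\<close>

definition rideal :: "'p::comm_ring_1 set \<Rightarrow> bool" where
  "rideal I \<longleftrightarrow> 0 \<in> I \<and> (\<forall>a\<in>I. \<forall>b\<in>I. a + b \<in> I) \<and> (\<forall>r. \<forall>a\<in>I. r * a \<in> I)"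

lemma rideal_0: "rideal I \<Longrightarrow> 0 \<in> I"
  and rideal_add: "rideal I \<Longrightarrow> a \<in> I \<Longrightarrow> b \<in> I \<Longrightarrow> a + b \<in> I"
  and rideal_mult: "rideal I \<Longrightarrow> a \<in> I \<Longrightarrow> r * a \<in> I"
  by (auto simp: rideal_def)

lemma rideal_mult': "rideal I \<Longrightarrow> a \<in> I \<Longrightarrow> a * r \<in> I"
  using rideal_mult[of I a r] by (simp add: mult.commute)

lemma rideal_minus: "rideal I \<Longrightarrow> a \<in> I \<Longrightarrow> - a \<in> I"
  using rideal_mult[of I a "-1"] by simp

lemma rideal_diff: "rideal I \<Longrightarrow> a \<in> I \<Longrightarrow> b \<in> I \<Longrightarrow> a - b \<in> I"
  using rideal_add[of I a "-b"] rideal_minus[of I b] by simp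

lemma rideal_sum: "rideal I \<Longrightarrow> (\<And>x. x \<in> A \<Longrightarrow> g x \<in> I) \<Longrightarrow> sum g A \<in> I"
  by (induction A rule: infinite_finite_induct) (auto simp: rideal_0 rideal_add)

lemma rideal_sum_diff:
  "rideal I \<Longrightarrow> (\<And>x. x \<in> A \<Longrightarrow> g x - h x \<in> I) \<Longrightarrow> sum g A - sum h A \<in> I"
  using rideal_sum[of I A "\<lambda>x. g x - h x"] by (simp add: sum_subtractf)

lemma rideal_cong: "rideal I \<Longrightarrow> a - b \<in> I \<Longrightarrow> a \<in> I \<longleftrightarrow> b \<in> I"
  using rideal_add[of I "a - b" b] rideal_diff[of I a "a - b"] by auto

lemma rideal_diff_sym: "rideal I \<Longrightarrow> a - b \<in> I \<Longrightarrow> b - a \<in> I"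
  using rideal_minus[of I "a - b"] by simp

text \<open>Only the index set of the summation is recorded. Rows and columns range over all numbers
  and entries outside the intended index sets are arbitrary, so statements about matrices restrict
  \<open>p\<close> and \<open>q\<close> explicitly.\<close>

definition matmul :: "nat set \<Rightarrow> (nat \<Rightarrow> nat \<Rightarrow> 'p::comm_ring_1) \<Rightarrow> (nat \<Rightarrow> nat \<Rightarrow> 'p) \<Rightarrow> nat \<Rightarrow> nat \<Rightarrow> 'p" where
  "matmul K A C = (\<lambda>p q. \<Sum>k\<in>K. A p k * C k q)"

definition rowmul :: "nat set \<Rightarrow> (nat \<Rightarrow> 'p::comm_ring_1) \<Rightarrow> (nat \<Rightarrow> nat \<Rightarrow> 'p) \<Rightarrow> nat \<Rightarrow> 'p" where
  "rowmul K x A = (\<lambda>q. \<Sum>k\<in>K. x k * A k q)"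

lemma rowmul_add: "rowmul K (x + y) A = rowmul K x A + rowmul K y A"
  by (auto simp: rowmul_def sum.distrib algebra_simps fun_eq_iff)

lemma rowmul_scale: "rowmul K (\<lambda>q. a * x q) A = (\<lambda>q. a * rowmul K x A q)"
  by (auto simp: rowmul_def sum_distrib_left algebra_simps fun_eq_iff)

lemma rowmul_rowmul: "rowmul L (rowmul K x A) C q = (\<Sum>k\<in>K. x k * matmul L A C k q)"
  by (simp add: rowmul_def matmul_def sum_distrib_left sum_distrib_right mult.assoc sum.swap[of _ L])

lemma matmul_assoc: "matmul L (matmul K A C) E = matmul K A (matmul L C E)"
  by (auto simp: matmul_def sum_distrib_left sum_distrib_right mult.assoc sum.swap[of _ L] fun_eq_iff)

section \<open>A graded Hilbert basis theorem\<close>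

text \<open>A presentation of the graded module \<open>Z n / Bd n\<close> over a polynomial ring in
  \<open>J\<close> variables of degree 2, without forming the quotient. The scalars carry no ring
  structure here; \<open>u\<close> stands for -1 and provides subtraction.\<close>

locale graded_op =
  fixes Z Bd :: "int \<Rightarrow> 'c::ab_group_add set" and sc :: "'p \<Rightarrow> 'c \<Rightarrow> 'c" and u :: 'p
    and t :: "nat \<Rightarrow> int \<Rightarrow> 'c \<Rightarrow> 'c" and J :: nat
  assumes Z_add: "x \<in> Z n \<Longrightarrow> y \<in> Z n \<Longrightarrow> x + y \<in> Z n"
    and Z_sc: "x \<in> Z n \<Longrightarrow> sc a x \<in> Z n"
    and Bd_add: "x \<in> Bd n \<Longrightarrow> y \<in> Bd n \<Longrightarrow> x + y \<in> Bd n"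
    and Bd_sc: "x \<in> Bd n \<Longrightarrow> sc a x \<in> Bd n"
    and Bd_0: "0 \<in> Bd n"
    and Bd_Z: "Bd n \<subseteq> Z n"
    and sc_add: "sc a (x + y) = sc a x + sc a y"
    and sc_neg: "sc u x = - x"
    and t_add: "t l n (x + y) = t l n x + t l n y"
    and t_sc: "t l n (sc a x) = sc a (t l n x)"
    and t_Z: "l < J \<Longrightarrow> x \<in> Z n \<Longrightarrow> t l n x \<in> Z (n + 2)"
    and t_Bd: "l < J \<Longrightarrow> x \<in> Bd n \<Longrightarrow> t l n x \<in> Bd (n + 2)"
    and t_comm: "l < J \<Longrightarrow> i < J \<Longrightarrow> x \<in> Z n \<Longrightarrow>
      t l (n + 2) (t i n x) - t i (n + 2) (t l n x) \<in> Bd (n + 4)"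
begin

text \<open>Graded submodules of the quotient, represented by their preimages in
  \<open>Z\<close>.\<close>

definition gsub :: "(int \<Rightarrow> 'c set) \<Rightarrow> bool" where
  "gsub U \<longleftrightarrow> (\<forall>n. U n \<subseteq> Z n \<and> Bd n \<subseteq> U n \<and> (\<forall>x\<in>U n. \<forall>y\<in>U n. x + y \<in> U n) \<and>
     (\<forall>a. \<forall>x\<in>U n. sc a x \<in> U n) \<and> (\<forall>l<J. \<forall>x\<in>U n. t l n x \<in> U (n + 2)))"

text \<open>The bound \<open>K\<close> does not depend on the degree \<open>n\<close>; the argument
  that bounds the socle uses this uniformity.\<close>

definition gacc :: bool where
  "gacc \<longleftrightarrow> (\<forall>U :: nat \<Rightarrow> int \<Rightarrow> 'c set. (\<forall>k. gsub (U k)) \<longrightarrow> (\<forall>k n. U k n \<subseteq> U (Suc k) n) \<longrightarrow>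
     (\<exists>K. \<forall>k\<ge>K. \<forall>n. U k n = U K n))"

primrec pw :: "nat \<Rightarrow> nat \<Rightarrow> int \<Rightarrow> 'c \<Rightarrow> 'c" where
  "pw j 0 n x = x"
| "pw j (Suc i) n x = t j (n + 2 * int i) (pw j i n x)"

lemma pw_Suc': "pw j (Suc i) n x = pw j i (n + 2) (t j n x)"
  by (induction i) (simp_all add: algebra_simps)

lemma Z_0: "0 \<in> Z n"
  using Bd_0 Bd_Z by blast

lemma Z_diff: "x \<in> Z n \<Longrightarrow> y \<in> Z n \<Longrightarrow> x - y \<in> Z n"
  using Z_add[of x n "sc u y"] Z_sc[of y n u] by (simp add: sc_neg)

lemma Bd_diff: "x \<in> Bd n \<Longrightarrow> y \<in> Bd n \<Longrightarrow> x - y \<in> Bd n"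
  using Bd_add[of x n "sc u y"] Bd_sc[of y n u] by (simp add: sc_neg)

lemma sc_diff: "sc a (x - y) = sc a x - sc a y"
  using sc_add[of a "x - y" y] by (simp add: algebra_simps)

lemma t_0: "t l n 0 = 0"
  using t_add[of l n 0 0] by simp

lemma t_diff: "t l n (x - y) = t l n x - t l n y"
  using t_add[of l n "x - y" y] by (simp add: algebra_simps)

lemma pw_add: "pw j i n (x + y) = pw j i n x + pw j i n y"
  by (induction i) (simp_all add: t_add)

lemma pw_diff: "pw j i n (x - y) = pw j i n x - pw j i n y"
  by (induction i) (simp_all add: t_diff)

lemma pw_sc: "pw j i n (sc a x) = sc a (pw j i n x)"
  by (induction i) (simp_all add: t_sc)

lemma pw_0: "pw j i n 0 = 0"
  by (induction i) (simp_all add: t_0)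

lemma pw_Z: "j < J \<Longrightarrow> x \<in> Z n \<Longrightarrow> pw j i n x \<in> Z (n + 2 * int i)"
proof (induction i)
  case (Suc i) then show ?case using t_Z[of j "pw j i n x" "n + 2 * int i"] by (simp add: algebra_simps)
qed simp

lemma pw_Bd: "j < J \<Longrightarrow> x \<in> Bd n \<Longrightarrow> pw j i n x \<in> Bd (n + 2 * int i)"
proof (induction i)
  case (Suc i) then show ?case using t_Bd[of j "pw j i n x" "n + 2 * int i"] by (simp add: algebra_simps)
qed simp

text \<open>Each exchange of two operators costs a coboundary, and the remaining operators preserve
  coboundaries.\<close>

lemma pw_comm:
  assumes "j < J" "x \<in> Z n" "l < J"
  shows "pw j i (n + 2) (t l n x) - t l (n + 2 * int i) (pw j i n x) \<in> Bd (n + 2 + 2 * int i)"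
proof (induction i)
  case 0 then show ?case by (simp add: Bd_0)
next
  case (Suc i)
  let ?N = "n + 2 * int i"
  have e: "n + 2 + 2 * int i = ?N + 2" "?N + 2 + 2 = ?N + 4" "n + 2 + 2 * int (Suc i) = ?N + 4"
    "n + 2 * int (Suc i) = ?N + 2" "n + (2 + 2 * int i) = ?N + 2" by simp_all
  have 1: "t j (?N + 2) (pw j i (n + 2) (t l n x)) - t j (?N + 2) (t l ?N (pw j i n x)) \<in> Bd (?N + 4)"
    using t_Bd[OF assms(1) Suc] by (simp add: t_diff e)
  have 2: "t l (?N + 2) (t j ?N (pw j i n x)) - t j (?N + 2) (t l ?N (pw j i n x)) \<in> Bd (?N + 4)"
    by (rule t_comm[OF assms(3,1) pw_Z[OF assms(1,2)]])
  show ?case using Bd_diff[OF 1 2] by (simp add: e add.commute[of 4])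
qed

end

text \<open>As in Hilbert's basis theorem, \<open>L i k\<close> in the proof consists of the leading coefficients of the
  elements of \<open>U k\<close> that are divisible by the \<open>i\<close>-th power of \<open>t j\<close>; the map \<open>rho\<close> identifies the
  cokernel of \<open>t j\<close> with a subobject of the Noetherian module on the right.\<close>

lemma gacc_step:
  fixes rho :: "'c::ab_group_add \<Rightarrow> 'g::ab_group_add"
  assumes F: "graded_op Z Bd sc u t (Suc j)" and G: "graded_op Z' Bd' sc' u t' j"
    and rho_add: "\<And>x y. rho (x + y) = rho x + rho y"
    and rho_sc: "\<And>a x. rho (sc a x) = sc' a (rho x)"
    and rho_Z: "\<And>n x. x \<in> Z n \<Longrightarrow> rho x \<in> Z' n"
    and rho_t: "\<And>l n x. l < j \<Longrightarrow> x \<in> Z n \<Longrightarrow> rho (t l n x) - t' l n (rho x) \<in> Bd' (n + 2)"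
    and rho_ker: "\<And>n x. x \<in> Z n \<Longrightarrow> rho x \<in> Bd' n \<Longrightarrow> \<exists>y\<in>Z (n - 2). x - t j (n - 2) y \<in> Bd n"
    and neg: "\<And>n. n < 0 \<Longrightarrow> Z n \<subseteq> Bd n"
    and acc': "graded_op.gacc Z' Bd' sc' t' j"
  shows "graded_op.gacc Z Bd sc t (Suc j)"
proof -
  interpret F: graded_op Z Bd sc u t "Suc j" by (rule F)
  interpret G: graded_op Z' Bd' sc' u t' j by (rule G)
  let ?pw = "F.pw j"
  have rho_0: "rho 0 = 0" using rho_add[of 0 0] by simp
  have rho_diff: "rho (x - y) = rho x - rho y" for x y
    using rho_add[of "x - y" y] by (simp add: algebra_simps)
  note pw_Bd = F.pw_Bd[OF lessI] and pw_comm = F.pw_comm[OF lessI _ less_SucI]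
  show ?thesis unfolding F.gacc_def
  proof (intro allI impI)
    fix U :: "nat \<Rightarrow> int \<Rightarrow> 'c set"
    assume sub: "\<forall>k. F.gsub (U k)" and inc: "\<forall>k n. U k n \<subseteq> U (Suc k) n"
    have U_add: "x + y \<in> U k n" if "x \<in> U k n" "y \<in> U k n" for x y k n
      using sub that unfolding F.gsub_def less_Suc_eq_le by blast
    have U_sc: "sc a x \<in> U k n" if "x \<in> U k n" for x a k n
      using sub that unfolding F.gsub_def less_Suc_eq_le by blast
    have U_diff: "x - y \<in> U k n" if "x \<in> U k n" "y \<in> U k n" for x y k n
      using U_add[OF that(1) U_sc[OF that(2), of u]] by (simp add: F.sc_neg)
    have U_Bd: "x \<in> U k n" if "x \<in> Bd n" for x k n
      using sub that unfolding F.gsub_def by blast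
    have U_Z: "x \<in> Z n" if "x \<in> U k n" for x k n
      using sub that unfolding F.gsub_def less_Suc_eq_le by blast
    have U_t: "t l n x \<in> U k (n + 2)" if "x \<in> U k n" "l \<le> j" for x k n l
      using sub that unfolding F.gsub_def less_Suc_eq_le by blast
    have U_mono: "U k n \<subseteq> U k' n" if "k \<le> k'" for k k' n
      using that inc by (induction rule: dec_induct) auto
    \<comment> \<open>\<open>y\<close> is the class of \<open>x\<close> in the cokernel of
      \<open>t j\<close>, and \<open>z\<close> absorbs the part of higher order: some element of
      \<open>U k\<close> agrees with the \<open>i\<close>-th power of \<open>t j\<close> applied to
      \<open>x\<close> up to a multiple of the next power.\<close>
    define L where "L i k n = {y \<in> Z' n. \<exists>x\<in>Z n. \<exists>z\<in>Z (n - 2). y - rho x \<in> Bd' n \<and>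
       ?pw i n x - ?pw (Suc i) (n - 2) z \<in> U k (n + 2 * int i)}" for i k n
    have LI: "y \<in> L i k n" if "y \<in> Z' n" "x \<in> Z n" "z \<in> Z (n - 2)" "y - rho x \<in> Bd' n"
      "?pw i n x - ?pw (Suc i) (n - 2) z \<in> U k (n + 2 * int i)" for i k n x y z
      unfolding L_def using that by blast
    have LE: "\<exists>x z. y \<in> Z' n \<and> x \<in> Z n \<and> z \<in> Z (n - 2) \<and> y - rho x \<in> Bd' n \<and>
      ?pw i n x - ?pw (Suc i) (n - 2) z \<in> U k (n + 2 * int i)" if "y \<in> L i k n" for i k n y
      using that unfolding L_def by blast
    have L_sub: "G.gsub (L i k)" for i k
      unfolding G.gsub_def
    proof (intro allI conjI ballI impI)
      fix n
      show "L i k n \<subseteq> Z' n" by (auto simp: L_def)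
      show "Bd' n \<subseteq> L i k n"
      proof
        fix y assume y: "y \<in> Bd' n"
        show "y \<in> L i k n" unfolding L_def using rho_0 y G.Bd_Z F.Z_0
          by (auto intro!: bexI[of _ 0] simp: F.pw_0 F.t_0 U_Bd F.Bd_0 simp del: F.pw.simps)
      qed
    next
      fix n y y' assume "y \<in> L i k n" "y' \<in> L i k n"
      then obtain x z x' z' where xz: "y \<in> Z' n" "x \<in> Z n" "z \<in> Z (n - 2)" "y - rho x \<in> Bd' n"
          "?pw i n x - ?pw (Suc i) (n - 2) z \<in> U k (n + 2 * int i)"
        and xz': "y' \<in> Z' n" "x' \<in> Z n" "z' \<in> Z (n - 2)" "y' - rho x' \<in> Bd' n"
          "?pw i n x' - ?pw (Suc i) (n - 2) z' \<in> U k (n + 2 * int i)"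
        using LE by meson
      have "y + y' - rho (x + x') \<in> Bd' n"
        using G.Bd_add[OF xz(4) xz'(4)] by (simp add: rho_add algebra_simps)
      moreover have "?pw i n (x + x') - ?pw (Suc i) (n - 2) (z + z') \<in> U k (n + 2 * int i)"
        using U_add[OF xz(5) xz'(5)] by (simp add: F.pw_add algebra_simps del: F.pw.simps)
      ultimately show "y + y' \<in> L i k n"
        using xz xz' F.Z_add G.Z_add by (intro LI) auto
    next
      fix n a y assume "y \<in> L i k n"
      then obtain x z where xz: "y \<in> Z' n" "x \<in> Z n" "z \<in> Z (n - 2)" "y - rho x \<in> Bd' n"
          "?pw i n x - ?pw (Suc i) (n - 2) z \<in> U k (n + 2 * int i)"
        using LE by meson
      have "sc' a y - rho (sc a x) \<in> Bd' n"
        using G.Bd_sc[OF xz(4), of a] by (simp add: rho_sc G.sc_diff)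
      moreover have "?pw i n (sc a x) - ?pw (Suc i) (n - 2) (sc a z) \<in> U k (n + 2 * int i)"
        using U_sc[OF xz(5), of a] by (simp add: F.pw_sc F.sc_diff del: F.pw.simps)
      ultimately show "sc' a y \<in> L i k n"
        using xz F.Z_sc G.Z_sc by (intro LI) auto
    next
      fix n l y assume l: "l < j" and "y \<in> L i k n"
      then obtain x z where xz: "y \<in> Z' n" "x \<in> Z n" "z \<in> Z (n - 2)" "y - rho x \<in> Bd' n"
          "?pw i n x - ?pw (Suc i) (n - 2) z \<in> U k (n + 2 * int i)"
        using LE by meson
      let ?N = "n + 2 * int i"
      have 1: "t' l n y - rho (t l n x) \<in> Bd' (n + 2)"
        using G.Bd_diff[OF G.t_Bd[OF l xz(4)] rho_t[OF l xz(2)]] by (simp add: G.t_diff)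
      \<comment> \<open>Moving \<open>t l\<close> past either power of \<open>t j\<close> changes
        the element by a coboundary, which \<open>U k\<close> contains.\<close>
      have "t l ?N (?pw i n x) - t l ?N (?pw (Suc i) (n - 2) z) \<in> U k (?N + 2)"
        using U_t[OF xz(5), of l] l by (simp add: F.t_diff del: F.pw.simps)
      moreover have "?pw i (n + 2) (t l n x) - t l ?N (?pw i n x) \<in> U k (?N + 2)"
        using U_Bd[OF pw_comm[OF xz(2) l, of i]] by (simp add: algebra_simps)
      moreover have "?pw (Suc i) n (t l (n - 2) z) - t l ?N (?pw (Suc i) (n - 2) z) \<in> U k (?N + 2)"
        using U_Bd[OF pw_comm[OF xz(3) l, of "Suc i"], where k = k]
        by (simp add: algebra_simps del: F.pw.simps)
      ultimately have "(t l ?N (?pw i n x) - t l ?N (?pw (Suc i) (n - 2) z)) +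
           (?pw i (n + 2) (t l n x) - t l ?N (?pw i n x)) -
           (?pw (Suc i) n (t l (n - 2) z) - t l ?N (?pw (Suc i) (n - 2) z)) \<in> U k (?N + 2)"
        by (rule U_diff[OF U_add])
      then have "?pw i (n + 2) (t l n x) - ?pw (Suc i) n (t l (n - 2) z) \<in> U k (n + 2 + 2 * int i)"
        by (simp add: algebra_simps del: F.pw.simps)
      moreover have "t l (n - 2) z \<in> Z n" using F.t_Z[OF less_SucI[OF l] xz(3)] by simp
      ultimately show "t' l n y \<in> L i k (n + 2)"
        using 1 G.t_Z[OF l xz(1)] F.t_Z[OF less_SucI[OF l] xz(2)]
        by (intro LI[of _ _ "t l n x" "t l (n - 2) z"]) (auto simp del: F.pw.simps)
    qed
    have L_mono_k: "L i k n \<subseteq> L i k' n" if "k \<le> k'" for i k k' n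
      using U_mono[OF that] by (fastforce simp: L_def simp del: F.pw.simps)
    \<comment> \<open>Applying \<open>t j\<close> keeps the leading coefficient and raises the order
      by one.\<close>
    have L_mono_i1: "L i k n \<subseteq> L (Suc i) k n" for i k n
    proof
      fix y assume "y \<in> L i k n"
      then obtain x z where xz: "y \<in> Z' n" "x \<in> Z n" "z \<in> Z (n - 2)" "y - rho x \<in> Bd' n"
          "?pw i n x - ?pw (Suc i) (n - 2) z \<in> U k (n + 2 * int i)"
        using LE by meson
      have "t j (n + 2 * int i) (?pw i n x - ?pw (Suc i) (n - 2) z) \<in> U k (n + 2 * int i + 2)"
        using U_t[OF xz(5)] by blast
      then have "?pw (Suc i) n x - ?pw (Suc (Suc i)) (n - 2) z \<in> U k (n + 2 * int (Suc i))"
        by (simp add: F.t_diff algebra_simps)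
      then show "y \<in> L (Suc i) k n" using xz by (intro LI)
    qed
    have L_mono_i: "L i k n \<subseteq> L i' k n" if "i \<le> i'" for i i' k n
      using lift_Suc_mono_le[of "\<lambda>i. L i k n", OF L_mono_i1 that] .
    \<comment> \<open>The diagonal controls all large \<open>i\<close>: for \<open>i\<close> and
      \<open>k\<close> at least \<open>K0\<close>, \<open>L i k\<close> lies between
      \<open>L K0 K0\<close> and a later diagonal term, which is equal to it. Only the finitely many
      \<open>i < K0\<close> need bounds of their own.\<close>
    have L_sub': "\<forall>k. G.gsub (L k k)" using L_sub by blast
    have L_inc: "\<forall>k n. L k k n \<subseteq> L (Suc k) (Suc k) n"
      using order.trans[OF L_mono_i1 L_mono_k[OF le_SucI[OF order.refl]]] by blast
    have "\<exists>K0. \<forall>k\<ge>K0. \<forall>n. L k k n = L K0 K0 n"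
      using acc'[unfolded G.gacc_def, THEN spec, of "\<lambda>k. L k k", THEN mp, OF L_sub', THEN mp, OF L_inc] .
    then obtain K0 where K0: "\<And>k n. k \<ge> K0 \<Longrightarrow> L k k n = L K0 K0 n" by blast
    have "\<exists>K. \<forall>k\<ge>K. \<forall>n. L i k n = L i K n" for i
    proof -
      have 1: "\<forall>k. G.gsub (L i k)" using L_sub by blast
      have 2: "\<forall>k n. L i k n \<subseteq> L i (Suc k) n" using L_mono_k[OF le_SucI[OF order.refl]] by blast
      show ?thesis
        using acc'[unfolded G.gacc_def, THEN spec, of "L i", THEN mp, OF 1, THEN mp, OF 2] .
    qed
    then have "\<forall>i. \<exists>K. \<forall>k\<ge>K. \<forall>n. L i k n = L i K n" by blast
    then obtain Ki where Ki': "\<forall>i. \<forall>k\<ge>Ki i. \<forall>n. L i k n = L i (Ki i) n"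
      unfolding choice_iff by blast
    then have Ki: "L i k n = L i (Ki i) n" if "k \<ge> Ki i" for i k n using that by blast
    define K where "K = Max (insert K0 (Ki ` {..<K0}))"
    have KK0: "K \<ge> K0" and KKi: "\<And>i. i < K0 \<Longrightarrow> K \<ge> Ki i" by (auto simp: K_def)
    have LK: "L i k n = L i K n" if "k \<ge> K" for i k n
    proof (cases "i < K0")
      case True then show ?thesis using Ki[of i k n] Ki[of i K n] KKi[OF True] that by simp
    next
      case False
      have *: "L i k n = L K0 K0 n" if "k \<ge> K0" for k
      proof
        have "L K0 K0 n \<subseteq> L i K0 n" using False by (intro L_mono_i) simp
        also have "\<dots> \<subseteq> L i k n" by (rule L_mono_k[OF that])
        finally show "L K0 K0 n \<subseteq> L i k n" .
        show "L i k n \<subseteq> L K0 K0 n"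
        proof -
          have "L i k n \<subseteq> L (max i k) k n" by (rule L_mono_i) simp
          also have "\<dots> \<subseteq> L (max i k) (max i k) n" by (rule L_mono_k) simp
          also have "\<dots> = L K0 K0 n" using that by (intro K0) simp
          finally show ?thesis .
        qed
      qed
      show ?thesis using * that KK0 by simp
    qed
    show "\<exists>K. \<forall>k\<ge>K. \<forall>n. U k n = U K n"
    proof (intro exI[of _ K] allI impI)
      fix k n assume k: "K \<le> k"
      have "U k n \<subseteq> U K n"
      proof
        fix x assume x: "x \<in> U k n"
        \<comment> \<open>Successive approximation: modulo \<open>U K\<close>, \<open>x\<close> is
          divisible by ever higher powers of \<open>t j\<close>. The coefficient \<open>z\<close> of
          the current power gives a leading coefficient for \<open>U k\<close>, hence one for
          \<open>U K\<close>, and subtracting the corresponding element of \<open>U K\<close> leaves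
          a multiple of the next power.\<close>
        have "\<exists>z\<in>Z (n - 2 * int i). x - ?pw i (n - 2 * int i) z \<in> U K n" for i
        proof (induction i)
          case 0 show ?case using U_Z[OF x] U_Bd[OF F.Bd_0] by (auto intro!: bexI[of _ x])
        next
          case (Suc i)
          let ?N = "n - 2 * int i"
          from Suc obtain z where z: "z \<in> Z ?N" "x - ?pw i ?N z \<in> U K n" by blast
          have "?pw i ?N z \<in> U k n"
            using U_diff[OF x subsetD[OF U_mono[OF k] z(2)]] by simp
          then have "rho z \<in> L i k ?N"
            using z rho_Z F.Z_0 G.Bd_0 F.pw_0[of j "Suc i"]
            by (intro LI[of _ _ z 0]) (auto simp del: F.pw.simps)
          then have "rho z \<in> L i K ?N" using LK[OF k] by simp
          then obtain v w where vw: "v \<in> Z ?N" "w \<in> Z (?N - 2)" "rho z - rho v \<in> Bd' ?N"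
              "?pw i ?N v - ?pw (Suc i) (?N - 2) w \<in> U K (?N + 2 * int i)"
            using LE by meson
          obtain y where y: "y \<in> Z (?N - 2)" "z - v - t j (?N - 2) y \<in> Bd ?N"
            using rho_ker[of "z - v" ?N] F.Z_diff[OF z(1) vw(1)] vw(3) by (auto simp: rho_diff)
          have 1: "?pw i ?N z - ?pw i ?N v - ?pw (Suc i) (?N - 2) y \<in> U K n"
            using U_Bd[OF pw_Bd[OF y(2), of i], of K]
            by (simp add: F.pw_Suc' F.pw_diff del: F.pw.simps)
          have 2: "?pw i ?N v - ?pw (Suc i) (?N - 2) w \<in> U K n" using vw(4) by simp
          have "x - ?pw (Suc i) (?N - 2) (y + w) \<in> U K n"
            using U_add[OF z(2) U_add[OF 1 2]]
            by (simp add: F.pw_add algebra_simps del: F.pw.simps)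
          moreover have "?N - 2 = n - 2 * int (Suc i)" by simp
          ultimately show ?case using F.Z_add[OF y(1) vw(2)] by metis
        qed
        \<comment> \<open>For \<open>n >= 0\<close> the coefficient \<open>z\<close> has degree
          \<open>n - 2 (n + 1)\<close>, which is negative, so it is a coboundary.\<close>
        from this[of "nat (n + 1)"] obtain z where z: "z \<in> Z (n - 2 * int (nat (n + 1)))"
          "x - ?pw (nat (n + 1)) (n - 2 * int (nat (n + 1))) z \<in> U K n" by blast
        show "x \<in> U K n"
        proof (cases "n < 0")
          case True then show ?thesis using neg[OF True] U_Z[OF x] U_Bd by blast
        next
          case False
          then have "z \<in> Bd (n - 2 * int (nat (n + 1)))"
            using neg[of "n - 2 * int (nat (n + 1))"] z(1) by auto
          from U_Bd[OF pw_Bd[OF this, of "nat (n + 1)"], of K]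
          have "?pw (nat (n + 1)) (n - 2 * int (nat (n + 1))) z \<in> U K n" by simp
          from U_add[OF z(2) this] show ?thesis by simp
        qed
      qed
      then show "U k n = U K n" using U_mono[OF k] by blast
    qed
  qed
qed

section \<open>Eisenbud operators\<close>

locale ideal_gens =
  fixes I0 :: "'p::comm_ring_1 set" and f :: "nat \<Rightarrow> 'p"
  assumes I0: "rideal I0"
begin

text \<open>The ideal generated by \<open>I0\<close> and \<open>f 0, ..., f (j - 1)\<close>, written
  with explicit coefficients so that these can be chosen and compared.\<close>

definition gens_ideal :: "nat \<Rightarrow> 'p set" where
  "gens_ideal j = {a. \<exists>b. a - (\<Sum>l<j. f l * b l) \<in> I0}"

lemma gens_ideal_I: "a - (\<Sum>l<j. f l * b l) \<in> I0 \<Longrightarrow> a \<in> gens_ideal j"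
  by (auto simp: gens_ideal_def)

lemma I0_gens_ideal: "a \<in> I0 \<Longrightarrow> a \<in> gens_ideal j"
  by (rule gens_ideal_I[of _ "\<lambda>_. 0"]) simp

lemma gens_ideal_ideal: "rideal (gens_ideal j)"
  unfolding rideal_def
proof (intro conjI ballI allI)
  show "0 \<in> gens_ideal j" using I0_gens_ideal rideal_0[OF I0] by blast
next
  fix a a' assume "a \<in> gens_ideal j" "a' \<in> gens_ideal j"
  then obtain b b' where "a - (\<Sum>l<j. f l * b l) \<in> I0" "a' - (\<Sum>l<j. f l * b' l) \<in> I0"
    by (auto simp: gens_ideal_def)
  from rideal_add[OF I0 this] show "a + a' \<in> gens_ideal j"
    by (intro gens_ideal_I[of _ "\<lambda>l. b l + b' l"]) (simp add: algebra_simps sum.distrib)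
next
  fix r a assume "a \<in> gens_ideal j"
  then obtain b where "a - (\<Sum>l<j. f l * b l) \<in> I0"
    by (auto simp: gens_ideal_def)
  from rideal_mult[OF I0 this, of r] show "r * a \<in> gens_ideal j"
    by (intro gens_ideal_I[of _ "\<lambda>l. r * b l"]) (simp add: algebra_simps sum_distrib_left)
qed

lemma gens_ideal_0: "gens_ideal 0 = I0"
  by (simp add: gens_ideal_def)

lemma gens_ideal_gen: "l < j \<Longrightarrow> f l \<in> gens_ideal j"
proof (rule gens_ideal_I[of _ "\<lambda>k. if k = l then 1 else 0"])
  assume "l < j"
  have "(\<Sum>k<j. f k * (if k = l then 1 else 0)) = (\<Sum>k<j. if k = l then f k else 0)"
    by (rule sum.cong) auto
  then show "f l - (\<Sum>k<j. f k * (if k = l then 1 else 0)) \<in> I0"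
    using \<open>l < j\<close> rideal_0[OF I0] by simp
qed

lemma gens_ideal_Suc: "a \<in> gens_ideal (Suc j) \<longleftrightarrow> (\<exists>b. a - f j * b \<in> gens_ideal j)"
proof
  assume "a \<in> gens_ideal (Suc j)"
  then obtain b where "a - (\<Sum>l<Suc j. f l * b l) \<in> I0" by (auto simp: gens_ideal_def)
  then have "a - f j * b j \<in> gens_ideal j" by (intro gens_ideal_I[of _ b]) (simp add: algebra_simps)
  then show "\<exists>b. a - f j * b \<in> gens_ideal j" ..
next
  assume "\<exists>b. a - f j * b \<in> gens_ideal j"
  then obtain b b' where "a - f j * b - (\<Sum>l<j. f l * b' l) \<in> I0" by (auto simp: gens_ideal_def)
  then show "a \<in> gens_ideal (Suc j)"
    by (intro gens_ideal_I[of _ "\<lambda>l. if l < j then b' l else b"]) (simp add: algebra_simps)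
qed

lemma gens_ideal_Suc_mono: "a \<in> gens_ideal j \<Longrightarrow> a \<in> gens_ideal (Suc j)"
  unfolding gens_ideal_Suc by (intro exI[of _ 0]) simp

end

text \<open>In the application the type-class ring maps onto \<open>S\<close> with kernel \<open>I0\<close>, the \<open>f l\<close> lift the
  regular sequence, and \<open>m\<close> is the preimage of the maximal ideal.\<close>

locale reg_ideal = ideal_gens I0 f
  for I0 :: "'p::comm_ring_1 set" and f :: "nat \<Rightarrow> 'p" +
  fixes m :: "'p set" and c :: nat
  assumes m: "rideal m" and I0_m: "I0 \<subseteq> m"
    and f_m: "\<And>l. l < c \<Longrightarrow> f l \<in> m"
    and one_m: "1 \<notin> m"
    and m_max: "\<And>a. a \<notin> m \<Longrightarrow> \<exists>b. a * b - 1 \<in> m"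
    and regI: "\<And>j a. j < c \<Longrightarrow> f j * a \<in> gens_ideal j \<Longrightarrow> a \<in> gens_ideal j"
begin

lemma gens_ideal_m: "j \<le> c \<Longrightarrow> a \<in> gens_ideal j \<Longrightarrow> a \<in> m"
proof -
  assume "j \<le> c" "a \<in> gens_ideal j"
  then obtain b where "a - (\<Sum>l<j. f l * b l) \<in> I0" by (auto simp: gens_ideal_def)
  moreover have "(\<Sum>l<j. f l * b l) \<in> m"
    using \<open>j \<le> c\<close> by (intro rideal_sum[OF m] rideal_mult'[OF m] f_m) simp
  ultimately show "a \<in> m" using rideal_cong[OF m] I0_m by blast
qed

lemma reg_relation_last:
  assumes "j < c" "(\<Sum>l<Suc j. f l * a l) \<in> I0"
  shows "a j \<in> gens_ideal j"
proof (rule regI[OF assms(1)], rule gens_ideal_I[of _ "\<lambda>l. - a l"])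
  show "f j * a j - (\<Sum>l<j. f l * - a l) \<in> I0"
    using assms(2) by (simp add: sum_negf algebra_simps)
qed

text \<open>Vanishing of the first Koszul homology in disguise. The last coefficient lies in the
  ideal of its predecessors by regularity; writing it as their combination and redistributing
  shortens the relation. This is what permits comparing coefficients of the
  \<open>f l\<close>.\<close>

lemma reg_relation:
  assumes "j \<le> c" "(\<Sum>l<j. f l * a l) \<in> I0" "l < j"
  shows "a l \<in> gens_ideal j"
  using assms
proof (induction j arbitrary: a)
  case (Suc j)
  have j: "j < c" using Suc by simp
  from reg_relation_last[OF j Suc.prems(2)] obtain b where b: "a j - (\<Sum>l<j. f l * b l) \<in> I0"
    by (auto simp: gens_ideal_def)
  show ?case
  proof (cases "l = j")
    case True then show ?thesis using reg_relation_last[OF j Suc.prems(2)] gens_ideal_Suc_mono by blast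
  next
    case False
    have "(\<Sum>l<Suc j. f l * a l) - f j * (a j - (\<Sum>l<j. f l * b l)) \<in> I0"
      by (rule rideal_diff[OF I0 Suc.prems(2) rideal_mult[OF I0 b]])
    then have "(\<Sum>l<j. f l * (a l + f j * b l)) \<in> I0"
      by (simp add: algebra_simps sum.distrib sum_distrib_left)
    then have "a l + f j * b l \<in> gens_ideal j" using Suc.IH[of "\<lambda>l. a l + f j * b l"] Suc.prems False j by simp
    moreover have "f j * b l \<in> gens_ideal (Suc j)" by (rule rideal_mult'[OF gens_ideal_ideal gens_ideal_gen]) simp
    ultimately have "a l + f j * b l - f j * b l \<in> gens_ideal (Suc j)"
      using rideal_diff[OF gens_ideal_ideal] gens_ideal_Suc_mono by blast
    then show ?thesis by simp
  qed
qed simp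

text \<open>\<open>F n\<close> is free on the index set \<open>B n\<close>, and \<open>D n : F (n + 1) \<rightarrow> F n\<close>, \<open>T l n : F (n + 2) \<rightarrow> F n\<close>
  are matrices whose columns are indexed by the basis of the source. Thus \<open>D\<close> is a differential
  only modulo \<open>f 0, \<dots>, f (j - 1)\<close>, and the \<open>T l\<close> are the operators of the complex over that
  quotient.\<close>

definition cdg :: "nat \<Rightarrow> (int \<Rightarrow> nat set) \<Rightarrow> (int \<Rightarrow> nat \<Rightarrow> nat \<Rightarrow> 'p) \<Rightarrow> (nat \<Rightarrow> int \<Rightarrow> nat \<Rightarrow> nat \<Rightarrow> 'p) \<Rightarrow> bool" where
  "cdg j B D T \<longleftrightarrow> j \<le> c \<and> (\<forall>n. finite (B n)) \<and> (\<forall>n<0. B n = {}) \<and>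
     (\<forall>n. \<forall>p\<in>B n. \<forall>q\<in>B (n + 2).
        matmul (B (n + 1)) (D n) (D (n + 1)) p q - (\<Sum>l<j. f l * T l n p q) \<in> I0)"

lemma matmul_sum_left: "matmul K (\<lambda>p k. \<Sum>l\<in>L. f l * A l p k) C p q = (\<Sum>l\<in>L. f l * matmul K (A l) C p q)"
  unfolding matmul_def sum_distrib_left sum_distrib_right mult.assoc by (rule sum.swap)

lemma matmul_sum_right: "matmul K C (\<lambda>k q. \<Sum>l\<in>L. f l * A l k q) p q = (\<Sum>l\<in>L. f l * matmul K C (A l) p q)"
  unfolding matmul_def sum_distrib_left mult.left_commute[of "C p _" "f _"] by (rule sum.swap)

lemmas matmul_sum = matmul_sum_left matmul_sum_right

lemma matmul_cong:
  assumes "rideal J" "\<And>k. k \<in> K \<Longrightarrow> A p k - A' p k \<in> J" "\<And>k. k \<in> K \<Longrightarrow> C k q - C' k q \<in> J"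
  shows "matmul K A C p q - matmul K A' C' p q \<in> J"
  unfolding matmul_def
proof (rule rideal_sum_diff[OF assms(1)])
  fix k assume k: "k \<in> K"
  have "(A p k - A' p k) * C k q + A' p k * (C k q - C' k q) \<in> J"
    by (intro rideal_add[OF assms(1)] rideal_mult[OF assms(1)] rideal_mult'[OF assms(1)] assms k)
  then show "A p k * C k q - A' p k * C' k q \<in> J" by (simp add: algebra_simps)
qed

text \<open>Associativity of \<open>D D D\<close>: replacing the first two or the last two factors
  by the combination of the \<open>T l\<close> gives two expansions of the same matrix.\<close>

lemma cdg_chain_relation:
  assumes "cdg j B D T" "p \<in> B n" "q \<in> B (n + 3)"
  shows "(\<Sum>l<j. f l * (matmul (B (n + 2)) (T l n) (D (n + 2)) p q - matmul (B (n + 1)) (D n) (T l (n + 1)) p q)) \<in> I0"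
proof -
  have rel: "matmul (B (n + 1)) (D n) (D (n + 1)) p q - (\<Sum>l<j. f l * T l n p q) \<in> I0"
    if "p \<in> B n" "q \<in> B (n + 2)" for n p q
    using assms(1) that by (auto simp: cdg_def)
  have 1: "matmul (B (n + 2)) (matmul (B (n + 1)) (D n) (D (n + 1))) (D (n + 2)) p q
     - matmul (B (n + 2)) (\<lambda>p q. \<Sum>l<j. f l * T l n p q) (D (n + 2)) p q \<in> I0"
    by (rule matmul_cong[OF I0]) (use rel[OF assms(2)] rideal_0[OF I0] in auto)
  have 2: "matmul (B (n + 1)) (D n) (matmul (B (n + 2)) (D (n + 1)) (D (n + 2))) p q
     - matmul (B (n + 1)) (D n) (\<lambda>p q. \<Sum>l<j. f l * T l (n + 1) p q) p q \<in> I0"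
    by (rule matmul_cong[OF I0]) (use rel[of _ "n + 1" q] assms(3) rideal_0[OF I0] in \<open>auto simp: add.assoc\<close>)
  from rideal_diff[OF I0 2 1] show ?thesis
    by (simp add: matmul_assoc matmul_sum right_diff_distrib sum_subtractf)
qed

lemma cdg_chain:
  assumes "cdg j B D T" "p \<in> B n" "q \<in> B (n + 3)" "l < j"
  shows "matmul (B (n + 2)) (T l n) (D (n + 2)) p q - matmul (B (n + 1)) (D n) (T l (n + 1)) p q \<in> gens_ideal j"
  using reg_relation[OF _ cdg_chain_relation[OF assms(1-3)] assms(4)] assms(1) by (auto simp: cdg_def)

text \<open>Sharper than \<open>cdg_chain\<close> for the operator of the last element: its
  commutator with \<open>D\<close> vanishes already modulo the first \<open>j\<close> elements. The
  cone lives over that quotient and needs exactly this.\<close>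

lemma cdg_chain_last:
  assumes "cdg (Suc j) B D T" "p \<in> B n" "q \<in> B (n + 3)"
  shows "matmul (B (n + 2)) (T j n) (D (n + 2)) p q - matmul (B (n + 1)) (D n) (T j (n + 1)) p q \<in> gens_ideal j"
  using reg_relation_last[OF _ cdg_chain_relation[OF assms(1-3)]] assms(1) by (auto simp: cdg_def)

text \<open>Write \<open>T i D - D T i = \<Sum>l. f l H l\<close>. Expanding \<open>T i D\<^sup>2 - D\<^sup>2 T i\<close> in two ways
  and comparing the coefficients of the \<open>f l\<close> shows that \<open>H l\<close> is a homotopy between
  \<open>T i T l\<close> and \<open>T l T i\<close>.\<close>

lemma cdg_comm:
  assumes "cdg j B D T" "i < j" "l < j"
  shows "\<exists>H. \<forall>n. \<forall>p\<in>B n. \<forall>q\<in>B (n + 4).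
    matmul (B (n + 2)) (T i n) (T l (n + 2)) p q - matmul (B (n + 2)) (T l n) (T i (n + 2)) p q
    - (matmul (B (n + 3)) (H n) (D (n + 3)) p q + matmul (B (n + 1)) (D n) (H (n + 1)) p q) \<in> gens_ideal j"
proof -
  have rel: "matmul (B (n + 1)) (D n) (D (n + 1)) p q - (\<Sum>l<j. f l * T l n p q) \<in> I0"
    if "p \<in> B n" "q \<in> B (n + 2)" for n p q
    using assms(1) that by (auto simp: cdg_def)
  have "\<forall>n p q. \<exists>h. p \<in> B n \<longrightarrow> q \<in> B (n + 3) \<longrightarrow>
      matmul (B (n + 2)) (T i n) (D (n + 2)) p q - matmul (B (n + 1)) (D n) (T i (n + 1)) p q - (\<Sum>l<j. f l * h l) \<in> I0"
    using cdg_chain[OF assms(1) _ _ assms(2)] unfolding gens_ideal_def by blast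
  then obtain h where h: "\<And>n p q. p \<in> B n \<Longrightarrow> q \<in> B (n + 3) \<Longrightarrow>
      matmul (B (n + 2)) (T i n) (D (n + 2)) p q - matmul (B (n + 1)) (D n) (T i (n + 1)) p q - (\<Sum>l<j. f l * h n p q l) \<in> I0"
    unfolding choice_iff by blast
  define H where "H l n = (\<lambda>p q. h n p q l)" for l n
  have "matmul (B (n + 2)) (T i n) (T l (n + 2)) p q - matmul (B (n + 2)) (T l n) (T i (n + 2)) p q
    - (matmul (B (n + 3)) (H l n) (D (n + 3)) p q + matmul (B (n + 1)) (D n) (H l (n + 1)) p q) \<in> gens_ideal j"
    if p: "p \<in> B n" and q: "q \<in> B (n + 4)" for n p q
  proof -
    let ?X = "matmul (B (n + 2)) (T i n) (D (n + 2))" and ?Y = "matmul (B (n + 1)) (D n) (T i (n + 1))"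
    let ?X' = "matmul (B (n + 3)) (T i (n + 1)) (D (n + 3))" and ?Y' = "matmul (B (n + 2)) (D (n + 1)) (T i (n + 2))"
    have 1: "matmul (B (n + 3)) (\<lambda>p q. ?X p q - ?Y p q) (D (n + 3)) p q
       - matmul (B (n + 3)) (\<lambda>p q. \<Sum>l<j. f l * H l n p q) (D (n + 3)) p q \<in> I0"
      by (rule matmul_cong[OF I0]) (use h[OF p] rideal_0[OF I0] in \<open>auto simp: H_def\<close>)
    have 2: "matmul (B (n + 1)) (D n) (\<lambda>p q. ?X' p q - ?Y' p q) p q
       - matmul (B (n + 1)) (D n) (\<lambda>p q. \<Sum>l<j. f l * H l (n + 1) p q) p q \<in> I0"
      by (rule matmul_cong[OF I0])
        (use h[of _ "n + 1" q] q rideal_0[OF I0] in \<open>auto simp: H_def add.assoc\<close>)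
    have 3: "matmul (B (n + 2)) (T i n) (matmul (B (n + 3)) (D (n + 2)) (D (n + 3))) p q
       - matmul (B (n + 2)) (T i n) (\<lambda>p q. \<Sum>l<j. f l * T l (n + 2) p q) p q \<in> I0"
      by (rule matmul_cong[OF I0])
        (use rel[of _ "n + 2" q] q rideal_0[OF I0] in \<open>auto simp: add.assoc\<close>)
    have 4: "matmul (B (n + 2)) (matmul (B (n + 1)) (D n) (D (n + 1))) (T i (n + 2)) p q
       - matmul (B (n + 2)) (\<lambda>p q. \<Sum>l<j. f l * T l n p q) (T i (n + 2)) p q \<in> I0"
      by (rule matmul_cong[OF I0]) (use rel[OF p] rideal_0[OF I0] in auto)
    have matmul_diff: "matmul K (\<lambda>p q. A p q - A' p q) C p q = matmul K A C p q - matmul K A' C p q"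
      "matmul K C (\<lambda>p q. A p q - A' p q) p q = matmul K C A p q - matmul K C A' p q" for K A A' C p q
      by (simp_all add: matmul_def algebra_simps sum_subtractf)
    \<comment> \<open>The products \<open>T i D D\<close>, \<open>D T i D\<close> and
      \<open>D D T i\<close>. The four relations below are added with signs so that all three
      cancel.\<close>
    define a1 a2 a3 where "a1 = matmul (B (n + 2)) (T i n) (matmul (B (n + 3)) (D (n + 2)) (D (n + 3))) p q"
      and "a2 = matmul (B (n + 1)) (D n) (matmul (B (n + 3)) (T i (n + 1)) (D (n + 3))) p q"
      and "a3 = matmul (B (n + 1)) (D n) (matmul (B (n + 2)) (D (n + 1)) (T i (n + 2))) p q"
    have 1: "a1 - a2 - (\<Sum>l<j. f l * matmul (B (n + 3)) (H l n) (D (n + 3)) p q) \<in> I0"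
      using 1 unfolding matmul_diff matmul_sum matmul_assoc a1_def a2_def .
    have 2: "a2 - a3 - (\<Sum>l<j. f l * matmul (B (n + 1)) (D n) (H l (n + 1)) p q) \<in> I0"
      using 2 unfolding matmul_diff matmul_sum matmul_assoc a2_def a3_def .
    have 3: "a1 - (\<Sum>l<j. f l * matmul (B (n + 2)) (T i n) (T l (n + 2)) p q) \<in> I0"
      using 3 unfolding matmul_sum a1_def .
    have 4: "a3 - (\<Sum>l<j. f l * matmul (B (n + 2)) (T l n) (T i (n + 2)) p q) \<in> I0"
      using 4 unfolding matmul_sum matmul_assoc a3_def .
    have "(\<Sum>l<j. f l * (matmul (B (n + 2)) (T i n) (T l (n + 2)) p q - matmul (B (n + 2)) (T l n) (T i (n + 2)) p q
      - (matmul (B (n + 3)) (H l n) (D (n + 3)) p q + matmul (B (n + 1)) (D n) (H l (n + 1)) p q))) \<in> I0"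
      (is "?s \<in> I0")
    proof -
      have eq: "?s = (\<Sum>l<j. f l * matmul (B (n + 2)) (T i n) (T l (n + 2)) p q)
          - (\<Sum>l<j. f l * matmul (B (n + 2)) (T l n) (T i (n + 2)) p q)
          - ((\<Sum>l<j. f l * matmul (B (n + 3)) (H l n) (D (n + 3)) p q)
             + (\<Sum>l<j. f l * matmul (B (n + 1)) (D n) (H l (n + 1)) p q))"
        by (simp add: right_diff_distrib distrib_left sum_subtractf sum.distrib)
      show ?thesis unfolding eq
        using rideal_diff[OF I0 rideal_add[OF I0 rideal_add[OF I0 1 2] 4] 3] by (simp add: algebra_simps)
    qed
    from reg_relation[OF _ this assms(3)] assms(1) show ?thesis by (simp add: cdg_def)
  qed
  then show ?thesis by blast
qed

end

section \<open>Cohomology and the cone of an operator\<close>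

definition vscale :: "'p::comm_ring_1 \<Rightarrow> (nat \<Rightarrow> 'p) \<Rightarrow> nat \<Rightarrow> 'p" where
  "vscale a x = (\<lambda>q. a * x q)"

lemma vscale_add: "vscale a (x + y) = vscale a x + vscale a y"
  and vscale_neg: "vscale (- 1) x = - x"
  by (auto simp: vscale_def algebra_simps fun_eq_iff)

definition act :: "(int \<Rightarrow> nat set) \<Rightarrow> (nat \<Rightarrow> int \<Rightarrow> nat \<Rightarrow> nat \<Rightarrow> 'p::comm_ring_1) \<Rightarrow> nat \<Rightarrow> int \<Rightarrow> (nat \<Rightarrow> 'p) \<Rightarrow> nat \<Rightarrow> 'p" where
  "act B T l n x = rowmul (B n) x (T l n)"

text \<open>The cone \<open>F n \<oplus> F (n - 1)\<close> has its summands indexed by the even and the odd numbers. Its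
  differential \<open>[[D, a], [- T, - D]]\<close> trades the relation \<open>a\<close> for the operator \<open>T\<close>: if
  \<open>D\<^sup>2 = a T\<close>, it squares to zero.\<close>

definition cone_ix :: "(int \<Rightarrow> nat set) \<Rightarrow> int \<Rightarrow> nat set" where
  "cone_ix B n = (\<lambda>q. 2 * q) ` B n \<union> (\<lambda>q. 2 * q + 1) ` B (n - 1)"

definition blk :: "(nat \<Rightarrow> nat \<Rightarrow> 'p) \<Rightarrow> (nat \<Rightarrow> nat \<Rightarrow> 'p) \<Rightarrow> (nat \<Rightarrow> nat \<Rightarrow> 'p) \<Rightarrow> (nat \<Rightarrow> nat \<Rightarrow> 'p) \<Rightarrow> nat \<Rightarrow> nat \<Rightarrow> 'p" where
  "blk A11 A12 A21 A22 p q =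
     (if even p then if even q then A11 (p div 2) (q div 2) else A12 (p div 2) (q div 2)
      else if even q then A21 (p div 2) (q div 2) else A22 (p div 2) (q div 2))"

lemma blk_simps [simp]:
  "blk A11 A12 A21 A22 (2 * p) (2 * q) = A11 p q"
  "blk A11 A12 A21 A22 (2 * p) (Suc (2 * q)) = A12 p q"
  "blk A11 A12 A21 A22 (Suc (2 * p)) (2 * q) = A21 p q"
  "blk A11 A12 A21 A22 (Suc (2 * p)) (Suc (2 * q)) = A22 p q"
  by (simp_all add: blk_def)

lemma blk_simps' [simp]:
  "blk A11 A12 A21 A22 (p * 2) (q * 2) = A11 p q"
  "blk A11 A12 A21 A22 (p * 2) (Suc (q * 2)) = A12 p q"
  "blk A11 A12 A21 A22 (Suc (p * 2)) (q * 2) = A21 p q"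
  "blk A11 A12 A21 A22 (Suc (p * 2)) (Suc (q * 2)) = A22 p q"
  by (simp_all add: blk_def)

lemma sum_cone_ix:
  assumes "\<And>n. finite (B n)"
  shows "sum g (cone_ix B n) = (\<Sum>k\<in>B n. g (2 * k)) + (\<Sum>k\<in>B (n - 1). g (Suc (2 * k)))"
proof -
  have "(\<lambda>q. 2 * q) ` B n \<inter> (\<lambda>q. Suc (2 * q)) ` B (n - 1) = {}"
    by auto presburger
  moreover have "inj_on (\<lambda>q::nat. 2 * q) X" "inj_on (\<lambda>q::nat. Suc (2 * q)) X" for X
    by (auto simp: inj_on_def)
  ultimately show ?thesis unfolding cone_ix_def
    by (subst sum.union_disjoint) (simp_all add: assms sum.reindex)
qed

lemma cone_ix_cases:
  assumes "p \<in> cone_ix B n"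
  obtains q where "p = 2 * q" "q \<in> B n" | q where "p = Suc (2 * q)" "q \<in> B (n - 1)"
  using assms by (auto simp: cone_ix_def)

lemma cone_ix_even [simp]: "2 * q \<in> cone_ix B n \<longleftrightarrow> q \<in> B n"
  and cone_ix_odd [simp]: "Suc (2 * q) \<in> cone_ix B n \<longleftrightarrow> q \<in> B (n - 1)"
  by (auto simp: cone_ix_def) presburger+

definition cone_D :: "'p \<Rightarrow> (int \<Rightarrow> nat \<Rightarrow> nat \<Rightarrow> 'p::comm_ring_1) \<Rightarrow> (int \<Rightarrow> nat \<Rightarrow> nat \<Rightarrow> 'p) \<Rightarrow> int \<Rightarrow> nat \<Rightarrow> nat \<Rightarrow> 'p" where
  "cone_D a D T n = blk (D n) (\<lambda>p q. if p = q then a else 0) (\<lambda>p q. - T (n - 1) p q) (\<lambda>p q. - D (n - 1) p q)"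

text \<open>The coefficient of \<open>f l\<close> in the square of the cone differential. The
  intended \<open>H l\<close> is the coefficient of \<open>f l\<close> in the commutator
  \<open>D T j - T j D\<close>, which is the lower left block of that square.\<close>

definition cone_T :: "(nat \<Rightarrow> int \<Rightarrow> nat \<Rightarrow> nat \<Rightarrow> 'p::comm_ring_1) \<Rightarrow> (nat \<Rightarrow> int \<Rightarrow> nat \<Rightarrow> nat \<Rightarrow> 'p) \<Rightarrow> nat \<Rightarrow> int \<Rightarrow> nat \<Rightarrow> nat \<Rightarrow> 'p" where
  "cone_T T H l n = blk (T l n) (\<lambda>p q. 0) (H l (n - 1)) (T l (n - 1))"

text \<open>Composition of a functional on \<open>F n\<close> with the projection of the cone onto
  \<open>F n\<close>. The projection commutes with the differentials modulo the relation
  \<open>a\<close>, and on cohomology with values in the residue field it induces the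
  change-of-rings map.\<close>

definition cone_in :: "(nat \<Rightarrow> 'p::comm_ring_1) \<Rightarrow> nat \<Rightarrow> 'p" where
  "cone_in x = (\<lambda>k. if even k then x (k div 2) else 0)"

lemma cone_in_simps [simp]: "cone_in x (2 * k) = x k" "cone_in x (Suc (2 * k)) = 0"
  by (simp_all add: cone_in_def)

context reg_ideal begin

text \<open>Together with \<open>coboundaries\<close> this presents the cohomology of Hom(F, k) for
  the residue field k; a row vector over the type-class ring is read modulo
  \<open>m\<close>.\<close>

definition cocycles :: "(int \<Rightarrow> nat set) \<Rightarrow> (int \<Rightarrow> nat \<Rightarrow> nat \<Rightarrow> 'p) \<Rightarrow> int \<Rightarrow> (nat \<Rightarrow> 'p) set" where
  "cocycles B D n = {x. \<forall>q\<in>B (n + 1). rowmul (B n) x (D n) q \<in> m}"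

definition coboundaries :: "(int \<Rightarrow> nat set) \<Rightarrow> (int \<Rightarrow> nat \<Rightarrow> nat \<Rightarrow> 'p) \<Rightarrow> int \<Rightarrow> (nat \<Rightarrow> 'p) set" where
  "coboundaries B D n = {x. \<exists>y. \<forall>q\<in>B n. x q - rowmul (B (n - 1)) y (D (n - 1)) q \<in> m}"

lemma rowmul_cong_row: "(\<And>k. k \<in> K \<Longrightarrow> x k - y k \<in> m) \<Longrightarrow> rowmul K x A q - rowmul K y A q \<in> m"
  unfolding rowmul_def
  by (rule rideal_sum_diff[OF m]) (metis left_diff_distrib rideal_mult'[OF m])

lemma rowmul_in_m: "(\<And>k. k \<in> K \<Longrightarrow> x k \<in> m) \<Longrightarrow> rowmul K x A q \<in> m"
  unfolding rowmul_def by (rule rideal_sum[OF m]) (rule rideal_mult'[OF m])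

lemma sum_mult_cong: "(\<And>k. k \<in> K \<Longrightarrow> A k - A' k \<in> m) \<Longrightarrow> (\<Sum>k\<in>K. x k * A k) - (\<Sum>k\<in>K. x k * A' k) \<in> m"
  by (rule rideal_sum_diff[OF m]) (metis right_diff_distrib rideal_mult[OF m])

lemma cdg_DD:
  assumes "cdg j B D T" "p \<in> B n" "q \<in> B (n + 2)"
  shows "matmul (B (n + 1)) (D n) (D (n + 1)) p q \<in> m"
proof -
  have "matmul (B (n + 1)) (D n) (D (n + 1)) p q - (\<Sum>l<j. f l * T l n p q) \<in> m" and "j \<le> c"
    using assms I0_m by (auto simp: cdg_def)
  moreover have "(\<Sum>l<j. f l * T l n p q) \<in> m"
    using \<open>j \<le> c\<close> by (intro rideal_sum[OF m] rideal_mult'[OF m] f_m) simp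
  ultimately show ?thesis using rideal_cong[OF m] by blast
qed

lemma cdg_TD:
  assumes "cdg j B D T" "p \<in> B n" "q \<in> B (n + 3)" "l < j"
  shows "matmul (B (n + 2)) (T l n) (D (n + 2)) p q - matmul (B (n + 1)) (D n) (T l (n + 1)) p q \<in> m"
  using gens_ideal_m[OF _ cdg_chain[OF assms]] assms(1) by (simp add: cdg_def)

lemma coboundaries_cocycles: "cdg j B D T \<Longrightarrow> coboundaries B D n \<subseteq> cocycles B D n"
proof
  fix x assume c: "cdg j B D T" and "x \<in> coboundaries B D n"
  then obtain y where y: "\<And>q. q \<in> B n \<Longrightarrow> x q - rowmul (B (n - 1)) y (D (n - 1)) q \<in> m"
    by (auto simp: coboundaries_def)
  show "x \<in> cocycles B D n" unfolding cocycles_def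
  proof (clarify)
    fix q assume q: "q \<in> B (n + 1)"
    have "rowmul (B n) (rowmul (B (n - 1)) y (D (n - 1))) (D n) q \<in> m"
      unfolding rowmul_rowmul
      by (rule rideal_sum[OF m], rule rideal_mult[OF m])
        (use cdg_DD[OF c, of _ "n - 1" q] q in \<open>simp add: add.commute\<close>)
    moreover have "rowmul (B n) x (D n) q - rowmul (B n) (rowmul (B (n - 1)) y (D (n - 1))) (D n) q \<in> m"
      by (rule rowmul_cong_row[OF y])
    ultimately show "rowmul (B n) x (D n) q \<in> m" using rideal_cong[OF m] by blast
  qed
qed

lemma act_commute:
  assumes "cdg j B D T" "l < j" "q \<in> B (n + 3)"
  shows "rowmul (B (n + 2)) (act B T l n x) (D (n + 2)) q - act B T l (n + 1) (rowmul (B n) x (D n)) q \<in> m"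
  unfolding act_def rowmul_rowmul
  by (rule sum_mult_cong) (rule cdg_TD[OF assms(1) _ assms(3,2)])

lemma act_cocycles:
  assumes "cdg j B D T" "l < j" "x \<in> cocycles B D n"
  shows "act B T l n x \<in> cocycles B D (n + 2)"
  unfolding cocycles_def
proof clarify
  fix q assume q: "q \<in> B (n + 2 + 1)"
  have "act B T l (n + 1) (rowmul (B n) x (D n)) q \<in> m" unfolding act_def
    by (rule rowmul_in_m) (use assms(3) in \<open>simp add: cocycles_def\<close>)
  then show "rowmul (B (n + 2)) (act B T l n x) (D (n + 2)) q \<in> m"
    using rideal_cong[OF m] act_commute[OF assms(1,2), of q n x] q by (auto simp: add.assoc)
qed

lemma act_coboundaries:
  assumes "cdg j B D T" "l < j" "x \<in> coboundaries B D n"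
  shows "act B T l n x \<in> coboundaries B D (n + 2)"
proof -
  from assms(3) obtain y where y: "\<And>q. q \<in> B n \<Longrightarrow> x q - rowmul (B (n - 1)) y (D (n - 1)) q \<in> m"
    by (auto simp: coboundaries_def)
  have "act B T l n x q - rowmul (B (n + 1)) (act B T l (n - 1) y) (D (n + 1)) q \<in> m" if "q \<in> B (n + 2)" for q
  proof -
    have 1: "act B T l n x q - act B T l n (rowmul (B (n - 1)) y (D (n - 1))) q \<in> m"
      unfolding act_def by (rule rowmul_cong_row[OF y])
    have 2: "rowmul (B (n + 1)) (act B T l (n - 1) y) (D (n + 1)) q - act B T l n (rowmul (B (n - 1)) y (D (n - 1))) q \<in> m"
      using act_commute[OF assms(1,2), of q "n - 1" y] that by (simp add: add.commute)
    from rideal_diff[OF m 1 2] show ?thesis by simp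
  qed
  then show ?thesis unfolding coboundaries_def by (auto simp: add_diff_eq[symmetric])
qed

text \<open>Compose the homotopy \<open>H\<close> of \<open>cdg_comm\<close> with the cocycle
  \<open>x\<close>: the summand \<open>x D H\<close> vanishes modulo \<open>m\<close>, and
  \<open>x H D\<close> is the coboundary. Rows are multiplied from the right, so applying
  \<open>T i\<close> first gives the product \<open>T i T l\<close>, whence the exchanged
  indices.\<close>

lemma act_act_comm:
  assumes "cdg j B D T" "l < j" "i < j" "x \<in> cocycles B D n"
  shows "act B T l (n + 2) (act B T i n x) - act B T i (n + 2) (act B T l n x) \<in> coboundaries B D (n + 4)"
proof -
  obtain H where H: "\<And>n p q. p \<in> B n \<Longrightarrow> q \<in> B (n + 4) \<Longrightarrow>
    matmul (B (n + 2)) (T i n) (T l (n + 2)) p q - matmul (B (n + 2)) (T l n) (T i (n + 2)) p q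
    - (matmul (B (n + 3)) (H n) (D (n + 3)) p q + matmul (B (n + 1)) (D n) (H (n + 1)) p q) \<in> gens_ideal j"
    using cdg_comm[OF assms(1,3,2)] by blast
  have j: "j \<le> c" using assms(1) by (simp add: cdg_def)
  have "(act B T l (n + 2) (act B T i n x) - act B T i (n + 2) (act B T l n x)) q
    - rowmul (B (n + 3)) (rowmul (B n) x (H n)) (D (n + 3)) q \<in> m" if q: "q \<in> B (n + 4)" for q
  proof -
    have 1: "rowmul (B (n + 1)) (rowmul (B n) x (D n)) (H (n + 1)) q \<in> m"
      by (rule rowmul_in_m) (use assms(4) in \<open>simp add: cocycles_def\<close>)
    have "(\<Sum>k\<in>B n. x k * (matmul (B (n + 2)) (T i n) (T l (n + 2)) k q - matmul (B (n + 2)) (T l n) (T i (n + 2)) k q))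
      - (\<Sum>k\<in>B n. x k * (matmul (B (n + 3)) (H n) (D (n + 3)) k q + matmul (B (n + 1)) (D n) (H (n + 1)) k q)) \<in> m"
      by (rule sum_mult_cong, rule gens_ideal_m[OF j H]) (use q in auto)
    then have 2: "act B T l (n + 2) (act B T i n x) q - act B T i (n + 2) (act B T l n x) q
      - (rowmul (B (n + 3)) (rowmul (B n) x (H n)) (D (n + 3)) q
         + rowmul (B (n + 1)) (rowmul (B n) x (D n)) (H (n + 1)) q) \<in> m"
      unfolding act_def rowmul_rowmul by (simp add: right_diff_distrib distrib_left sum_subtractf sum.distrib)
    show ?thesis using rideal_add[OF m 2 1] by (simp add: algebra_simps)
  qed
  then show ?thesis unfolding coboundaries_def by (auto simp: add_diff_eq[symmetric])
qed

lemma cocycles_add: "x \<in> cocycles B D n \<Longrightarrow> y \<in> cocycles B D n \<Longrightarrow> x + y \<in> cocycles B D n"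
  by (simp add: cocycles_def rowmul_add rideal_add[OF m])

lemma cocycles_sc: "x \<in> cocycles B D n \<Longrightarrow> vscale a x \<in> cocycles B D n"
  by (simp add: cocycles_def vscale_def rowmul_scale rideal_mult[OF m])

lemma coboundaries_add: "x \<in> coboundaries B D n \<Longrightarrow> y \<in> coboundaries B D n \<Longrightarrow> x + y \<in> coboundaries B D n"
proof -
  assume "x \<in> coboundaries B D n" "y \<in> coboundaries B D n"
  then obtain v w where "\<And>q. q \<in> B n \<Longrightarrow> x q - rowmul (B (n - 1)) v (D (n - 1)) q \<in> m"
    "\<And>q. q \<in> B n \<Longrightarrow> y q - rowmul (B (n - 1)) w (D (n - 1)) q \<in> m" by (auto simp: coboundaries_def)
  from rideal_add[OF m this] show ?thesis unfolding coboundaries_def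
    by (auto intro!: exI[of _ "v + w"] simp: rowmul_add algebra_simps)
qed

lemma coboundaries_sc: "x \<in> coboundaries B D n \<Longrightarrow> vscale a x \<in> coboundaries B D n"
proof -
  assume "x \<in> coboundaries B D n"
  then obtain v where "\<And>q. q \<in> B n \<Longrightarrow> x q - rowmul (B (n - 1)) v (D (n - 1)) q \<in> m" by (auto simp: coboundaries_def)
  from rideal_mult[OF m this, of _ a] show ?thesis unfolding coboundaries_def vscale_def
    by (auto intro!: exI[of _ "\<lambda>q. a * v q"] simp: rowmul_scale algebra_simps)
qed

lemma coboundaries_0: "0 \<in> coboundaries B D n"
  unfolding coboundaries_def by (auto intro!: exI[of _ 0] simp: rowmul_def rideal_0[OF m])

lemma act_add: "act B T l n (x + y) = act B T l n x + act B T l n y"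
  by (simp add: act_def rowmul_add)

lemma act_sc: "act B T l n (vscale a x) = vscale a (act B T l n x)"
  by (simp add: act_def vscale_def rowmul_scale)

lemma cdg_graded_op:
  assumes "cdg j B D T"
  shows "graded_op (cocycles B D) (coboundaries B D) vscale (- 1) (act B T) j"
  by unfold_locales
    (use assms in \<open>auto simp: act_add act_sc vscale_add vscale_neg intro: cocycles_add cocycles_sc coboundaries_add coboundaries_sc coboundaries_0
       act_cocycles act_coboundaries act_act_comm subsetD[OF coboundaries_cocycles]\<close>)

text \<open>The squared block differential has \<open>D^2 - f j T j\<close> on the diagonal, zero in
  the upper right corner and the commutator \<open>D T j - T j D\<close> in the lower left. All are
  combinations of the first \<open>j\<close> elements, the commutator by
  \<open>cdg_chain_last\<close>.\<close>

lemma cdg_cone: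
  assumes "cdg (Suc j) B D T"
  shows "\<exists>H. cdg j (cone_ix B) (cone_D (f j) D (T j)) (cone_T T H)"
proof -
  have fin: "finite (B n)" for n using assms by (simp add: cdg_def)
  have "\<forall>n p q. \<exists>h. p \<in> B n \<longrightarrow> q \<in> B (n + 3) \<longrightarrow>
      matmul (B (n + 1)) (D n) (T j (n + 1)) p q - matmul (B (n + 2)) (T j n) (D (n + 2)) p q - (\<Sum>l<j. f l * h l) \<in> I0"
    using rideal_diff_sym[OF gens_ideal_ideal cdg_chain_last[OF assms]] unfolding gens_ideal_def by blast
  then obtain h where h: "\<And>n p q. p \<in> B n \<Longrightarrow> q \<in> B (n + 3) \<Longrightarrow>
      matmul (B (n + 1)) (D n) (T j (n + 1)) p q - matmul (B (n + 2)) (T j n) (D (n + 2)) p q - (\<Sum>l<j. f l * h n p q l) \<in> I0"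
    unfolding choice_iff by blast
  define H where "H l n = (\<lambda>p q. h n p q l)" for l n
  have rel: "matmul (B (n + 1)) (D n) (D (n + 1)) p q - ((\<Sum>l<j. f l * T l n p q) + f j * T j n p q) \<in> I0"
    if "p \<in> B n" "q \<in> B (n + 2)" for n p q
    using assms that by (auto simp: cdg_def)
  let ?D = "cone_D (f j) D (T j)" and ?T = "cone_T T H" and ?B = "cone_ix B"
  have "matmul (?B (n + 1)) (?D n) (?D (n + 1)) p q - (\<Sum>l<j. f l * ?T l n p q) \<in> I0"
    if p: "p \<in> ?B n" and q: "q \<in> ?B (n + 2)" for n p q
  proof (rule cone_ix_cases[OF p]; rule cone_ix_cases[OF q])
    fix p' q' assume e: "p = 2 * p'" "p' \<in> B n" "q = 2 * q'" "q' \<in> B (n + 2)"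
    have "(\<Sum>k\<in>B n. (if p' = k then f j else 0) * T j n k q') = f j * T j n p' q'"
      using e fin by (simp add: if_distrib[of "\<lambda>x. x * _"] cong: if_cong)
    then show ?thesis using rel[OF e(2,4)]
      by (simp add: e matmul_def sum_cone_ix[OF fin] cone_D_def cone_T_def sum_negf algebra_simps)
  next
    fix p' q' assume e: "p = 2 * p'" "p' \<in> B n" "q = Suc (2 * q')" "q' \<in> B (n + 2 - 1)"
    then show ?thesis using rideal_0[OF I0] fin
      by (simp add: e matmul_def sum_cone_ix[OF fin] cone_D_def cone_T_def sum_negf algebra_simps
          if_distrib[of "\<lambda>x. x * _"] if_distrib[of "\<lambda>x. _ * x"] cong: if_cong)
  next
    fix p' q' assume e: "p = Suc (2 * p')" "p' \<in> B (n - 1)" "q = 2 * q'" "q' \<in> B (n + 2)"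
    show ?thesis using h[of p' "n - 1" q'] e
      by (simp add: e matmul_def sum_cone_ix[OF fin] cone_D_def cone_T_def sum_negf H_def algebra_simps)
  next
    fix p' q' assume e: "p = Suc (2 * p')" "p' \<in> B (n - 1)" "q = Suc (2 * q')" "q' \<in> B (n + 2 - 1)"
    have "(\<Sum>k\<in>B (n + 1). T j (n - 1) p' k * (if k = q' then f j else 0)) = f j * T j (n - 1) p' q'"
    proof -
      have "(\<Sum>k\<in>B (n + 1). T j (n - 1) p' k * (if k = q' then f j else 0))
          = (\<Sum>k\<in>B (n + 1). if k = q' then f j * T j (n - 1) p' k else 0)"
        by (rule sum.cong) (auto simp: mult.commute)
      then show ?thesis using e fin by (simp add: add.commute)
    qed
    then show ?thesis using rel[of p' "n - 1" q'] e
      by (simp add: e matmul_def sum_cone_ix[OF fin] cone_D_def cone_T_def sum_negf algebra_simps)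
  qed
  moreover have "j \<le> c" "\<forall>n. finite (?B n)" "\<forall>n<0. ?B n = {}"
    using assms by (auto simp: cdg_def cone_ix_def)
  ultimately show ?thesis unfolding cdg_def by blast
qed

lemma rowmul_cone:
  assumes "\<And>n. finite (B n)"
  shows "rowmul (cone_ix B n) x A q = (\<Sum>k\<in>B n. x (2 * k) * A (2 * k) q) + (\<Sum>k\<in>B (n - 1). x (Suc (2 * k)) * A (Suc (2 * k)) q)"
  by (simp add: rowmul_def sum_cone_ix[OF assms])

text \<open>\<open>cone_in\<close> is the map into the cohomology of the cone, and its kernel is the
  image of the last operator; this is the kernel condition of \<open>gacc_step\<close>.\<close>

lemma gacc_cone:
  assumes F: "cdg (Suc j) B D T" and G: "cdg j (cone_ix B) (cone_D (f j) D (T j)) (cone_T T H)"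
    and acc: "graded_op.gacc (cocycles (cone_ix B) (cone_D (f j) D (T j))) (coboundaries (cone_ix B) (cone_D (f j) D (T j))) vscale
      (act (cone_ix B) (cone_T T H)) j"
  shows "graded_op.gacc (cocycles B D) (coboundaries B D) vscale (act B T) (Suc j)"
proof (rule gacc_step[where rho = cone_in, OF cdg_graded_op[OF F] cdg_graded_op[OF G] _ _ _ _ _ _ acc])
  have fin: "finite (B n)" for n using F by (simp add: cdg_def)
  have fm: "f j \<in> m" using F f_m by (simp add: cdg_def)
  show "cone_in (x + y) = cone_in x + cone_in y" for x y :: "nat \<Rightarrow> 'p"
    by (auto simp: cone_in_def)
  show "cone_in (vscale a x) = vscale a (cone_in x)" for a and x :: "nat \<Rightarrow> 'p"
    by (auto simp: cone_in_def vscale_def)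
  show "cone_in x \<in> cocycles (cone_ix B) (cone_D (f j) D (T j)) n" if "x \<in> cocycles B D n" for x n
    unfolding cocycles_def
  proof clarify
    fix q assume q: "q \<in> cone_ix B (n + 1)"
    show "rowmul (cone_ix B n) (cone_in x) (cone_D (f j) D (T j) n) q \<in> m"
    proof (rule cone_ix_cases[OF q])
      fix q' assume "q = 2 * q'" "q' \<in> B (n + 1)"
      then show ?thesis using that unfolding rowmul_cone[OF fin]
        by (simp add: cone_D_def cocycles_def rowmul_def)
    next
      fix q' assume "q = Suc (2 * q')" "q' \<in> B (n + 1 - 1)"
      then show ?thesis using fm
        by (auto simp: rowmul_cone[OF fin] cone_D_def intro!: rideal_sum[OF m] rideal_mult[OF m] rideal_0[OF m])
    qed
  qed
  show "cone_in (act B T l n x) - act (cone_ix B) (cone_T T H) l n (cone_in x)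
      \<in> coboundaries (cone_ix B) (cone_D (f j) D (T j)) (n + 2)" for l n x
  proof -
    have "cone_in (act B T l n x) k = act (cone_ix B) (cone_T T H) l n (cone_in x) k" for k
    proof (cases "even k")
      case True
      then obtain i where "k = 2 * i" by blast
      then show ?thesis by (simp add: act_def rowmul_cone[OF fin] cone_T_def, simp add: rowmul_def)
    next
      case False
      then obtain i where "k = Suc (2 * i)" by (auto elim: oddE)
      then show ?thesis by (simp add: act_def rowmul_cone[OF fin] cone_T_def)
    qed
    then have "cone_in (act B T l n x) = act (cone_ix B) (cone_T T H) l n (cone_in x)" by blast
    then show ?thesis by (simp add: coboundaries_0)
  qed
  show "\<exists>y\<in>cocycles B D (n - 2). x - act B T j (n - 2) y \<in> coboundaries B D n"
    if x: "x \<in> cocycles B D n" "cone_in x \<in> coboundaries (cone_ix B) (cone_D (f j) D (T j)) n" for n x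
  proof -
    from x(2) obtain y where y: "\<And>q. q \<in> cone_ix B n \<Longrightarrow>
      cone_in x q - rowmul (cone_ix B (n - 1)) y (cone_D (f j) D (T j) (n - 1)) q \<in> m" by (auto simp: coboundaries_def)
    \<comment> \<open>In even coordinates the coboundary of \<open>y\<close> is
      \<open>y0 D + y1 T\<close>; the sign in \<open>y1\<close> compensates the block
      \<open>- T\<close>. In odd coordinates it is \<open>y1 D\<close> plus multiples of
      \<open>f j\<close>, which lie in \<open>m\<close>, so \<open>y1\<close> is a cocycle.\<close>
    define y0 y1 where "y0 = (\<lambda>k. y (2 * k))" and "y1 = (\<lambda>k. - y (Suc (2 * k)))"
    have "rowmul (B (n - 2)) y1 (D (n - 2)) q \<in> m" if "q \<in> B (n - 1)" for q
    proof -
      have "- (\<Sum>k\<in>B (n - 1). y (2 * k) * (if k = q then f j else 0)) - rowmul (B (n - 2)) y1 (D (n - 2)) q \<in> m"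
        using y[of "Suc (2 * q)"] that unfolding rowmul_cone[OF fin]
        by (simp add: cone_D_def y1_def rowmul_def sum_negf)
      moreover have "- (\<Sum>k\<in>B (n - 1). y (2 * k) * (if k = q then f j else 0)) \<in> m"
        using fm by (auto intro!: rideal_minus[OF m] rideal_sum[OF m] rideal_mult[OF m] rideal_0[OF m])
      ultimately show ?thesis using rideal_cong[OF m] by blast
    qed
    then have "y1 \<in> cocycles B D (n - 2)" by (auto simp: cocycles_def)
    moreover have "(x - act B T j (n - 2) y1) q - rowmul (B (n - 1)) y0 (D (n - 1)) q \<in> m" if "q \<in> B n" for q
      using y[of "2 * q"] that unfolding rowmul_cone[OF fin]
      by (simp add: cone_D_def y1_def y0_def act_def rowmul_def sum_negf, simp add: algebra_simps)
    ultimately show ?thesis unfolding coboundaries_def by blast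
  qed
  show "cocycles B D n \<subseteq> coboundaries B D n" if "n < 0" for n
    using F that by (auto simp: cdg_def coboundaries_def)
qed

end

section \<open>Descent along the regular sequence\<close>

definition colmul :: "nat set \<Rightarrow> (nat \<Rightarrow> nat \<Rightarrow> 'p::comm_ring_1) \<Rightarrow> (nat \<Rightarrow> 'p) \<Rightarrow> nat \<Rightarrow> 'p" where
  "colmul K A v = (\<lambda>p. \<Sum>k\<in>K. A p k * v k)"

context reg_ideal begin

text \<open>Acyclicity in positive degrees over the quotient by the first \<open>j\<close> elements.
  The cokernel in degree 0 is the resolved module and is described separately, by
  \<open>im0\<close>.\<close>

definition exact_from :: "nat \<Rightarrow> (int \<Rightarrow> nat set) \<Rightarrow> (int \<Rightarrow> nat \<Rightarrow> nat \<Rightarrow> 'p) \<Rightarrow> bool" where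
  "exact_from j B D \<longleftrightarrow> (\<forall>n\<ge>0. \<forall>v. (\<forall>p\<in>B n. colmul (B (n + 1)) (D n) v p \<in> gens_ideal j) \<longrightarrow>
     (\<exists>w. \<forall>p\<in>B (n + 1). v p - colmul (B (n + 2)) (D (n + 1)) w p \<in> gens_ideal j))"

definition im0 :: "nat \<Rightarrow> (int \<Rightarrow> nat set) \<Rightarrow> (int \<Rightarrow> nat \<Rightarrow> nat \<Rightarrow> 'p) \<Rightarrow> (nat \<Rightarrow> 'p) set" where
  "im0 j B D = {v. \<exists>w. \<forall>p\<in>B 0. v p - colmul (B 1) (D 0) w p \<in> gens_ideal j}"

lemma colmul_cone_even:
  assumes "\<And>n. finite (B n)" "p \<in> B n"
  shows "colmul (cone_ix B (n + 1)) (cone_D a D T n) v (2 * p) = colmul (B (n + 1)) (D n) (\<lambda>q. v (2 * q)) p + a * v (Suc (2 * p))"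
proof -
  have "(\<Sum>k\<in>B n. (if p = k then a else 0) * v (Suc (2 * k))) = a * v (Suc (2 * p))"
    using assms by (simp add: if_distrib[of "\<lambda>x. x * _"] cong: if_cong)
  then show ?thesis by (simp add: colmul_def sum_cone_ix[OF assms(1)] cone_D_def)
qed

lemma colmul_cone_odd:
  assumes "\<And>n. finite (B n)"
  shows "colmul (cone_ix B (n + 1)) (cone_D a D T n) v (Suc (2 * p))
    = - colmul (B (n + 1)) (T (n - 1)) (\<lambda>q. v (2 * q)) p - colmul (B n) (D (n - 1)) (\<lambda>q. v (Suc (2 * q))) p"
  by (simp add: colmul_def sum_cone_ix[OF assms(1)] cone_D_def sum_negf)

lemma colmul_cong:
  assumes "rideal J" "\<And>k. k \<in> K \<Longrightarrow> v k - w k \<in> J"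
  shows "colmul K A v p - colmul K A w p \<in> J"
  unfolding colmul_def
  by (rule rideal_sum_diff[OF assms(1)]) (metis assms right_diff_distrib rideal_mult)

lemma colmul_colmul: "colmul K A (colmul L C v) p = colmul L (matmul K A C) v p"
  by (simp add: colmul_def matmul_def sum_distrib_left sum_distrib_right mult.assoc sum.swap[of _ L])

lemma colmul_add: "colmul K A (\<lambda>k. v k + w k) p = colmul K A v p + colmul K A w p"
  by (simp add: colmul_def algebra_simps sum.distrib)

lemma colmul_scale: "colmul K A (\<lambda>k. a * v k) p = a * colmul K A v p"
  by (simp add: colmul_def algebra_simps sum_distrib_left)

lemma gens_ideal_Suc_vec:
  assumes "\<And>p. p \<in> X \<Longrightarrow> g p \<in> gens_ideal (Suc j)"
  shows "\<exists>z. \<forall>p\<in>X. g p - f j * z p \<in> gens_ideal j"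
  using assms unfolding gens_ideal_Suc by (rule bchoice[OF ballI])

text \<open>A cycle \<open>(x, y)\<close> of the cone satisfies \<open>D x = - f j y\<close>, so
  \<open>x = D w + f j z\<close> by exactness over the smaller quotient. Then
  \<open>f j (y + T w + D z) = 0\<close>, and cancelling the regular element \<open>f j\<close>
  shows that \<open>(w, z)\<close> is a preimage.\<close>

lemma cone_exact:
  assumes c: "cdg (Suc j) B D T" and ex: "exact_from (Suc j) B D"
  shows "exact_from j (cone_ix B) (cone_D (f j) D (T j))"
  unfolding exact_from_def
proof (intro allI impI)
  fix n :: int and v assume n: "n \<ge> 0"
    and v: "\<forall>p\<in>cone_ix B n. colmul (cone_ix B (n + 1)) (cone_D (f j) D (T j) n) v p \<in> gens_ideal j"
  have fin: "finite (B n)" for n using c by (simp add: cdg_def)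
  have j: "j < c" using c by (simp add: cdg_def)
  define x y where "x = (\<lambda>q. v (2 * q))" and "y = (\<lambda>q. v (Suc (2 * q)))"
  have 1: "colmul (B (n + 1)) (D n) x p + f j * y p \<in> gens_ideal j" if "p \<in> B n" for p
    using bspec[OF v, of "2 * p"] that colmul_cone_even[of B p n "f j" D "T j" v, OF fin that] by (simp add: x_def y_def)
  have "colmul (B (n + 1)) (D n) x p \<in> gens_ideal (Suc j)" if "p \<in> B n" for p
    unfolding gens_ideal_Suc using 1[OF that] by (intro exI[of _ "- y p"]) simp
  then obtain w where w: "\<And>p. p \<in> B (n + 1) \<Longrightarrow> x p - colmul (B (n + 2)) (D (n + 1)) w p \<in> gens_ideal (Suc j)"
    using ex n unfolding exact_from_def by blast
  obtain z where z: "\<And>p. p \<in> B (n + 1) \<Longrightarrow> x p - colmul (B (n + 2)) (D (n + 1)) w p - f j * z p \<in> gens_ideal j"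
    using gens_ideal_Suc_vec[of "B (n + 1)" "\<lambda>p. x p - colmul (B (n + 2)) (D (n + 1)) w p" j] w by blast
  have *: "y p + colmul (B (n + 2)) (T j n) w p + colmul (B (n + 1)) (D n) z p \<in> gens_ideal j" if p: "p \<in> B n" for p
  proof (rule regI[OF j])
    have rel: "matmul (B (n + 1)) (D n) (D (n + 1)) p q - f j * T j n p q \<in> gens_ideal j" if "q \<in> B (n + 2)" for q
    proof -
      have "matmul (B (n + 1)) (D n) (D (n + 1)) p q - ((\<Sum>l<j. f l * T l n p q) + f j * T j n p q) \<in> I0"
        using c that p by (auto simp: cdg_def)
      then show ?thesis by (intro gens_ideal_I[of _ "\<lambda>l. T l n p q"]) (simp add: algebra_simps)
    qed
    have a: "colmul (B (n + 2)) (matmul (B (n + 1)) (D n) (D (n + 1))) w p - f j * colmul (B (n + 2)) (T j n) w p \<in> gens_ideal j"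
    proof -
      have "(\<Sum>k\<in>B (n + 2). matmul (B (n + 1)) (D n) (D (n + 1)) p k * w k) - (\<Sum>k\<in>B (n + 2). f j * T j n p k * w k) \<in> gens_ideal j"
        by (rule rideal_sum_diff[OF gens_ideal_ideal]) (metis rel left_diff_distrib rideal_mult'[OF gens_ideal_ideal])
      then show ?thesis by (simp add: colmul_def sum_distrib_left mult.assoc)
    qed
    have b: "colmul (B (n + 1)) (D n) x p
       - colmul (B (n + 1)) (D n) (\<lambda>p. colmul (B (n + 2)) (D (n + 1)) w p + f j * z p) p \<in> gens_ideal j"
      by (rule colmul_cong[OF gens_ideal_ideal]) (use z in \<open>simp add: algebra_simps\<close>)
    have b': "colmul (B (n + 1)) (D n) x p - (colmul (B (n + 2)) (matmul (B (n + 1)) (D n) (D (n + 1))) w p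
       + f j * colmul (B (n + 1)) (D n) z p) \<in> gens_ideal j"
      using b by (simp add: colmul_add colmul_scale colmul_colmul)
    from rideal_diff[OF gens_ideal_ideal rideal_diff[OF gens_ideal_ideal 1[OF p] b'] a]
    show "f j * (y p + colmul (B (n + 2)) (T j n) w p + colmul (B (n + 1)) (D n) z p) \<in> gens_ideal j"
      by (simp add: algebra_simps)
  qed
  define u where "u = (\<lambda>k. if even k then w (k div 2) else z (k div 2))"
  have u: "(\<lambda>q. u (2 * q)) = w" "(\<lambda>q. u (Suc (2 * q))) = z" by (auto simp: u_def)
  have u': "u (Suc (2 * q)) = z q" for q by (auto simp: u_def)
  have "v p - colmul (cone_ix B (n + 1 + 1)) (cone_D (f j) D (T j) (n + 1)) u p \<in> gens_ideal j" if p: "p \<in> cone_ix B (n + 1)" for p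
    using p
  proof (cases rule: cone_ix_cases)
    case (1 q)
    show ?thesis using z[OF 1(2)]
      by (simp only: 1 colmul_cone_even[of B q "n + 1", OF fin 1(2)] u u', simp add: x_def algebra_simps)
  next
    case (2 q)
    then have q: "q \<in> B n" by simp
    show ?thesis using *[OF q]
      by (simp only: 2 colmul_cone_odd[of B, OF fin] u, simp add: y_def algebra_simps)
  qed
  then show "\<exists>w. \<forall>p\<in>cone_ix B (n + 1). v p - colmul (cone_ix B (n + 2)) (cone_D (f j) D (T j) (n + 1)) w p \<in> gens_ideal j"
    by (auto simp: add.assoc)
qed

text \<open>In degree 0 the cone is \<open>F 0\<close>, because \<open>F (-1) = 0\<close>, and its
  boundaries are \<open>D w + f j z\<close>. The cokernel is thus unchanged: the cone resolves the
  same module over the larger ring.\<close>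

lemma cone_im0:
  assumes c: "cdg (Suc j) B D T"
  shows "v \<in> im0 j (cone_ix B) (cone_D (f j) D (T j)) \<longleftrightarrow> (\<lambda>q. v (2 * q)) \<in> im0 (Suc j) B D"
proof -
  have fin: "finite (B n)" for n using c by (simp add: cdg_def)
  have B0: "B (-1) = {}" using c by (simp add: cdg_def)
  have e: "colmul (cone_ix B 1) (cone_D (f j) D (T j) 0) w (2 * p) = colmul (B 1) (D 0) (\<lambda>q. w (2 * q)) p + f j * w (Suc (2 * p))"
    if "p \<in> B 0" for w p using colmul_cone_even[of B p 0 "f j" D "T j" w, OF fin that] by simp
  show ?thesis
  proof
    assume "v \<in> im0 j (cone_ix B) (cone_D (f j) D (T j))"
    then obtain w where w: "\<forall>p\<in>cone_ix B 0. v p - colmul (cone_ix B 1) (cone_D (f j) D (T j) 0) w p \<in> gens_ideal j"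
      by (auto simp: im0_def)
    have "v (2 * p) - colmul (B 1) (D 0) (\<lambda>q. w (2 * q)) p \<in> gens_ideal (Suc j)" if "p \<in> B 0" for p
      unfolding gens_ideal_Suc using bspec[OF w, of "2 * p"] that e[OF that, of w]
      by (intro exI[of _ "w (Suc (2 * p))"]) (simp add: diff_diff_eq)
    then show "(\<lambda>q. v (2 * q)) \<in> im0 (Suc j) B D" by (auto simp: im0_def)
  next
    assume "(\<lambda>q. v (2 * q)) \<in> im0 (Suc j) B D"
    then obtain w where w: "\<And>p. p \<in> B 0 \<Longrightarrow> v (2 * p) - colmul (B 1) (D 0) w p \<in> gens_ideal (Suc j)"
      by (auto simp: im0_def)
    obtain z where z: "\<And>p. p \<in> B 0 \<Longrightarrow> v (2 * p) - colmul (B 1) (D 0) w p - f j * z p \<in> gens_ideal j"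
      using gens_ideal_Suc_vec[of "B 0" "\<lambda>p. v (2 * p) - colmul (B 1) (D 0) w p" j] w by blast
    define u where "u = (\<lambda>k. if even k then w (k div 2) else z (k div 2))"
    have u: "(\<lambda>q. u (2 * q)) = w" by (auto simp: u_def)
    have u': "u (Suc (2 * q)) = z q" for q by (auto simp: u_def)
    have "v p - colmul (cone_ix B 1) (cone_D (f j) D (T j) 0) u p \<in> gens_ideal j" if "p \<in> cone_ix B 0" for p
      using that
    proof (cases rule: cone_ix_cases)
      case (1 q)
      show ?thesis unfolding 1(1) e[OF 1(2)] u u' using z[OF 1(2)] by (simp add: algebra_simps)
    qed (simp add: B0)
    then show "v \<in> im0 j (cone_ix B) (cone_D (f j) D (T j))" by (auto simp: im0_def)
  qed
qed

text \<open>Finite dimension over the residue field, with vectors read modulo \<open>m\<close>.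
  Along an ascending chain a subspace is determined by its projection forgetting the coordinate
  \<open>b\<close> (\<open>V\<close>) and by whether it contains a nonzero vector supported at
  \<open>b\<close> (\<open>W\<close>).\<close>

lemma subspace_acc:
  fixes U :: "nat \<Rightarrow> (nat \<Rightarrow> 'p) set"
  assumes "finite X"
    and "\<And>k x y. x \<in> U k \<Longrightarrow> y \<in> U k \<Longrightarrow> x + y \<in> U k"
    and "\<And>k a x. x \<in> U k \<Longrightarrow> vscale a x \<in> U k"
    and "\<And>k x. (\<forall>q\<in>X. x q \<in> m) \<Longrightarrow> x \<in> U k"
    and "\<And>k. U k \<subseteq> U (Suc k)"
  shows "\<exists>K. \<forall>k\<ge>K. U k = U K"
  using assms
proof (induction X arbitrary: U rule: finite_induct)
  case empty
  then have "U k = UNIV" for k by auto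
  then show ?case by blast
next
  case (insert b X)
  note add = insert.prems(1) and sc = insert.prems(2) and zero = insert.prems(3) and inc = insert.prems(4)
  have mono: "U k \<subseteq> U k'" if "k \<le> k'" for k k' using lift_Suc_mono_le[of U, OF inc that] .
  have neg: "- x \<in> U k" if "x \<in> U k" for x k using sc[OF that, of "-1"] unfolding vscale_neg .
  define V where "V k = {x. \<exists>y\<in>U k. \<forall>q\<in>X. x q - y q \<in> m}" for k
  have "\<exists>K. \<forall>k\<ge>K. V k = V K"
  proof (rule insert.IH)
    show "x + y \<in> V k" if "x \<in> V k" "y \<in> V k" for x y k
    proof -
      from that obtain x' y' where "x' \<in> U k" "\<forall>q\<in>X. x q - x' q \<in> m" "y' \<in> U k" "\<forall>q\<in>X. y q - y' q \<in> m"
        by (auto simp: V_def)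
      then show ?thesis unfolding V_def
        by (auto intro!: bexI[of _ "x' + y'"] add rideal_add[OF m] simp: add_diff_add)
    qed
    show "vscale a x \<in> V k" if "x \<in> V k" for a x k
    proof -
      from that obtain x' where "x' \<in> U k" "\<forall>q\<in>X. x q - x' q \<in> m" by (auto simp: V_def)
      then show ?thesis unfolding V_def
        by (auto intro!: bexI[of _ "vscale a x'"] sc rideal_mult[OF m] simp: vscale_def right_diff_distrib[symmetric])
    qed
    show "x \<in> V k" if "\<forall>q\<in>X. x q \<in> m" for x k
      unfolding V_def using that by (auto intro!: bexI[of _ "\<lambda>_. 0"] zero simp: rideal_0[OF m])
    show "V k \<subseteq> V (Suc k)" for k unfolding V_def using inc by blast
  qed
  then obtain K1 where K1: "\<And>k. k \<ge> K1 \<Longrightarrow> V k = V K1" by blast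
  define W where "W k \<longleftrightarrow> (\<exists>y\<in>U k. (\<forall>q\<in>X. y q \<in> m) \<and> y b \<notin> m)" for k
  \<comment> \<open>Along the chain \<open>W\<close> can only change from false to true; if it never
    holds, any \<open>K2\<close> will do.\<close>
  obtain K2 where K2: "\<And>k. W k \<Longrightarrow> W K2" by (cases "\<exists>k. W k") auto
  define K where "K = max K1 K2"
  have W: "W k \<Longrightarrow> W K" for k using K2 mono[of K2 K] unfolding W_def K_def by fastforce
  have "U k \<subseteq> U K" if "k \<ge> K" for k
  proof
    fix x assume x: "x \<in> U k"
    then have "x \<in> V k" unfolding V_def by (auto intro!: bexI[of _ x] simp: rideal_0[OF m])
    then have "x \<in> V K" using K1[of k] K1[of K] that by (simp add: K_def)
    then obtain y where y: "y \<in> U K" "\<forall>q\<in>X. x q - y q \<in> m" by (auto simp: V_def)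
    let ?d = "x + (- y)"
    have d: "?d \<in> U k" using add[OF x neg[OF subsetD[OF mono[OF that] y(1)]]] .
    have "?d \<in> U K"
    proof (cases "?d b \<in> m")
      case True then show ?thesis using y by (intro zero) auto
    next
      case False
      then have "W k" unfolding W_def using d y by (auto intro!: bexI[of _ ?d])
      then obtain z where z: "z \<in> U K" "\<forall>q\<in>X. z q \<in> m" "z b \<notin> m" using W unfolding W_def by blast
      obtain r where r: "z b * r - 1 \<in> m" using m_max[OF z(3)] by blast
      let ?e = "?d + (- vscale (?d b * r) z)"
      have "?e \<in> U K"
      proof (rule zero, intro ballI)
        fix q assume "q \<in> insert b X"
        then show "?e q \<in> m"
        proof
          assume [simp]: "q = b"
          have "?e q = - ?d b * (z b * r - 1)" by (simp add: vscale_def algebra_simps)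
          then show ?thesis using rideal_mult[OF m r] by simp
        next
          assume "q \<in> X"
          then have "(x q - y q) - ?d b * r * z q \<in> m"
            using y z by (intro rideal_diff[OF m, of "x q - y q"] rideal_mult[OF m, of "z q"]) auto
          then show ?thesis by (simp add: vscale_def)
        qed
      qed
      from add[OF this sc[OF z(1), of "?d b * r"]]
      have "?e + vscale (?d b * r) z \<in> U K" .
      moreover have "?e + vscale (?d b * r) z = ?d" by (simp add: fun_eq_iff)
      ultimately show ?thesis by (simp only:)
    qed
    from add[OF this y(1)] have "?d + y \<in> U K" .
    moreover have "?d + y = x" by (simp add: fun_eq_iff)
    ultimately show "x \<in> U K" by (simp only:)
  qed
  then show ?case using mono by blast
qed

text \<open>Without operators a submodule is a family of unrelated subspaces, one in each degree.
  Only degrees from 0 to \<open>N\<close> can carry cohomology, so finitely many bounds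
  suffice.\<close>

lemma gacc_base:
  assumes c: "cdg 0 B D T" and van: "\<And>n. n > N \<Longrightarrow> cocycles B D n \<subseteq> coboundaries B D n"
  shows "graded_op.gacc (cocycles B D) (coboundaries B D) vscale (act B T) 0"
proof -
  interpret graded_op "cocycles B D" "coboundaries B D" vscale "- 1" "act B T" 0 by (rule cdg_graded_op[OF c])
  have fin: "finite (B n)" and neg: "n < 0 \<Longrightarrow> B n = {}" for n using c by (simp_all add: cdg_def)
  show ?thesis unfolding gacc_def
  proof (intro allI impI)
    fix U :: "nat \<Rightarrow> int \<Rightarrow> (nat \<Rightarrow> 'p) set"
    assume sub: "\<forall>k. gsub (U k)" and inc: "\<forall>k n. U k n \<subseteq> U (Suc k) n"
    have U: "coboundaries B D n \<subseteq> U k n" "U k n \<subseteq> cocycles B D n" for k n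
      using sub by (auto simp: gsub_def)
    have m_coboundaries: "x \<in> coboundaries B D n" if "\<forall>q\<in>B n. x q \<in> m" for x n
      unfolding coboundaries_def using that by (auto intro!: exI[of _ 0] simp: rowmul_def)
    have "\<exists>K. \<forall>k\<ge>K. U k n = U K n" for n
    proof (rule subspace_acc[OF fin[of n]])
      show "x + y \<in> U k n" if "x \<in> U k n" "y \<in> U k n" for k x y
        using sub that by (auto simp: gsub_def)
      show "vscale a x \<in> U k n" if "x \<in> U k n" for k x a
        using sub that by (auto simp: gsub_def)
      show "x \<in> U k n" if "\<forall>q\<in>B n. x q \<in> m" for k x
        using m_coboundaries[OF that] U by blast
      show "U k n \<subseteq> U (Suc k) n" for k using inc by blast
    qed
    then obtain Kn :: "int \<Rightarrow> nat" where Kn: "\<And>n k. k \<ge> Kn n \<Longrightarrow> U k n = U (Kn n) n" by metis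
    define K where "K = Max (insert 0 (Kn ` {0..N}))"
    have "U k n = U K n" if k: "k \<ge> K" for k n
    proof (cases "n \<in> {0..N}")
      case True
      then have "K \<ge> Kn n" unfolding K_def by (intro Max_ge) auto
      then show ?thesis using Kn[of n k] Kn[of n K] k by simp
    next
      case False
      then have "cocycles B D n \<subseteq> coboundaries B D n" using van m_coboundaries neg by (cases "n < 0") auto
      then show ?thesis using U(1)[of n k] U(1)[of n K] U(2)[of k n] U(2)[of K n] by blast
    qed
    then show "\<exists>K. \<forall>k\<ge>K. \<forall>n. U k n = U K n" by blast
  qed
qed

text \<open>The predicate \<open>P\<close> carries along what the base case needs to know about the augmentation.\<close>

lemma gacc_resolution:
  fixes z :: 'z and P :: "((nat \<Rightarrow> 'p) \<Rightarrow> 'z) \<Rightarrow> bool"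
  assumes base: "\<And>B D T e. cdg 0 B D T \<Longrightarrow> exact_from 0 B D \<Longrightarrow> (\<And>v. e v = z \<longleftrightarrow> v \<in> im0 0 B D) \<Longrightarrow> P e \<Longrightarrow>
      \<exists>N. \<forall>n>N. cocycles B D n \<subseteq> coboundaries B D n"
    and P: "\<And>e. P e \<Longrightarrow> P (\<lambda>v. e (\<lambda>q. v (2 * q)))"
  shows "cdg j B D T \<Longrightarrow> exact_from j B D \<Longrightarrow> (\<And>v. e v = z \<longleftrightarrow> v \<in> im0 j B D) \<Longrightarrow> P e \<Longrightarrow>
      graded_op.gacc (cocycles B D) (coboundaries B D) vscale (act B T) j"
proof (induction j arbitrary: B D T e)
  case 0
  then obtain N where "\<forall>n>N. cocycles B D n \<subseteq> coboundaries B D n" using base by blast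
  then show ?case by (intro gacc_base[OF 0(1), where N = N]) simp
next
  case (Suc j)
  obtain H where H: "cdg j (cone_ix B) (cone_D (f j) D (T j)) (cone_T T H)"
    using cdg_cone[OF Suc.prems(1)] by blast
  \<comment> \<open>The augmentation of the cone reads the even coordinates, since these index
    \<open>F 0\<close> and the odd part in degree 0 is \<open>F (-1) = 0\<close>.\<close>
  show ?case
    by (rule gacc_cone[OF Suc.prems(1) H],
        rule Suc.IH[OF H cone_exact[OF Suc.prems(1,2)], where e = "\<lambda>v. e (\<lambda>q. v (2 * q))"])
      (use Suc.prems P cone_im0[OF Suc.prems(1)] in auto)
qed

lemma rowmul_minimal:
  assumes "\<And>n p q. p \<in> B n \<Longrightarrow> q \<in> B (n + 1) \<Longrightarrow> D n p q \<in> m" "q \<in> B (n + 1)"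
  shows "rowmul (B n) x (D n) q \<in> m"
  unfolding rowmul_def by (rule rideal_sum[OF m], rule rideal_mult[OF m], rule assms) (use assms in auto)

text \<open>Modulo \<open>m\<close> the differentials of a minimal complex are zero, so its
  cohomology in degree \<open>n\<close> is the space of all vectors on \<open>B n\<close>.\<close>

lemma cocycles_minimal:
  assumes "\<And>n p q. p \<in> B n \<Longrightarrow> q \<in> B (n + 1) \<Longrightarrow> D n p q \<in> m"
  shows "cocycles B D n = UNIV"
  using rowmul_minimal[of B D, OF assms] by (auto simp: cocycles_def)

lemma coboundaries_minimal:
  assumes "\<And>n p q. p \<in> B n \<Longrightarrow> q \<in> B (n + 1) \<Longrightarrow> D n p q \<in> m"
  shows "x \<in> coboundaries B D n \<longleftrightarrow> (\<forall>q\<in>B n. x q \<in> m)"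
proof
  assume "x \<in> coboundaries B D n"
  then obtain y where y: "\<And>q. q \<in> B n \<Longrightarrow> x q - rowmul (B (n - 1)) y (D (n - 1)) q \<in> m" by (auto simp: coboundaries_def)
  show "\<forall>q\<in>B n. x q \<in> m"
    using rideal_cong[OF m y] rowmul_minimal[of B D _ "n - 1" y, OF assms] by simp
next
  assume "\<forall>q\<in>B n. x q \<in> m"
  then show "x \<in> coboundaries B D n" unfolding coboundaries_def by (auto intro!: exI[of _ 0] simp: rowmul_def)
qed

text \<open>The classes killed by all operators form a submodule, and so do those of degree at most
  \<open>k\<close> among them, because the operators send them to zero. The ascending chain of these
  truncations stops, so no such class lives in large degrees.\<close>

lemma socle_bounded:
  assumes c: "cdg c B D T" and acc: "graded_op.gacc (cocycles B D) (coboundaries B D) vscale (act B T) c"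
    and min: "\<And>n p q. p \<in> B n \<Longrightarrow> q \<in> B (n + 1) \<Longrightarrow> D n p q \<in> m"
  shows "\<exists>K. \<forall>n>K. \<forall>x. (\<forall>l<c. \<forall>q\<in>B (n + 2). act B T l n x q \<in> m) \<longrightarrow> (\<forall>q\<in>B n. x q \<in> m)"
proof -
  interpret graded_op "cocycles B D" "coboundaries B D" vscale "- 1" "act B T" c by (rule cdg_graded_op[OF c])
  note Z = cocycles_minimal[OF min] and Bm = coboundaries_minimal[OF min]
  define U where "U k n = {x. (n \<le> int k \<and> (\<forall>l<c. act B T l n x \<in> coboundaries B D (n + 2))) \<or> x \<in> coboundaries B D n}" for k n
  have tB: "\<forall>l<c. act B T l n x \<in> coboundaries B D (n + 2)" if "x \<in> coboundaries B D n" for x n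
    using act_coboundaries[OF c _ that] by blast
  have sub: "gsub (U k)" for k
    unfolding gsub_def
  proof (intro allI conjI ballI impI)
    fix n show "U k n \<subseteq> cocycles B D n" "coboundaries B D n \<subseteq> U k n" by (auto simp: Z U_def)
  next
    fix n x y assume "x \<in> U k n" "y \<in> U k n"
    then show "x + y \<in> U k n" using tB[of x] tB[of y] unfolding U_def
      by (auto simp: act_add intro: coboundaries_add)
  next
    fix n a x assume "x \<in> U k n"
    then show "vscale a x \<in> U k n" unfolding U_def by (auto simp: act_sc intro: coboundaries_sc)
  next
    fix n l x assume "l < c" "x \<in> U k n"
    then show "act B T l n x \<in> U k (n + 2)" using tB unfolding U_def by auto
  qed
  have inc: "U k n \<subseteq> U (Suc k) n" for k n unfolding U_def by auto
  obtain K where K: "\<And>k n. k \<ge> K \<Longrightarrow> U k n = U K n"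
    using acc[unfolded gacc_def, THEN spec, of U] sub inc by blast
  show ?thesis
  proof (intro exI[of _ "int K"] allI impI)
    fix n x assume n: "int K < n" and x: "\<forall>l<c. \<forall>q\<in>B (n + 2). act B T l n x q \<in> m"
    then have "x \<in> U (nat n) n" unfolding U_def by (auto simp: Bm)
    then have "x \<in> U K n" using K[of "nat n" n] n by simp
    then show "\<forall>q\<in>B n. x q \<in> m" using n unfolding U_def by (auto simp: Bm)
  qed
qed

lemma cdg_exists:
  assumes "\<And>n. finite (B n)" "\<And>n. n < 0 \<Longrightarrow> B n = {}"
    and "\<And>n p q. p \<in> B n \<Longrightarrow> q \<in> B (n + 2) \<Longrightarrow> matmul (B (n + 1)) (D n) (D (n + 1)) p q \<in> gens_ideal j" "j \<le> c"
  shows "\<exists>T. cdg j B D T"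
proof -
  have "\<forall>n p q. \<exists>h. p \<in> B n \<longrightarrow> q \<in> B (n + 2) \<longrightarrow>
      matmul (B (n + 1)) (D n) (D (n + 1)) p q - (\<Sum>l<j. f l * h l) \<in> I0"
    using assms(3) unfolding gens_ideal_def by blast
  then obtain h where "\<And>n p q. p \<in> B n \<Longrightarrow> q \<in> B (n + 2) \<Longrightarrow>
      matmul (B (n + 1)) (D n) (D (n + 1)) p q - (\<Sum>l<j. f l * h n p q l) \<in> I0"
    unfolding choice_iff by blast
  then have "cdg j B D (\<lambda>l n p q. h n p q l)" using assms by (auto simp: cdg_def)
  then show ?thesis by blast
qed

end

section \<open>Minors and generic operators\<close>

definition Det :: "nat \<Rightarrow> (nat \<Rightarrow> nat \<Rightarrow> 'a::comm_ring_1) \<Rightarrow> 'a" where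
  "Det r A = (\<Sum>s | s permutes {..<r}. of_int (sign s) * (\<Prod>i<r. A i (s i)))"

lemma Det_cong: "(\<And>i j. i < r \<Longrightarrow> j < r \<Longrightarrow> A i j = A' i j) \<Longrightarrow> Det r A = Det r A'"
  unfolding Det_def by (intro sum.cong refl arg_cong2[where f = "(*)"] prod.cong)
    (auto dest: permutes_in_image)

lemma Det_transpose: "Det r (\<lambda>i j. A j i) = Det r A"
proof -
  have "(\<Sum>s | s permutes {..<r}. of_int (sign s) * (\<Prod>i<r. A (s i) i))
      = (\<Sum>s | s permutes {..<r}. of_int (sign (inv_into UNIV s)) * (\<Prod>i<r. A (inv_into UNIV s i) i))"
    by (rule sum_permutations_inverse)
  also have "\<dots> = (\<Sum>s | s permutes {..<r}. of_int (sign s) * (\<Prod>i<r. A i (s i)))"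
  proof (rule sum.cong[OF refl])
    fix s assume "s \<in> {s. s permutes {..<r}}"
    then have s: "s permutes {..<r}" by simp
    have "(\<Prod>i<r. A i (s i)) = (\<Prod>i<r. A (inv_into UNIV s i) (s (inv_into UNIV s i)))"
      using prod.permute[OF permutes_inv[OF s], of "\<lambda>i. A i (s i)"] by (simp add: o_def)
    also have "\<dots> = (\<Prod>i<r. A (inv_into UNIV s i) i)"
      using permutes_inverses(1)[OF s] by simp
    finally have "(\<Prod>i<r. A (inv_into UNIV s i) i) = (\<Prod>i<r. A i (s i))" ..
    moreover have "sign (inv_into UNIV s) = sign s"
      using s by (intro sign_inverse permutation_permutes[THEN iffD2]) auto
    ultimately show "of_int (sign (inv_into UNIV s)) * (\<Prod>i<r. A (inv_into UNIV s i) i) = of_int (sign s) * (\<Prod>i<r. A i (s i))"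
      by simp
  qed
  finally show ?thesis by (simp add: Det_def)
qed

text \<open>Multilinearity in the rows: a form of the Cauchy-Binet formula that sums over all maps
  \<open>g\<close> instead of collecting them into increasing ones.\<close>

lemma Det_mult_left:
  assumes "finite K"
  shows "Det r (\<lambda>i j. \<Sum>k\<in>K. A i k * C k j)
    = (\<Sum>g\<in>PiE {..<r} (\<lambda>_. K). (\<Prod>i<r. A i (g i)) * Det r (\<lambda>i j. C (g i) j))"
proof -
  have "Det r (\<lambda>i j. \<Sum>k\<in>K. A i k * C k j)
    = (\<Sum>s | s permutes {..<r}. of_int (sign s) * (\<Sum>g\<in>PiE {..<r} (\<lambda>_. K). (\<Prod>i<r. A i (g i) * C (g i) (s i))))"
    unfolding Det_def by (subst prod_sum_PiE) (auto simp: assms)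
  also have "\<dots> = (\<Sum>g\<in>PiE {..<r} (\<lambda>_. K). \<Sum>s | s permutes {..<r}. of_int (sign s) * ((\<Prod>i<r. A i (g i)) * (\<Prod>i<r. C (g i) (s i))))"
    unfolding sum_distrib_left prod.distrib by (rule sum.swap)
  finally show ?thesis unfolding Det_def sum_distrib_left
    by (simp only: mult.left_commute)
qed

lemma Det_mult_mem:
  assumes J: "rideal J" and K: "finite K"
    and minors: "\<And>g. g \<in> {..<r} \<rightarrow> K \<Longrightarrow> Det r (\<lambda>i j. C (g i) j) \<in> J"
  shows "Det r (\<lambda>i j. \<Sum>k\<in>K. A i k * C k j) \<in> J"
  unfolding Det_mult_left[OF K] by (intro rideal_sum[OF J] rideal_mult[OF J] minors) auto

lemma Det_mult_mem':
  assumes J: "rideal J" and K: "finite K"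
    and minors: "\<And>g. g \<in> {..<r} \<rightarrow> K \<Longrightarrow> Det r (\<lambda>i j. C i (g j)) \<in> J"
  shows "Det r (\<lambda>i j. \<Sum>k\<in>K. C i k * E k j) \<in> J"
proof -
  have "Det r (\<lambda>i j. \<Sum>k\<in>K. E k i * C j k) \<in> J"
  proof (rule Det_mult_mem[OF J K])
    fix g assume "g \<in> {..<r} \<rightarrow> K"
    then show "Det r (\<lambda>i j. C j (g i)) \<in> J"
      using minors unfolding Det_transpose[of r "\<lambda>i j. C i (g j)"] by blast
  qed
  then have "Det r (\<lambda>i j. \<Sum>k\<in>K. E k j * C i k) \<in> J"
    unfolding Det_transpose[of r "\<lambda>i j. \<Sum>k\<in>K. E k j * C i k"] .
  then show ?thesis by (simp only: mult.commute)
qed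

lemma Det_diff_mem:
  assumes J: "rideal J" and "\<And>i j. i < r \<Longrightarrow> j < r \<Longrightarrow> A i j - A' i j \<in> J"
  shows "Det r A - Det r A' \<in> J"
proof -
  have "(\<Prod>i\<in>X. g i) - (\<Prod>i\<in>X. h i) \<in> J" if "\<And>i. i \<in> X \<Longrightarrow> g i - h i \<in> J" for X :: "nat set" and g h
    using that
  proof (induction X rule: infinite_finite_induct)
    case (insert x X)
    have "(g x - h x) * (\<Prod>i\<in>X. g i) + h x * ((\<Prod>i\<in>X. g i) - (\<Prod>i\<in>X. h i)) \<in> J"
      using insert by (intro rideal_add[OF J] rideal_mult'[OF J] rideal_mult[OF J, of "_ - _"]) auto
    then show ?case using insert by (simp add: algebra_simps)
  qed (auto simp: rideal_0[OF J])
  note prod = this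
  show ?thesis unfolding Det_def
  proof (rule rideal_sum_diff[OF J])
    fix s assume "s \<in> {s. s permutes {..<r}}"
    then have "(\<Prod>i<r. A i (s i)) - (\<Prod>i<r. A' i (s i)) \<in> J"
      by (intro prod assms) (auto dest: permutes_in_image)
    from rideal_mult[OF J this, of "of_int (sign s)"]
    show "of_int (sign s) * (\<Prod>i<r. A i (s i)) - of_int (sign s) * (\<Prod>i<r. A' i (s i)) \<in> J"
      by (simp add: right_diff_distrib)
  qed
qed

lemma Det_scale: "Det r (\<lambda>i j. a * A i j) = a ^ r * Det r A"
  unfolding Det_def sum_distrib_left
  by (intro sum.cong refl) (simp add: prod.distrib mult.left_commute)

lemma Det_const_poly: "Det r (\<lambda>i j. [:A i j:]) = [:Det r A:]"
proof -
  have 1: "(\<Prod>i\<in>X. [:g i:]) = [:\<Prod>i\<in>X. g i:]" for X :: "nat set" and g :: "nat \<Rightarrow> 'a"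
    by (induction X rule: infinite_finite_induct) (auto simp: one_pCons)
  have 2: "(\<Sum>i\<in>X. [:g i:]) = [:\<Sum>i\<in>X. g i:]" for X :: "(nat \<Rightarrow> nat) set" and g :: "(nat \<Rightarrow> nat) \<Rightarrow> 'a"
    by (induction X rule: infinite_finite_induct) auto
  have "of_int k * [:a:] = [:of_int k * a:]" for k and a :: 'a
    by (simp add: of_int_poly)
  then show ?thesis unfolding Det_def 1 by (simp add: 2)
qed

lemma Det_row_perm:
  assumes t: "t permutes {..<r}"
  shows "Det r (\<lambda>i j. A (t i) j) = of_int (sign t) * Det r A"
proof -
  have "Det r (\<lambda>i j. A (t i) j) = (\<Sum>s | s permutes {..<r}. of_int (sign (s \<circ> t)) * (\<Prod>i<r. A (t i) ((s \<circ> t) i)))"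
    unfolding Det_def by (rule sum_permutations_compose_right[OF t])
  also have "\<dots> = (\<Sum>s | s permutes {..<r}. of_int (sign t) * (of_int (sign s) * (\<Prod>i<r. A i (s i))))"
  proof (rule sum.cong[OF refl])
    fix s assume "s \<in> {s. s permutes {..<r}}"
    then have s: "s permutes {..<r}" by simp
    have "(\<Prod>i<r. A i (s i)) = (\<Prod>i<r. A (t i) (s (t i)))"
      using prod.permute[OF t, of "\<lambda>i. A i (s i)"] by (simp add: o_def)
    moreover have "sign (s \<circ> t) = sign s * sign t"
      using s t by (intro sign_compose) (auto simp: permutation_permutes)
    ultimately show "of_int (sign (s \<circ> t)) * (\<Prod>i<r. A (t i) ((s \<circ> t) i)) = of_int (sign t) * (of_int (sign s) * (\<Prod>i<r. A i (s i)))"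
      by simp
  qed
  finally show ?thesis by (simp add: Det_def sum_distrib_left)
qed

text \<open>Exchanging the two rows gives only \<open>2 * Det r A = 0\<close>, which is too weak
  when 2 is a zero divisor. Instead even and odd permutations are paired by composition with the
  transposition, and paired products are equal.\<close>

lemma Det_equal_rows:
  assumes i: "i < r" "i' < r" "i \<noteq> i'" and eq: "\<And>j. j < r \<Longrightarrow> A i j = A i' j"
  shows "Det r A = 0"
proof -
  let ?t = "transpose i i'"
  have t: "?t permutes {..<r}" using i by (intro permutes_swap_id) auto
  let ?E = "{s. s permutes {..<r} \<and> evenperm s}" and ?O = "{s. s permutes {..<r} \<and> \<not> evenperm s}"
  have fin: "finite {s. s permutes {..<r}}" by (rule finite_permutations) simp
  have ev: "evenperm (s \<circ> ?t) \<longleftrightarrow> \<not> evenperm s" if "s permutes {..<r}" for s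
    using that t i by (subst evenperm_comp) (auto simp: permutation_permutes evenperm_swap)
  have tt: "s \<circ> ?t \<circ> ?t = s" for s :: "nat \<Rightarrow> nat" by (simp add: comp_assoc)
  have "(\<Sum>s\<in>?O. \<Prod>k<r. A k (s k)) = (\<Sum>s\<in>?E. \<Prod>k<r. A k ((s \<circ> ?t) k))"
    by (rule sum.reindex_bij_witness[of _ "\<lambda>s. s \<circ> ?t" "\<lambda>s. s \<circ> ?t"])
      (auto simp: tt ev permutes_compose[OF t] simp del: comp_apply)
  also have "\<dots> = (\<Sum>s\<in>?E. \<Prod>k<r. A k (s k))"
  proof (rule sum.cong[OF refl])
    fix s assume "s \<in> ?E"
    then have s: "s permutes {..<r}" by simp
    have "(\<Prod>k<r. A k ((s \<circ> ?t) k)) = (\<Prod>k<r. A (?t k) ((s \<circ> ?t) (?t k)))"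
      using prod.permute[OF t, of "\<lambda>k. A k ((s \<circ> ?t) k)"] by (simp add: o_def)
    also have "\<dots> = (\<Prod>k<r. A k (s k))"
    proof (rule prod.cong[OF refl])
      fix k assume "k \<in> {..<r}"
      then have "s k < r" using permutes_in_image[OF s, of k] by simp
      then show "A (?t k) ((s \<circ> ?t) (?t k)) = A k (s k)"
        using eq by (auto simp: transpose_def)
    qed
    finally show "(\<Prod>k<r. A k ((s \<circ> ?t) k)) = (\<Prod>k<r. A k (s k))" .
  qed
  finally have OE: "(\<Sum>s\<in>?O. \<Prod>k<r. A k (s k)) = (\<Sum>s\<in>?E. \<Prod>k<r. A k (s k))" .
  have "Det r A = (\<Sum>s\<in>?E. of_int (sign s) * (\<Prod>k<r. A k (s k))) + (\<Sum>s\<in>?O. of_int (sign s) * (\<Prod>k<r. A k (s k)))"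
    unfolding Det_def by (subst sum.union_disjoint[symmetric]) (auto intro!: sum.cong finite_subset[OF _ fin])
  also have "\<dots> = (\<Sum>s\<in>?E. \<Prod>k<r. A k (s k)) - (\<Sum>s\<in>?O. \<Prod>k<r. A k (s k))"
    by (simp add: sign_def sum_negf)
  finally show ?thesis using OE by simp
qed

text \<open>A repeated row makes the determinant zero, and distinct rows can be sorted at the cost
  of a sign. This links the increasing selections in \<open>minors\<close> to the arbitrary ones
  produced by \<open>Det_mult_left\<close>.\<close>

lemma Det_rows_mem:
  assumes J: "rideal J"
    and mono: "\<And>g. g \<in> {..<r} \<rightarrow> X \<Longrightarrow> strict_mono_on {..<r} g \<Longrightarrow> Det r (\<lambda>i j. A (g i) j) \<in> J"
    and g: "g \<in> {..<r} \<rightarrow> (X :: nat set)"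
  shows "Det r (\<lambda>i j. A (g i) j) \<in> J"
proof (cases "inj_on g {..<r}")
  case False
  then obtain i i' where "i < r" "i' < r" "i \<noteq> i'" "g i = g i'" by (auto simp: inj_on_def)
  then have "Det r (\<lambda>i j. A (g i) j) = 0" by (intro Det_equal_rows[of i r i']) auto
  then show ?thesis using rideal_0[OF J] by simp
next
  case True
  let ?Y = "g ` {..<r}"
  have cY: "card ?Y = r" using card_image[OF True] by simp
  obtain e where e: "bij_betw e {..<r} ?Y" "strict_mono_on {..<r} e"
    using ex_bij_betw_strict_mono_card[of ?Y] cY by auto
  define t where "t i = (if i < r then inv_into {..<r} e (g i) else i)" for i
  have et: "e (t i) = g i" if "i < r" for i
    using that e(1) by (auto simp: t_def bij_betw_def intro!: f_inv_into_f)
  have "bij_betw (\<lambda>i. inv_into {..<r} e (g i)) {..<r} {..<r}"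
    using bij_betw_trans[OF inj_on_imp_bij_betw[OF True] bij_betw_inv_into[OF e(1)]] by (simp add: o_def)
  then have "bij_betw t {..<r} {..<r}"
    by (rule bij_betw_cong[THEN iffD1, rotated]) (simp add: t_def)
  then have t: "t permutes {..<r}"
    by (rule bij_imp_permutes) (simp add: t_def)
  have eX: "e \<in> {..<r} \<rightarrow> X"
  proof
    fix i assume "i \<in> {..<r}"
    then have "e i \<in> g ` {..<r}" using e(1) by (auto simp: bij_betw_def)
    then show "e i \<in> X" using g by auto
  qed
  have "Det r (\<lambda>i j. A (g i) j) = Det r (\<lambda>i j. A (e (t i)) j)"
    by (rule Det_cong) (simp add: et)
  also have "\<dots> = of_int (sign t) * Det r (\<lambda>i j. A (e i) j)"
    by (rule Det_row_perm[OF t, of "\<lambda>i j. A (e i) j"])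
  finally show ?thesis using rideal_mult[OF J mono[OF eX e(2)]] by simp
qed

lemma Det_minors_mem:
  assumes J: "rideal J"
    and mono: "\<And>g h. g \<in> {..<r} \<rightarrow> X \<Longrightarrow> strict_mono_on {..<r} g \<Longrightarrow> h \<in> {..<r} \<rightarrow> Y \<Longrightarrow> strict_mono_on {..<r} h \<Longrightarrow>
      Det r (\<lambda>i j. A (g i) (h j)) \<in> J"
    and g: "g \<in> {..<r} \<rightarrow> (X :: nat set)" and h: "h \<in> {..<r} \<rightarrow> (Y :: nat set)"
  shows "Det r (\<lambda>i j. A (g i) (h j)) \<in> J"
proof (rule Det_rows_mem[OF J _ g, of "\<lambda>i j. A i (h j)"])
  fix g assume g: "g \<in> {..<r} \<rightarrow> X" "strict_mono_on {..<r} g"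
  have "Det r (\<lambda>j i. A (g i) (h j)) \<in> J"
  proof (rule Det_rows_mem[OF J _ h, of "\<lambda>j i. A (g i) j"])
    fix h assume h: "h \<in> {..<r} \<rightarrow> Y" "strict_mono_on {..<r} h"
    show "Det r (\<lambda>j i. A (g i) (h j)) \<in> J"
      using mono[OF g h] Det_transpose[of r "\<lambda>i j. A (g i) (h j)"] by simp
  qed
  then show "Det r (\<lambda>i j. A (g i) (h j)) \<in> J"
    using Det_transpose[of r "\<lambda>i j. A (g i) (h j)"] by simp
qed

text \<open>Fraction-free Gaussian elimination.\<close>

lemma generic_right_inverse:
  fixes Q :: "'a::comm_ring_1 set" and T :: "nat \<Rightarrow> nat \<Rightarrow> 'a"
  assumes Q: "rideal Q" and Q1: "1 \<notin> Q" and prime: "\<And>a b. a * b \<in> Q \<Longrightarrow> a \<in> Q \<or> b \<in> Q"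
    and C: "finite C" and "finite B"
    and "\<And>x. (\<forall>q\<in>C. (\<Sum>p\<in>B. x p * T p q) \<in> Q) \<Longrightarrow> \<forall>p\<in>B. x p \<in> Q"
  shows "\<exists>X u. u \<notin> Q \<and> (\<forall>p\<in>B. \<forall>p'\<in>B. (\<Sum>q\<in>C. T p q * X q p') = (if p = p' then u else 0))"
  using assms(5,6)
proof (induction B arbitrary: T rule: finite_induct)
  case empty
  then show ?case using Q1 by auto
next
  case (insert p0 B)
  \<comment> \<open>A pivot exists: if the whole row \<open>p0\<close> were in \<open>Q\<close>, the
    unit vector at \<open>p0\<close> would contradict injectivity.\<close>
  have "\<exists>q\<in>C. T p0 q \<notin> Q"
  proof (rule ccontr)
    assume *: "\<not> ?thesis"
    have "\<forall>p\<in>insert p0 B. (if p = p0 then 1 else 0) \<in> Q"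
    proof (rule insert.prems, intro ballI)
      fix q assume "q \<in> C"
      have "(\<Sum>p\<in>B. (if p = p0 then 1 else 0) * T p q) = 0"
        using insert.hyps by (intro sum.neutral) auto
      then show "(\<Sum>p\<in>insert p0 B. (if p = p0 then 1 else 0) * T p q) \<in> Q"
        using * \<open>q \<in> C\<close> insert.hyps by simp
    qed
    then show False using Q1 by simp
  qed
  then obtain q0 where q0: "q0 \<in> C" "T p0 q0 \<notin> Q" by blast
  define a where "a = T p0 q0"
  \<comment> \<open>Clears the column \<open>q0\<close> from the other rows, multiplying by the
    pivot \<open>a\<close> instead of dividing by it.\<close>
  define T' where "T' p q = a * T p q - T p q0 * T p0 q" for p q
  have "\<forall>p\<in>B. x p \<in> Q" if x: "\<forall>q\<in>C. (\<Sum>p\<in>B. x p * T' p q) \<in> Q" for x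
  proof -
    \<comment> \<open>Chosen so that \<open>y T = x T'\<close>, which transfers injectivity from
      \<open>T\<close> to \<open>T'\<close>; primality of \<open>Q\<close> then removes the factor
      \<open>a\<close>.\<close>
    define y where "y p = (if p = p0 then - (\<Sum>p\<in>B. x p * T p q0) else a * x p)" for p
    have "\<forall>p\<in>insert p0 B. y p \<in> Q"
    proof (rule insert.prems, intro ballI)
      fix q assume q: "q \<in> C"
      have "(\<Sum>p\<in>B. y p * T p q) = (\<Sum>p\<in>B. a * x p * T p q)"
        using insert.hyps by (intro sum.cong) (auto simp: y_def)
      then have "(\<Sum>p\<in>insert p0 B. y p * T p q) = (\<Sum>p\<in>B. x p * T' p q)"
        using insert.hyps
        by (simp add: y_def T'_def sum_distrib_left sum_distrib_right right_diff_distrib sum_subtractf mult_ac)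
      then show "(\<Sum>p\<in>insert p0 B. y p * T p q) \<in> Q" using x q by simp
    qed
    then have "a * x p \<in> Q" if "p \<in> B" for p
    proof -
      have "p \<noteq> p0" using that insert.hyps by auto
      then show ?thesis using bspec[OF \<open>\<forall>p\<in>insert p0 B. y p \<in> Q\<close>, of p] that by (simp add: y_def)
    qed
    then show ?thesis using prime q0(2) unfolding a_def by blast
  qed
  from insert.IH[of T', OF this] obtain X' u' where u': "u' \<notin> Q"
    and X': "\<And>p p'. p \<in> B \<Longrightarrow> p' \<in> B \<Longrightarrow> (\<Sum>q\<in>C. T' p q * X' q p') = (if p = p' then u' else 0)"
    by blast
  \<comment> \<open>The correction at \<open>q0\<close> gives \<open>T Y = T' X'\<close>, and in
    particular zero in row \<open>p0\<close>, because that row of \<open>T'\<close>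
    vanishes.\<close>
  define Y where "Y q p' = a * X' q p' - (if q = q0 then (\<Sum>q\<in>C. T p0 q * X' q p') else 0)" for q p'
  have TY: "(\<Sum>q\<in>C. T p q * Y q p') = (\<Sum>q\<in>C. T' p q * X' q p')" for p p'
  proof -
    have "(\<Sum>q\<in>C. T p q * (if q = q0 then (\<Sum>q\<in>C. T p0 q * X' q p') else 0))
       = (\<Sum>q\<in>C. if q = q0 then T p q0 * (\<Sum>q\<in>C. T p0 q * X' q p') else 0)"
      by (rule sum.cong) auto
    then show ?thesis using q0(1) C
      by (simp add: Y_def T'_def right_diff_distrib left_diff_distrib sum_subtractf sum_distrib_left mult_ac)
  qed
  have TY0: "(\<Sum>q\<in>C. T p0 q * Y q p') = 0" for p'
    unfolding TY by (simp add: T'_def a_def mult.commute)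
  \<comment> \<open>Column \<open>p0\<close> starts from \<open>u'\<close> times the unit vector at
    \<open>q0\<close>, whose image under \<open>T\<close> is \<open>u'\<close> times column
    \<open>q0\<close> of \<open>T\<close>; subtracting combinations of \<open>Y\<close> clears its
    entries in the rows of \<open>B\<close> and leaves \<open>a * u'\<close> in row
    \<open>p0\<close>. The other columns are scaled by \<open>a\<close> to obtain the same
    scalar.\<close>
  define X where "X q p' = (if p' = p0 then (if q = q0 then u' else 0) - (\<Sum>p\<in>B. T p q0 * Y q p) else a * Y q p')" for q p'
  have TX0: "(\<Sum>q\<in>C. T p q * X q p0) = T p q0 * u' - (\<Sum>p''\<in>B. T p'' q0 * (\<Sum>q\<in>C. T p q * Y q p''))" for p
  proof -
    have "(\<Sum>q\<in>C. T p q * (if q = q0 then u' else 0)) = (\<Sum>q\<in>C. if q = q0 then T p q0 * u' else 0)"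
      by (rule sum.cong) auto
    moreover have "(\<Sum>q\<in>C. T p q * (\<Sum>p\<in>B. T p q0 * Y q p)) = (\<Sum>p''\<in>B. T p'' q0 * (\<Sum>q\<in>C. T p q * Y q p''))"
      unfolding sum_distrib_left by (subst sum.swap) (simp add: mult_ac)
    ultimately show ?thesis using q0(1) C by (simp add: X_def right_diff_distrib sum_subtractf)
  qed
  have TX: "(\<Sum>q\<in>C. T p q * X q p') = a * (\<Sum>q\<in>C. T p q * Y q p')" if "p' \<noteq> p0" for p p'
    using that by (simp add: X_def sum_distrib_left mult_ac)
  have "(\<Sum>q\<in>C. T p q * X q p') = (if p = p' then a * u' else 0)" if "p \<in> insert p0 B" "p' \<in> insert p0 B" for p p'
  proof (cases "p' = p0")
    case True
    show ?thesis
    proof (cases "p = p0")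
      case True then show ?thesis using \<open>p' = p0\<close> TX0[of p0] TY0 by (simp add: a_def)
    next
      case False
      then have p: "p \<in> B" using that by simp
      have "(\<Sum>p''\<in>B. T p'' q0 * (\<Sum>q\<in>C. T p q * Y q p'')) = (\<Sum>p''\<in>B. if p = p'' then T p'' q0 * u' else 0)"
        by (rule sum.cong) (auto simp: TY X' p)
      then show ?thesis using False True p insert.hyps by (simp add: TX0)
    qed
  next
    case False
    then have p': "p' \<in> B" using that by simp
    show ?thesis
    proof (cases "p = p0")
      case True then show ?thesis using False TX[OF False] TY0 by simp
    next
      case False
      then have p: "p \<in> B" using that by simp
      then show ?thesis using TX[OF \<open>p' \<noteq> p0\<close>] X'[OF p p'] by (simp add: TY)
    qed
  qed
  moreover have "a * u' \<notin> Q" using prime u' q0(2) unfolding a_def by blast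
  ultimately show ?case by blast
qed

text \<open>The extension of an ideal \<open>J\<close> to the polynomial ring; the quotient by it is
  the polynomial ring over the quotient by \<open>J\<close>.\<close>

definition coeffs_in :: "'p::comm_ring_1 set \<Rightarrow> 'p poly set" where
  "coeffs_in J = {g. \<forall>i. coeff g i \<in> J}"

lemma coeffs_in_ideal: "rideal J \<Longrightarrow> rideal (coeffs_in J)"
  unfolding rideal_def[of "coeffs_in J"]
  by (auto simp: coeffs_in_def coeff_mult rideal_0 rideal_add intro!: rideal_sum rideal_mult)

lemma coeffs_in_const: "rideal J \<Longrightarrow> [:a:] \<in> coeffs_in J \<longleftrightarrow> a \<in> J"
  by (auto simp: coeffs_in_def coeff_pCons rideal_0 split: nat.splits dest: spec[of _ 0])

context reg_ideal begin

lemma m_prime: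
  assumes "a * b \<in> m" shows "a \<in> m \<or> b \<in> m"
proof (rule ccontr)
  assume "\<not> ?thesis"
  then obtain a' where a': "a * a' - 1 \<in> m" and b: "b \<notin> m" using m_max by blast
  have "a' * (a * b) - (a * a' - 1) * b \<in> m"
    by (rule rideal_diff[OF m rideal_mult[OF m assms] rideal_mult'[OF m a']])
  then show False using b by (simp add: algebra_simps)
qed

text \<open>Polynomials over a field form a domain: the lowest coefficients outside \<open>m\<close>
  multiply to the lowest one of the product.\<close>

lemma coeffs_in_m_prime:
  assumes "g * h \<in> coeffs_in m" shows "g \<in> coeffs_in m \<or> h \<in> coeffs_in m"
proof (rule ccontr)
  assume "\<not> ?thesis"
  then have ex: "\<exists>i. coeff g i \<notin> m" "\<exists>i. coeff h i \<notin> m" by (auto simp: coeffs_in_def)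
  define i j where "i = (LEAST i. coeff g i \<notin> m)" and "j = (LEAST i. coeff h i \<notin> m)"
  have i: "coeff g i \<notin> m" "\<And>k. k < i \<Longrightarrow> coeff g k \<in> m"
    using LeastI_ex[OF ex(1)] not_less_Least unfolding i_def by blast+
  have j: "coeff h j \<notin> m" "\<And>k. k < j \<Longrightarrow> coeff h k \<in> m"
    using LeastI_ex[OF ex(2)] not_less_Least unfolding j_def by blast+
  have "coeff (g * h) (i + j) = coeff g i * coeff h j + (\<Sum>k\<in>{..i + j} - {i}. coeff g k * coeff h (i + j - k))"
    unfolding coeff_mult by (subst sum.remove[of _ i]) auto
  moreover have "(\<Sum>k\<in>{..i + j} - {i}. coeff g k * coeff h (i + j - k)) \<in> m"
  proof (rule rideal_sum[OF m])
    fix k assume k: "k \<in> {..i + j} - {i}"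
    show "coeff g k * coeff h (i + j - k) \<in> m"
    proof (cases "k < i")
      case True then show ?thesis using i by (intro rideal_mult'[OF m])
    next
      case False then show ?thesis using k by (intro rideal_mult[OF m] j) auto
    qed
  qed
  moreover have "coeff (g * h) (i + j) \<in> m" using assms by (auto simp: coeffs_in_def)
  ultimately have "coeff g i * coeff h j \<in> m"
    using rideal_diff[OF m] by fastforce
  then show False using m_prime i j by blast
qed

text \<open>McCoy's argument: the top coefficient of \<open>x\<close> is killed by the top operator that does not
  kill \<open>x\<close>, so applying that operator lowers the degree.\<close>

lemma mccoy:
  assumes c: "cdg c B D T" and min: "\<And>n p q. p \<in> B n \<Longrightarrow> q \<in> B (n + 1) \<Longrightarrow> D n p q \<in> m"
    and K: "\<And>n x. n > K \<Longrightarrow> (\<And>l q. l < c \<Longrightarrow> q \<in> B (n + 2) \<Longrightarrow> act B T l n x q \<in> m) \<Longrightarrow> \<forall>q\<in>B n. x q \<in> m"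
  shows "n > K \<Longrightarrow> (\<And>a p. a \<ge> A \<Longrightarrow> p \<in> B n \<Longrightarrow> x a p \<in> m) \<Longrightarrow>
    (\<And>s q. q \<in> B (n + 2) \<Longrightarrow> (\<Sum>l<c. if l \<le> s then act B T l n (x (s - l)) q else 0) \<in> m) \<Longrightarrow>
    p \<in> B n \<Longrightarrow> x a p \<in> m"
proof (induction A arbitrary: n x a p)
  case 0
  show ?case by (rule 0(2)[OF le0 0(4)])
next
  case (Suc A)
  note n = Suc.prems(1) and top = Suc.prems(2) and eq = Suc.prems(3)
  have tm: "act B T l n y q \<in> m" if "\<And>p. p \<in> B n \<Longrightarrow> y p \<in> m" for l n y q
    unfolding act_def by (rule rowmul_in_m[OF that])
  \<comment> \<open>The family \<open>x a\<close> is a polynomial vector, and \<open>A\<close>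
    bounds its degree modulo \<open>m\<close>. Inside the induction on \<open>A\<close>, the
    operators are treated downwards from the last one.\<close>
  have "act B T l n (x a) q \<in> m" if "l < c" "q \<in> B (n + 2)" for l a q
    using that
  proof (induction "c - l" arbitrary: l a q rule: less_induct)
    case (less l)
    have high: "act B T l' n (x a) q \<in> m" if "l < l'" "l' < c" "q \<in> B (n + 2)" for l' a q
      using less.hyps[of l' q a] that by simp
    \<comment> \<open>In coefficient \<open>A + l\<close> of the product, operators above
      \<open>l\<close> already kill \<open>x\<close>, and operators below \<open>l\<close> meet
      coefficients of index above \<open>A\<close>. Only \<open>T l\<close> applied to the
      coefficient \<open>A\<close> remains.\<close>
    have lead: "act B T l n (x A) q \<in> m" if q: "q \<in> B (n + 2)" for q
    proof -
      have "(\<Sum>l'<c. if l' \<le> A + l then act B T l' n (x (A + l - l')) q else 0)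
        = act B T l n (x A) q + (\<Sum>l'\<in>{..<c} - {l}. if l' \<le> A + l then act B T l' n (x (A + l - l')) q else 0)"
        by (subst sum.remove[of _ l]) (use less.prems in auto)
      moreover have "(\<Sum>l'\<in>{..<c} - {l}. if l' \<le> A + l then act B T l' n (x (A + l - l')) q else 0) \<in> m"
      proof (rule rideal_sum[OF m])
        fix l' assume l': "l' \<in> {..<c} - {l}"
        show "(if l' \<le> A + l then act B T l' n (x (A + l - l')) q else 0) \<in> m"
        proof (cases "l' < l")
          case True
          then have "Suc A \<le> A + l - l'" by simp
          then show ?thesis using tm[OF top] rideal_0[OF m] by simp
        next
          case False
          then show ?thesis using high[OF _ _ q, of l'] l' rideal_0[OF m] by simp
        qed
      qed
      ultimately show ?thesis
        using rideal_cong[OF m, of "\<Sum>l'<c. if l' \<le> A + l then act B T l' n (x (A + l - l')) q else 0" "act B T l n (x A) q"]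
          eq[OF q, of "A + l"] by (simp only: add_diff_cancel_left')
    qed
    \<comment> \<open>Applying \<open>T l\<close> removed the top coefficient, and the result is
      still killed by the generic operator because the operators commute modulo \<open>m\<close>.
      The outer induction hypothesis applies two degrees higher.\<close>
    show ?case
    proof (rule Suc.IH[of "n + 2" "\<lambda>a. act B T l n (x a)" q a])
      show "K < n + 2" using n by simp
      show "act B T l n (x a) p \<in> m" if "a \<ge> A" "p \<in> B (n + 2)" for a p
      proof (cases "a = A")
        case True then show ?thesis using lead[OF that(2)] by (simp only:)
      next
        case False
        then have "Suc A \<le> a" using that by simp
        then show ?thesis by (rule tm[OF top])
      qed
      show "(\<Sum>l'<c. if l' \<le> s then act B T l' (n + 2) (act B T l n (x (s - l'))) q else 0) \<in> m"
        if q: "q \<in> B (n + 2 + 2)" for s q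
      proof -
        have comm: "act B T l' (n + 2) (act B T l n y) q - act B T l (n + 2) (act B T l' n y) q \<in> m" if "l' < c" for l' y
          using act_act_comm[OF c that less.prems(1), of y n] q
          by (simp add: cocycles_minimal[OF min] coboundaries_minimal[OF min] add.assoc)
        define y where "y = (\<lambda>q. \<Sum>l'<c. if l' \<le> s then act B T l' n (x (s - l')) q else 0)"
        have "act B T l (n + 2) y q \<in> m" unfolding y_def by (rule tm[OF eq])
        moreover have "act B T l (n + 2) y q = (\<Sum>l'<c. if l' \<le> s then act B T l (n + 2) (act B T l' n (x (s - l'))) q else 0)"
        proof -
          have "act B T l (n + 2) y q = (\<Sum>l'<c. \<Sum>k\<in>B (n + 2). (if l' \<le> s then act B T l' n (x (s - l')) k else 0) * T l (n + 2) k q)"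
            unfolding act_def[of B T l] rowmul_def y_def sum_distrib_right by (rule sum.swap)
          also have "\<dots> = (\<Sum>l'<c. if l' \<le> s then act B T l (n + 2) (act B T l' n (x (s - l'))) q else 0)"
            by (rule sum.cong) (auto simp: act_def[of B T l] rowmul_def)
          finally show ?thesis .
        qed
        moreover have "(\<Sum>l'<c. if l' \<le> s then act B T l' (n + 2) (act B T l n (x (s - l'))) q else 0)
           - (\<Sum>l'<c. if l' \<le> s then act B T l (n + 2) (act B T l' n (x (s - l'))) q else 0) \<in> m"
          by (rule rideal_sum_diff[OF m]) (auto intro: comm rideal_0[OF m])
        ultimately show ?thesis by (simp only: rideal_cong[OF m])
      qed
      show "q \<in> B (n + 2)" by fact
    qed
  qed
  then show ?case using K[OF n, of "x a"] Suc.prems(4) by blast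
qed

text \<open>As \<open>J\<close> contains the \<open>f l\<close>, the operators commute with
  \<open>D\<close> modulo \<open>J\<close>, so the factorisation of \<open>u D\<close> holds
  coefficientwise modulo \<open>J\<close>. The minor is a constant polynomial, hence every
  coefficient of \<open>u ^ r\<close> multiplies it into \<open>J\<close>, and \<open>a\<close> is
  one outside \<open>m\<close>.\<close>

lemma minors_step:
  assumes c: "cdg c B D T" and min: "\<And>n p q. p \<in> B n \<Longrightarrow> q \<in> B (n + 1) \<Longrightarrow> D n p q \<in> m"
    and K: "\<And>n x. n > K \<Longrightarrow> (\<And>l q. l < c \<Longrightarrow> q \<in> B (n + 2) \<Longrightarrow> act B T l n x q \<in> m) \<Longrightarrow> \<forall>q\<in>B n. x q \<in> m"
    and n: "n \<ge> K" and J: "rideal J" "gens_ideal c \<subseteq> J"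
    and minors: "\<And>g h. g \<in> {..<r} \<rightarrow> B (n + 2) \<Longrightarrow> h \<in> {..<r} \<rightarrow> B (n + 3) \<Longrightarrow> Det r (\<lambda>i j. D (n + 2) (g i) (h j)) \<in> J"
    and g: "g \<in> {..<r} \<rightarrow> B n" and h: "h \<in> {..<r} \<rightarrow> B (n + 1)"
  shows "\<exists>a. a \<notin> m \<and> a * Det r (\<lambda>i j. D n (g i) (h j)) \<in> J"
proof -
  have fin: "finite (B n)" for n using c by (simp add: cdg_def)
  define TX where "TX n p q = (\<Sum>l<c. monom (T l n p q) l)" for n p q
  \<comment> \<open>Injectivity is used in degree \<open>n + 1\<close>, the source of
    \<open>D n\<close>; this is why \<open>n >= K\<close> is enough.\<close>
  have inj: "\<forall>p\<in>B (n + 1). y p \<in> coeffs_in m"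
    if y: "\<forall>q\<in>B (n + 3). (\<Sum>p\<in>B (n + 1). y p * TX (n + 1) p q) \<in> coeffs_in m" for y
  proof -
    define A where "A = Suc (Max (insert 0 ((\<lambda>p. degree (y p)) ` B (n + 1))))"
    have A: "coeff (y p) a = 0" if "a \<ge> A" "p \<in> B (n + 1)" for a p
    proof -
      have "degree (y p) \<le> Max (insert 0 ((\<lambda>p. degree (y p)) ` B (n + 1)))"
        using that fin by (intro Max_ge) auto
      then show ?thesis using that by (intro coeff_eq_0) (simp add: A_def)
    qed
    have "coeff (y p) a \<in> m" if "p \<in> B (n + 1)" for p a
    proof (rule mccoy[OF c min K, where n = "n + 1" and A = A and x = "\<lambda>a p. coeff (y p) a" and p = p and a = a])
      show "K < n + 1" using n by simp
      show "coeff (y p) a \<in> m" if "A \<le> a" "p \<in> B (n + 1)" for a p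
        using A[OF that] rideal_0[OF m] by simp
      show "(\<Sum>l<c. if l \<le> s then act B T l (n + 1) (\<lambda>p. coeff (y p) (s - l)) q else 0) \<in> m"
        if "q \<in> B (n + 1 + 2)" for s q
      proof -
        have "coeff (\<Sum>p\<in>B (n + 1). y p * TX (n + 1) p q) s
          = (\<Sum>p\<in>B (n + 1). \<Sum>l<c. coeff (monom (T l (n + 1) p q) l * y p) s)"
          by (simp add: TX_def coeff_sum sum_distrib_left mult.commute)
        also have "\<dots> = (\<Sum>l<c. \<Sum>p\<in>B (n + 1). if l \<le> s then coeff (y p) (s - l) * T l (n + 1) p q else 0)"
          by (subst sum.swap) (auto simp: coeff_monom_mult intro!: sum.cong)
        also have "\<dots> = (\<Sum>l<c. if l \<le> s then act B T l (n + 1) (\<lambda>p. coeff (y p) (s - l)) q else 0)"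
          by (rule sum.cong) (auto simp: act_def rowmul_def)
        finally have eq: "coeff (\<Sum>p\<in>B (n + 1). y p * TX (n + 1) p q) s
          = (\<Sum>l<c. if l \<le> s then act B T l (n + 1) (\<lambda>p. coeff (y p) (s - l)) q else 0)" .
        have "coeff (\<Sum>p\<in>B (n + 1). y p * TX (n + 1) p q) s \<in> m"
          using y that unfolding coeffs_in_def by (simp only: add.assoc) simp
        then show ?thesis unfolding eq .
      qed
    qed (use that in auto)
    then show ?thesis by (auto simp: coeffs_in_def)
  qed
  have one: "1 \<notin> coeffs_in m" using one_m coeffs_in_const[OF m, of 1] by (simp add: one_pCons)
  obtain X u where u: "u \<notin> coeffs_in m"
    and X: "\<And>p p'. p \<in> B (n + 1) \<Longrightarrow> p' \<in> B (n + 1) \<Longrightarrow>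
      (\<Sum>q\<in>B (n + 3). TX (n + 1) p q * X q p') = (if p = p' then u else 0)"
    using generic_right_inverse[OF coeffs_in_ideal[OF m] one coeffs_in_m_prime fin fin inj] by blast
  let ?J = "coeffs_in J"
  have J': "rideal ?J" by (rule coeffs_in_ideal[OF J(1)])
  define DX where "DX n p q = [:D n p q:]" for n p q
  \<comment> \<open>The coefficient of index \<open>s\<close> is the chain map property of
    \<open>T s\<close>.\<close>
  have DT: "(\<Sum>k\<in>B (n + 1). DX n p k * TX (n + 1) k q) - (\<Sum>k\<in>B (n + 2). TX n p k * DX (n + 2) k q) \<in> ?J"
    if "p \<in> B n" "q \<in> B (n + 3)" for p q
    unfolding coeffs_in_def
  proof clarify
    fix s
    have t: "coeff (TX n p q) s = (if s < c then T s n p q else 0)" for n p q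
      by (simp add: TX_def coeff_sum)
    have 1: "coeff (\<Sum>k\<in>B (n + 1). DX n p k * TX (n + 1) k q) s = (\<Sum>k\<in>B (n + 1). D n p k * (if s < c then T s (n + 1) k q else 0))"
      by (simp add: DX_def coeff_sum t)
    have 2: "coeff (\<Sum>k\<in>B (n + 2). TX n p k * DX (n + 2) k q) s = (\<Sum>k\<in>B (n + 2). (if s < c then T s n p k else 0) * D (n + 2) k q)"
      by (simp add: DX_def coeff_sum t mult.commute)
    show "coeff ((\<Sum>k\<in>B (n + 1). DX n p k * TX (n + 1) k q) - (\<Sum>k\<in>B (n + 2). TX n p k * DX (n + 2) k q)) s \<in> J"
    proof (cases "s < c")
      case True
      show ?thesis
        using rideal_diff_sym[OF J(1) subsetD[OF J(2) cdg_chain[OF c that True]]] True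
        by (simp add: 1 2 matmul_def)
    next
      case False then show ?thesis by (simp add: 1 2 rideal_0[OF J(1)])
    qed
  qed
  have uD: "u * DX n p p' - (\<Sum>k\<in>B (n + 2). TX n p k * (\<Sum>q\<in>B (n + 3). DX (n + 2) k q * X q p')) \<in> ?J"
    if "p \<in> B n" "p' \<in> B (n + 1)" for p p'
  proof -
    have "(\<Sum>k\<in>B (n + 1). DX n p k * (\<Sum>q\<in>B (n + 3). TX (n + 1) k q * X q p'))
      = (\<Sum>k\<in>B (n + 1). if k = p' then u * DX n p k else 0)"
      by (rule sum.cong) (auto simp: X that)
    then have "u * DX n p p' = (\<Sum>k\<in>B (n + 1). DX n p k * (\<Sum>q\<in>B (n + 3). TX (n + 1) k q * X q p'))"
      using that fin by simp
    also have "\<dots> = (\<Sum>q\<in>B (n + 3). (\<Sum>k\<in>B (n + 1). DX n p k * TX (n + 1) k q) * X q p')"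
      unfolding sum_distrib_left sum_distrib_right by (subst sum.swap) (simp add: mult.assoc)
    finally have 1: "u * DX n p p' = (\<Sum>q\<in>B (n + 3). (\<Sum>k\<in>B (n + 1). DX n p k * TX (n + 1) k q) * X q p')" .
    have 2: "(\<Sum>k\<in>B (n + 2). TX n p k * (\<Sum>q\<in>B (n + 3). DX (n + 2) k q * X q p'))
       = (\<Sum>q\<in>B (n + 3). (\<Sum>k\<in>B (n + 2). TX n p k * DX (n + 2) k q) * X q p')"
      unfolding sum_distrib_left sum_distrib_right by (subst sum.swap) (simp add: mult.assoc)
    show ?thesis unfolding 1 2
    proof (rule rideal_sum_diff[OF J'])
      fix q assume "q \<in> B (n + 3)"
      from rideal_mult'[OF J' DT[OF that(1) this], of "X q p'"]
      show "(\<Sum>k\<in>B (n + 1). DX n p k * TX (n + 1) k q) * X q p' - (\<Sum>k\<in>B (n + 2). TX n p k * DX (n + 2) k q) * X q p' \<in> ?J"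
        by (simp only: left_diff_distrib)
    qed
  qed
  have "Det r (\<lambda>i j. \<Sum>k\<in>B (n + 2). TX n (g i) k * (\<Sum>q\<in>B (n + 3). DX (n + 2) k q * X q (h j))) \<in> ?J"
  proof (rule Det_mult_mem[OF J' fin, where C = "\<lambda>k j. \<Sum>q\<in>B (n + 3). DX (n + 2) k q * X q (h j)"])
    fix g' assume g': "g' \<in> {..<r} \<rightarrow> B (n + 2)"
    show "Det r (\<lambda>i j. \<Sum>q\<in>B (n + 3). DX (n + 2) (g' i) q * X q (h j)) \<in> ?J"
    proof (rule Det_mult_mem'[OF J' fin, where C = "\<lambda>i q. DX (n + 2) (g' i) q" and E = "\<lambda>q j. X q (h j)"])
      fix h' assume "h' \<in> {..<r} \<rightarrow> B (n + 3)"
      then show "Det r (\<lambda>i j. DX (n + 2) (g' i) (h' j)) \<in> ?J"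
        using minors[OF g'] by (simp add: DX_def Det_const_poly coeffs_in_const[OF J(1)])
    qed
  qed
  moreover have "Det r (\<lambda>i j. u * DX n (g i) (h j))
      - Det r (\<lambda>i j. \<Sum>k\<in>B (n + 2). TX n (g i) k * (\<Sum>q\<in>B (n + 3). DX (n + 2) k q * X q (h j))) \<in> ?J"
    using g h by (intro Det_diff_mem[OF J'] uD) auto
  ultimately have "Det r (\<lambda>i j. u * DX n (g i) (h j)) \<in> ?J"
    using rideal_cong[OF J'] by blast
  then have mem: "u ^ r * [:Det r (\<lambda>i j. D n (g i) (h j)):] \<in> ?J"
    unfolding Det_scale by (simp add: DX_def Det_const_poly)
  \<comment> \<open>The extension of \<open>m\<close> is prime, so powers of \<open>u\<close> keep a
    coefficient outside \<open>m\<close>.\<close>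
  have "u ^ r \<notin> coeffs_in m"
    by (induction r) (use u one coeffs_in_m_prime in auto)
  then obtain s where s: "coeff (u ^ r) s \<notin> m" by (auto simp: coeffs_in_def)
  have "coeff (u ^ r * [:Det r (\<lambda>i j. D n (g i) (h j)):]) s \<in> J"
    using mem by (auto simp: coeffs_in_def)
  then have "coeff (u ^ r) s * Det r (\<lambda>i j. D n (g i) (h j)) \<in> J" by (simp add: mult.commute)
  then show ?thesis using s by blast
qed

end

section \<open>Comparison of resolutions\<close>

lemma mod_homD:
  assumes "h \<in> mod_hom R M N"
  shows "\<And>x. x \<in> carrier M \<Longrightarrow> h x \<in> carrier N"
    and "\<And>x y. x \<in> carrier M \<Longrightarrow> y \<in> carrier M \<Longrightarrow> h (x \<oplus>\<^bsub>M\<^esub> y) = h x \<oplus>\<^bsub>N\<^esub> h y"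
    and "\<And>a x. a \<in> carrier R \<Longrightarrow> x \<in> carrier M \<Longrightarrow> h (a \<odot>\<^bsub>M\<^esub> x) = a \<odot>\<^bsub>N\<^esub> h x"
  using assms by (auto simp: mod_hom_def)

lemma mod_homI:
  assumes "\<And>x. x \<in> carrier M \<Longrightarrow> h x \<in> carrier N"
    and "\<And>x y. x \<in> carrier M \<Longrightarrow> y \<in> carrier M \<Longrightarrow> h (x \<oplus>\<^bsub>M\<^esub> y) = h x \<oplus>\<^bsub>N\<^esub> h y"
    and "\<And>a x. a \<in> carrier R \<Longrightarrow> x \<in> carrier M \<Longrightarrow> h (a \<odot>\<^bsub>M\<^esub> x) = a \<odot>\<^bsub>N\<^esub> h x"
  shows "h \<in> mod_hom R M N"
  using assms by (auto simp: mod_hom_def)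

lemma module_abelian_group: "module R M \<Longrightarrow> abelian_group M"
  by (simp add: module_def)

lemma mod_hom_zero:
  assumes "module R M" "module R N" "h \<in> mod_hom R M N"
  shows "h \<zero>\<^bsub>M\<^esub> = \<zero>\<^bsub>N\<^esub>"
proof -
  interpret M: abelian_group M by (rule module_abelian_group[OF assms(1)])
  interpret N: abelian_group N by (rule module_abelian_group[OF assms(2)])
  have "h \<zero>\<^bsub>M\<^esub> \<oplus>\<^bsub>N\<^esub> h \<zero>\<^bsub>M\<^esub> = h \<zero>\<^bsub>M\<^esub>"
    by (simp add: mod_homD(2)[OF assms(3), symmetric])
  then show ?thesis using mod_homD(1)[OF assms(3) M.zero_closed] N.add.l_cancel_one by simp
qed

lemma mod_hom_minus:
  assumes "module R M" "module R N" "h \<in> mod_hom R M N" "x \<in> carrier M" "y \<in> carrier M"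
  shows "h (x \<ominus>\<^bsub>M\<^esub> y) = h x \<ominus>\<^bsub>N\<^esub> h y"
proof -
  interpret M: abelian_group M by (rule module_abelian_group[OF assms(1)])
  interpret N: abelian_group N by (rule module_abelian_group[OF assms(2)])
  note hom = mod_homD[OF assms(3)]
  have "h (x \<ominus>\<^bsub>M\<^esub> y) \<oplus>\<^bsub>N\<^esub> h y = h x"
    using assms(4,5) by (simp add: hom(2)[symmetric] M.minus_eq M.a_assoc M.l_neg)
  then have "h x \<ominus>\<^bsub>N\<^esub> h y = (h (x \<ominus>\<^bsub>M\<^esub> y) \<oplus>\<^bsub>N\<^esub> h y) \<oplus>\<^bsub>N\<^esub> \<ominus>\<^bsub>N\<^esub> h y"
    by (simp add: N.minus_eq)
  then show ?thesis
    using assms(4,5) hom(1)[of "x \<ominus>\<^bsub>M\<^esub> y"] hom(1)[of y] by (simp add: N.a_assoc N.r_neg)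
qed

lemma mod_hom_comp:
  "h \<in> mod_hom R M N \<Longrightarrow> k \<in> mod_hom R N L \<Longrightarrow> (\<lambda>x. k (h x)) \<in> mod_hom R M L"
  by (rule mod_homI) (simp_all add: mod_homD[of h] mod_homD[of k])

lemma mod_hom_diff:
  assumes "module R M" "module R N" "h \<in> mod_hom R M N" "k \<in> mod_hom R M N"
  shows "(\<lambda>x. h x \<ominus>\<^bsub>N\<^esub> k x) \<in> mod_hom R M N"
proof -
  interpret N: module R N by (rule assms(2))
  note h = mod_homD[OF assms(3)] and k = mod_homD[OF assms(4)]
  show ?thesis
  proof (rule mod_homI)
    show "h x \<ominus>\<^bsub>N\<^esub> k x \<in> carrier N" if "x \<in> carrier M" for x
      using that h k by simp
    show "h (x \<oplus>\<^bsub>M\<^esub> y) \<ominus>\<^bsub>N\<^esub> k (x \<oplus>\<^bsub>M\<^esub> y) = (h x \<ominus>\<^bsub>N\<^esub> k x) \<oplus>\<^bsub>N\<^esub> (h y \<ominus>\<^bsub>N\<^esub> k y)"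
      if "x \<in> carrier M" "y \<in> carrier M" for x y
      using that h k by (simp add: N.minus_eq N.minus_add N.a_ac)
    show "h (a \<odot>\<^bsub>M\<^esub> x) \<ominus>\<^bsub>N\<^esub> k (a \<odot>\<^bsub>M\<^esub> x) = a \<odot>\<^bsub>N\<^esub> (h x \<ominus>\<^bsub>N\<^esub> k x)"
      if "a \<in> carrier R" "x \<in> carrier M" for a x
      using that h k by (simp add: N.minus_eq N.smult_r_distr N.smult_r_minus)
  qed
qed

lemma (in abelian_group) minus_zero_right:
  assumes "x \<in> carrier G" shows "x \<ominus> \<zero> = x"
proof -
  have "\<ominus> \<zero> = \<zero>"
    by (rule trans[OF l_zero[OF a_inv_closed[OF zero_closed], symmetric] r_neg[OF zero_closed]])
  then show ?thesis using assms by (simp add: minus_eq)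
qed

lemma unit_vec_carrier: "cring R \<Longrightarrow> x \<in> X \<Longrightarrow> unit_vec R x \<in> carrier (free_mod R X)"
proof -
  assume "cring R" and x: "x \<in> X"
  then interpret cring R by simp
  have "finite {p. unit_vec R x p \<noteq> \<zero>\<^bsub>R\<^esub>}"
    by (rule finite_subset[of _ "{x}"]) (auto simp: unit_vec_def)
  then show ?thesis using x by (auto simp: free_mod_def unit_vec_def)
qed

lemma free_mod_hom_cong:
  assumes R: "cring R" and h: "h \<in> mod_hom R (free_mod R X) N" and k: "k \<in> mod_hom R (free_mod R X) N"
    and N: "module R N"
    and eq: "\<And>x. x \<in> X \<Longrightarrow> h (unit_vec R x) = k (unit_vec R x)"
    and v: "v \<in> carrier (free_mod R X)"
  shows "h v = k v"
proof -
  interpret cring R by fact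
  let ?F = "free_mod R X"
  have F: "module R ?F" by (rule free_mod_module[OF R])
  have "\<forall>v\<in>carrier ?F. {x. v x \<noteq> \<zero>\<^bsub>R\<^esub>} \<subseteq> Y \<longrightarrow> h v = k v" if "finite Y" "Y \<subseteq> X" for Y
    using that
  proof (induction Y)
    case empty
    have "v = \<zero>\<^bsub>?F\<^esub>" if "{x. v x \<noteq> \<zero>\<^bsub>R\<^esub>} \<subseteq> {}" for v
      using that by (auto simp: free_mod_def)
    then show ?case using mod_hom_zero[OF F N h] mod_hom_zero[OF F N k] by metis
  next
    case (insert x Y)
    show ?case
    proof (intro ballI impI)
      fix v assume v: "v \<in> carrier ?F" and supp: "{y. v y \<noteq> \<zero>\<^bsub>R\<^esub>} \<subseteq> insert x Y"
      define w where "w = v(x := \<zero>\<^bsub>R\<^esub>)"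
      have w: "w \<in> carrier ?F"
        using v by (auto simp: free_mod_def w_def elim: rev_finite_subset)
      have "{y. w y \<noteq> \<zero>\<^bsub>R\<^esub>} \<subseteq> Y" using supp by (auto simp: w_def)
      then have hk: "h w = k w" using insert w by auto
      have vx: "v x \<in> carrier R" using v by (auto simp: free_mod_def)
      have x: "x \<in> X" using insert by simp
      have e: "unit_vec R x \<in> carrier ?F" by (rule unit_vec_carrier[OF R x])
      have "v y = (w \<oplus>\<^bsub>?F\<^esub> (v x \<odot>\<^bsub>?F\<^esub> unit_vec R x)) y" for y
        using v vx by (auto simp: free_mod_def w_def unit_vec_def)
      then have v_eq: "v = w \<oplus>\<^bsub>?F\<^esub> (v x \<odot>\<^bsub>?F\<^esub> unit_vec R x)" by blast
      have s: "v x \<odot>\<^bsub>?F\<^esub> unit_vec R x \<in> carrier ?F" by (rule module.smult_closed[OF F vx e])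
      have "h v = h w \<oplus>\<^bsub>N\<^esub> v x \<odot>\<^bsub>N\<^esub> h (unit_vec R x)"
        by (subst v_eq) (simp add: mod_homD(2)[OF h w s] mod_homD(3)[OF h vx e])
      also have "\<dots> = k w \<oplus>\<^bsub>N\<^esub> v x \<odot>\<^bsub>N\<^esub> k (unit_vec R x)" using hk eq[OF x] by simp
      also have "\<dots> = k v"
        by (subst (2) v_eq) (simp add: mod_homD(2)[OF k w s] mod_homD(3)[OF k vx e])
      finally show "h v = k v" .
    qed
  qed
  from this[of "{x. v x \<noteq> \<zero>\<^bsub>R\<^esub>}"] v show ?thesis by (auto simp: free_mod_def)
qed

lemma free_mod_hom_exists:
  assumes R: "cring R" and G: "module R G" and g: "g \<in> X \<rightarrow> carrier G"
  shows "\<exists>h\<in>mod_hom R (free_mod R X) G. \<forall>x\<in>X. h (unit_vec R x) = g x"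
proof -
  interpret cring R by fact
  interpret G: module R G by fact
  let ?F = "free_mod R X"
  define h where "h v = (\<Oplus>\<^bsub>G\<^esub>x\<in>{x. v x \<noteq> \<zero>\<^bsub>R\<^esub>}. v x \<odot>\<^bsub>G\<^esub> g x)" for v
  have gX: "v x \<odot>\<^bsub>G\<^esub> g x \<in> carrier G" if "v \<in> carrier ?F" "x \<in> X" for v x
    using that g by (auto simp: free_mod_def)
  have supp: "{x. v x \<noteq> \<zero>\<^bsub>R\<^esub>} \<subseteq> X" "finite {x. v x \<noteq> \<zero>\<^bsub>R\<^esub>}" if "v \<in> carrier ?F" for v
    using that by (auto simp: free_mod_def)
  have h_eq: "h v = (\<Oplus>\<^bsub>G\<^esub>x\<in>Y. v x \<odot>\<^bsub>G\<^esub> g x)"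
    if "v \<in> carrier ?F" "finite Y" "{x. v x \<noteq> \<zero>\<^bsub>R\<^esub>} \<subseteq> Y" "Y \<subseteq> X" for v Y
    unfolding h_def
  proof (rule G.add.finprod_mono_neutral_cong_left[OF that(2,3)])
    fix x assume "x \<in> Y - {x. v x \<noteq> \<zero>\<^bsub>R\<^esub>}"
    moreover from this have "g x \<in> carrier G" using that(4) g by blast
    ultimately show "v x \<odot>\<^bsub>G\<^esub> g x = \<zero>\<^bsub>G\<^esub>" by (simp add: G.smult_l_null)
  qed (use gX that in auto)
  have "h \<in> mod_hom R ?F G"
  proof (rule mod_homI)
    fix v assume v: "v \<in> carrier ?F"
    show "h v \<in> carrier G" unfolding h_def
      by (rule G.finsum_closed) (use gX[OF v] supp[OF v] in auto)
  next
    fix v w assume v: "v \<in> carrier ?F" and w: "w \<in> carrier ?F"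
    let ?Y = "{x. v x \<noteq> \<zero>\<^bsub>R\<^esub>} \<union> {x. w x \<noteq> \<zero>\<^bsub>R\<^esub>}"
    have Y: "finite ?Y" "?Y \<subseteq> X" using supp[OF v] supp[OF w] by auto
    have vw: "v \<oplus>\<^bsub>?F\<^esub> w \<in> carrier ?F"
      by (rule abelian_monoid.a_closed[OF abelian_group.axioms(1)[OF module_abelian_group[OF free_mod_module[OF R]]] v w])
    have vw': "(v \<oplus>\<^bsub>?F\<^esub> w) x = v x \<oplus>\<^bsub>R\<^esub> w x" for x by (simp add: free_mod_def)
    have c: "v x \<in> carrier R" "w x \<in> carrier R" for x using v w by (auto simp: free_mod_def)
    have sY: "{x. (v \<oplus>\<^bsub>?F\<^esub> w) x \<noteq> \<zero>\<^bsub>R\<^esub>} \<subseteq> ?Y" unfolding vw' by auto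
    have "h (v \<oplus>\<^bsub>?F\<^esub> w) = (\<Oplus>\<^bsub>G\<^esub>x\<in>?Y. (v \<oplus>\<^bsub>?F\<^esub> w) x \<odot>\<^bsub>G\<^esub> g x)"
      by (rule h_eq[OF vw Y(1) sY Y(2)])
    also have "\<dots> = (\<Oplus>\<^bsub>G\<^esub>x\<in>?Y. v x \<odot>\<^bsub>G\<^esub> g x \<oplus>\<^bsub>G\<^esub> w x \<odot>\<^bsub>G\<^esub> g x)"
    proof (rule G.finsum_cong'[OF refl])
      show "(\<lambda>x. v x \<odot>\<^bsub>G\<^esub> g x \<oplus>\<^bsub>G\<^esub> w x \<odot>\<^bsub>G\<^esub> g x) \<in> ?Y \<rightarrow> carrier G"
        using gX[OF v] gX[OF w] Y(2) by auto
    next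
      fix x assume "x \<in> ?Y"
      then have "g x \<in> carrier G" using Y(2) g by auto
      then show "(v \<oplus>\<^bsub>?F\<^esub> w) x \<odot>\<^bsub>G\<^esub> g x = v x \<odot>\<^bsub>G\<^esub> g x \<oplus>\<^bsub>G\<^esub> w x \<odot>\<^bsub>G\<^esub> g x"
        unfolding vw' using c by (simp add: G.smult_l_distr)
    qed
    also have "\<dots> = (\<Oplus>\<^bsub>G\<^esub>x\<in>?Y. v x \<odot>\<^bsub>G\<^esub> g x) \<oplus>\<^bsub>G\<^esub> (\<Oplus>\<^bsub>G\<^esub>x\<in>?Y. w x \<odot>\<^bsub>G\<^esub> g x)"
      by (rule G.finsum_addf) (use gX[OF v] gX[OF w] Y(2) in auto)
    also have "\<dots> = h v \<oplus>\<^bsub>G\<^esub> h w"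
      using h_eq[OF v Y(1) _ Y(2)] h_eq[OF w Y(1) _ Y(2)] by simp
    finally show "h (v \<oplus>\<^bsub>?F\<^esub> w) = h v \<oplus>\<^bsub>G\<^esub> h w" .
  next
    fix a v assume a: "a \<in> carrier R" and v: "v \<in> carrier ?F"
    let ?Y = "{x. v x \<noteq> \<zero>\<^bsub>R\<^esub>}"
    have av: "a \<odot>\<^bsub>?F\<^esub> v \<in> carrier ?F" by (rule module.smult_closed[OF free_mod_module[OF R] a v])
    have av': "(a \<odot>\<^bsub>?F\<^esub> v) x = a \<otimes>\<^bsub>R\<^esub> v x" for x by (simp add: free_mod_def)
    have c: "v x \<in> carrier R" for x using v by (auto simp: free_mod_def)
    have "h (a \<odot>\<^bsub>?F\<^esub> v) = (\<Oplus>\<^bsub>G\<^esub>x\<in>?Y. (a \<odot>\<^bsub>?F\<^esub> v) x \<odot>\<^bsub>G\<^esub> g x)"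
      by (rule h_eq[OF av supp(2)[OF v] _ supp(1)[OF v]]) (use a in \<open>auto simp: av'\<close>)
    also have "\<dots> = (\<Oplus>\<^bsub>G\<^esub>x\<in>?Y. a \<odot>\<^bsub>G\<^esub> (v x \<odot>\<^bsub>G\<^esub> g x))"
    proof (rule G.finsum_cong'[OF refl])
      show "(\<lambda>x. a \<odot>\<^bsub>G\<^esub> (v x \<odot>\<^bsub>G\<^esub> g x)) \<in> ?Y \<rightarrow> carrier G"
        using gX[OF v] supp[OF v] a by auto
    next
      fix x assume "x \<in> ?Y"
      then have "g x \<in> carrier G" using supp[OF v] g by auto
      then show "(a \<odot>\<^bsub>?F\<^esub> v) x \<odot>\<^bsub>G\<^esub> g x = a \<odot>\<^bsub>G\<^esub> (v x \<odot>\<^bsub>G\<^esub> g x)"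
        unfolding av' using a c by (simp add: G.smult_assoc1)
    qed
    also have "\<dots> = a \<odot>\<^bsub>G\<^esub> h v" unfolding h_def
      by (rule G.finsum_smult_ldistr[symmetric]) (use supp[OF v] a gX[OF v] in auto)
    finally show "h (a \<odot>\<^bsub>?F\<^esub> v) = a \<odot>\<^bsub>G\<^esub> h v" .
  qed
  moreover have "h (unit_vec R x) = g x" if x: "x \<in> X" for x
  proof -
    have gx: "g x \<in> carrier G" using g x by auto
    have "h (unit_vec R x) = (\<Oplus>\<^bsub>G\<^esub>y\<in>{x}. unit_vec R x y \<odot>\<^bsub>G\<^esub> g y)"
      by (rule h_eq[OF unit_vec_carrier[OF R x]]) (use x in \<open>auto simp: unit_vec_def\<close>)
    also have "\<dots> = g x" using gx by (simp add: unit_vec_def)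
    finally show ?thesis .
  qed
  ultimately show ?thesis by blast
qed

text \<open>Containment of images replaces surjectivity of \<open>e\<close>, so boundaries can be
  lifted without making the kernels into modules. It is a predicate on three given modules so that
  one comparison argument serves both free and projective sources.\<close>

definition lifting ::
  "('a, 'e) ring_scheme \<Rightarrow> ('a, 'f) module \<Rightarrow> ('a, 'g) module \<Rightarrow> ('a, 'n) module \<Rightarrow> bool" where
  "lifting R P G N \<longleftrightarrow> (\<forall>h\<in>mod_hom R P N. \<forall>e\<in>mod_hom R G N. h ` carrier P \<subseteq> e ` carrier G \<longrightarrow>
     (\<exists>k\<in>mod_hom R P G. \<forall>v\<in>carrier P. e (k v) = h v))"

lemma lifting_ex:
  assumes "lifting R P G N" "h \<in> mod_hom R P N" "e \<in> mod_hom R G N"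
    and "\<And>v. v \<in> carrier P \<Longrightarrow> h v \<in> e ` carrier G"
  shows "\<exists>k\<in>mod_hom R P G. \<forall>v\<in>carrier P. e (k v) = h v"
  by (rule assms(1)[unfolded lifting_def, THEN bspec, OF assms(2), THEN bspec, OF assms(3), THEN mp,
        OF image_subsetI[OF assms(4)]])

lemma lifting_free:
  assumes R: "cring R" and G: "module R G" and N: "module R N"
  shows "lifting R (free_mod R X) G N"
  unfolding lifting_def
proof (intro ballI impI)
  fix h e assume h: "h \<in> mod_hom R (free_mod R X) N" and e: "e \<in> mod_hom R G N"
    and im: "h ` carrier (free_mod R X) \<subseteq> e ` carrier G"
  have "\<forall>x\<in>X. \<exists>y. y \<in> carrier G \<and> e y = h (unit_vec R x)"
  proof
    fix x assume "x \<in> X"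
    then have "h (unit_vec R x) \<in> e ` carrier G"
      by (intro subsetD[OF im] imageI unit_vec_carrier[OF R])
    then obtain y where "h (unit_vec R x) = e y" "y \<in> carrier G" by (rule imageE)
    then show "\<exists>y. y \<in> carrier G \<and> e y = h (unit_vec R x)" by (intro exI[of _ y]) simp
  qed
  from bchoice[OF this] obtain g where g': "\<forall>x\<in>X. g x \<in> carrier G \<and> e (g x) = h (unit_vec R x)" by (rule exE)
  then have g: "\<And>x. x \<in> X \<Longrightarrow> g x \<in> carrier G" "\<And>x. x \<in> X \<Longrightarrow> e (g x) = h (unit_vec R x)" by simp_all
  from g(1) have "g \<in> X \<rightarrow> carrier G" by simp
  from free_mod_hom_exists[OF R G this]
  obtain k where k: "k \<in> mod_hom R (free_mod R X) G" "\<forall>x\<in>X. k (unit_vec R x) = g x" by (rule bexE)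
  have "e (k v) = h v" if "v \<in> carrier (free_mod R X)" for v
    by (rule free_mod_hom_cong[OF R mod_hom_comp[OF k(1) e] h N _ that]) (simp only: bspec[OF k(2)] g(2))
  then show "\<exists>k\<in>mod_hom R (free_mod R X) G. \<forall>v\<in>carrier (free_mod R X). e (k v) = h v"
    by (intro bexI[OF _ k(1)] ballI)
qed

lemma lifting_projective:
  fixes P :: "('a, 'p) module"
  assumes R: "cring R" and P: "projective R P" and G: "module R G" and N: "module R N"
  shows "lifting R P G N"
  unfolding lifting_def
proof (intro ballI impI)
  fix h e assume h: "h \<in> mod_hom R P N" and e: "e \<in> mod_hom R G N" and im: "h ` carrier P \<subseteq> e ` carrier G"
  obtain X :: "'p set" and i p where i: "i \<in> mod_hom R P (free_mod R X)" and p: "p \<in> mod_hom R (free_mod R X) P"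
    and pi: "\<And>x. x \<in> carrier P \<Longrightarrow> p (i x) = x"
    using P unfolding projective_def by blast
  have hp: "h (p v) \<in> e ` carrier G" if "v \<in> carrier (free_mod R X)" for v
    by (rule subsetD[OF im imageI[OF mod_homD(1)[OF p that]]])
  from lifting_ex[OF lifting_free[OF R G N] mod_hom_comp[OF p h] e hp]
    obtain k where k1: "k \<in> mod_hom R (free_mod R X) G" and k2: "\<forall>v\<in>carrier (free_mod R X). e (k v) = h (p v)" by (rule bexE)
    note k = k1 bspec[OF k2]
  have "e (k (i v)) = h v" if "v \<in> carrier P" for v
    using k(2)[OF mod_homD(1)[OF i that]] pi[OF that] by simp
  then show "\<exists>k\<in>mod_hom R P G. \<forall>v\<in>carrier P. e (k v) = h v"
    by (intro bexI[OF _ mod_hom_comp[OF i k(1)]] ballI)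
qed

lemma resolutionD:
  assumes "resolution R M F d e"
  shows "module R (F i)" "e \<in> mod_hom R (F 0) M" "d (Suc i) \<in> mod_hom R (F (Suc i)) (F i)"
    "e ` carrier (F 0) = carrier M"
    "x \<in> carrier (F 0) \<Longrightarrow> e x = \<zero>\<^bsub>M\<^esub> \<Longrightarrow> x \<in> d (Suc 0) ` carrier (F (Suc 0))"
    "x \<in> carrier (F (Suc 0)) \<Longrightarrow> e (d (Suc 0) x) = \<zero>\<^bsub>M\<^esub>"
    "x \<in> carrier (F (Suc i)) \<Longrightarrow> d (Suc i) x = \<zero>\<^bsub>F i\<^esub> \<Longrightarrow> x \<in> d (Suc (Suc i)) ` carrier (F (Suc (Suc i)))"
    "x \<in> carrier (F (Suc (Suc i))) \<Longrightarrow> d (Suc i) (d (Suc (Suc i)) x) = \<zero>\<^bsub>F i\<^esub>"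
proof -
  note r = assms[unfolded resolution_def]
  show "module R (F i)" "e \<in> mod_hom R (F 0) M" "d (Suc i) \<in> mod_hom R (F (Suc i)) (F i)"
    "e ` carrier (F 0) = carrier M" using r by auto
  have 1: "d (Suc 0) ` carrier (F (Suc 0)) = a_kernel (F 0) M e" using r by simp
  have 2: "d (Suc (Suc i)) ` carrier (F (Suc (Suc i))) = a_kernel (F (Suc i)) (F i) (d (Suc i))"
    using r by blast
  show "x \<in> carrier (F 0) \<Longrightarrow> e x = \<zero>\<^bsub>M\<^esub> \<Longrightarrow> x \<in> d (Suc 0) ` carrier (F (Suc 0))"
    unfolding 1 by (simp add: a_kernel_def kernel_def)
  show "x \<in> carrier (F (Suc 0)) \<Longrightarrow> e (d (Suc 0) x) = \<zero>\<^bsub>M\<^esub>"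
    using imageI[of x "carrier (F (Suc 0))" "d (Suc 0)"] unfolding 1 by (simp add: a_kernel_def kernel_def)
  show "x \<in> carrier (F (Suc i)) \<Longrightarrow> d (Suc i) x = \<zero>\<^bsub>F i\<^esub> \<Longrightarrow> x \<in> d (Suc (Suc i)) ` carrier (F (Suc (Suc i)))"
    unfolding 2 by (simp add: a_kernel_def kernel_def)
  show "x \<in> carrier (F (Suc (Suc i))) \<Longrightarrow> d (Suc i) (d (Suc (Suc i)) x) = \<zero>\<^bsub>F i\<^esub>"
    using imageI[of x "carrier (F (Suc (Suc i)))" "d (Suc (Suc i))"] unfolding 2 by (simp add: a_kernel_def kernel_def)
qed

lemma comparison_map:
  assumes M: "module R M" and F: "resolution R M F d e" and P: "resolution R M P \<delta> \<eta>"
    and l0: "lifting R (F 0) (P 0) M" and lS: "\<And>i. lifting R (F (Suc i)) (P (Suc i)) (P i)"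
  shows "\<exists>\<alpha>. (\<forall>i. \<alpha> i \<in> mod_hom R (F i) (P i)) \<and> (\<forall>x\<in>carrier (F 0). \<eta> (\<alpha> 0 x) = e x) \<and>
    (\<forall>i. \<forall>x\<in>carrier (F (Suc i)). \<delta> (Suc i) (\<alpha> (Suc i) x) = \<alpha> i (d (Suc i) x))"
proof -
  note F = resolutionD[OF F] and P = resolutionD[OF P]
  \<comment> \<open>The second conjunct, that boundaries go to boundaries, is the containment of
    images required by the lifting in the next degree.\<close>
  let ?Q = "\<lambda>i a. a \<in> mod_hom R (F i) (P i) \<and>
     (\<forall>x\<in>carrier (F (Suc i)). a (d (Suc i) x) \<in> \<delta> (Suc i) ` carrier (P (Suc i))) \<and>
     (i = 0 \<longrightarrow> (\<forall>x\<in>carrier (F 0). \<eta> (a x) = e x))"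
  have "\<exists>a. ?Q 0 a"
  proof -
    have ex: "e x \<in> \<eta> ` carrier (P 0)" if "x \<in> carrier (F 0)" for x
      using imageI[OF that, of e] F(4) P(4) by simp
    from lifting_ex[OF l0 F(2) P(2) ex]
    obtain a where a1: "a \<in> mod_hom R (F 0) (P 0)" and a2: "\<forall>x\<in>carrier (F 0). \<eta> (a x) = e x" by (rule bexE)
    note a = a1 bspec[OF a2]
    have "a (d (Suc 0) x) \<in> \<delta> (Suc 0) ` carrier (P (Suc 0))" if x: "x \<in> carrier (F (Suc 0))" for x
    proof -
      have dx: "d (Suc 0) x \<in> carrier (F 0)" by (rule mod_homD(1)[OF F(3) x])
      show ?thesis by (rule P(5)[OF mod_homD(1)[OF a(1) dx]]) (simp add: a(2)[OF dx] F(6)[OF x])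
    qed
    then show ?thesis using a by blast
  qed
  moreover have "\<exists>b. ?Q (Suc i) b \<and> (\<forall>x\<in>carrier (F (Suc i)). \<delta> (Suc i) (b x) = a (d (Suc i) x))" if a: "?Q i a" for a i
  proof -
    have a1: "a \<in> mod_hom R (F i) (P i)" and a2: "\<And>x. x \<in> carrier (F (Suc i)) \<Longrightarrow> a (d (Suc i) x) \<in> \<delta> (Suc i) ` carrier (P (Suc i))"
      using a by simp_all
    from lifting_ex[OF lS mod_hom_comp[OF F(3) a1] P(3) a2]
    obtain b where b1: "b \<in> mod_hom R (F (Suc i)) (P (Suc i))" and b2: "\<forall>x\<in>carrier (F (Suc i)). \<delta> (Suc i) (b x) = a (d (Suc i) x)" by (rule bexE)
    note b = b1 bspec[OF b2]
    have "b (d (Suc (Suc i)) x) \<in> \<delta> (Suc (Suc i)) ` carrier (P (Suc (Suc i)))" if x: "x \<in> carrier (F (Suc (Suc i)))" for x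
    proof -
      have dx: "d (Suc (Suc i)) x \<in> carrier (F (Suc i))" by (rule mod_homD(1)[OF F(3) x])
      show ?thesis
        by (rule P(7)[OF mod_homD(1)[OF b(1) dx]])
          (simp only: b(2)[OF dx] F(8)[OF x] mod_hom_zero[OF F(1) P(1) a1])
    qed
    then show ?thesis using b by blast
  qed
  ultimately obtain \<alpha> where "\<forall>i. ?Q i (\<alpha> i) \<and> (\<forall>x\<in>carrier (F (Suc i)). \<delta> (Suc i) (\<alpha> (Suc i) x) = \<alpha> i (d (Suc i) x))"
    using dependent_nat_choice[of ?Q "\<lambda>i a b. \<forall>x\<in>carrier (F (Suc i)). \<delta> (Suc i) (b x) = a (d (Suc i) x)"] by blast
  then show ?thesis by blast
qed

text \<open>The identity and \<open>\<gamma>\<close> both lift the identity of \<open>M\<close>, so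
  their difference is null-homotopic.\<close>

lemma comparison_homotopy:
  assumes M: "module R M" and F: "resolution R M F d e"
    and l: "\<And>i. lifting R (F i) (F (Suc i)) (F i)"
    and g: "\<And>i. \<gamma> i \<in> mod_hom R (F i) (F i)"
    and g0: "\<And>x. x \<in> carrier (F 0) \<Longrightarrow> e (\<gamma> 0 x) = e x"
    and gS: "\<And>i x. x \<in> carrier (F (Suc i)) \<Longrightarrow> d (Suc i) (\<gamma> (Suc i) x) = \<gamma> i (d (Suc i) x)"
  shows "\<exists>s. (\<forall>i. s i \<in> mod_hom R (F i) (F (Suc i))) \<and>
    (\<forall>i. \<forall>x\<in>carrier (F (Suc i)). d (Suc (Suc i)) (s (Suc i) x) =
        x \<ominus>\<^bsub>F (Suc i)\<^esub> \<gamma> (Suc i) x \<ominus>\<^bsub>F (Suc i)\<^esub> s i (d (Suc i) x))"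
proof -
  note F = resolutionD[OF F]
  have id: "(\<lambda>x. x) \<in> mod_hom R (F i) (F i)" for i by (rule mod_homI) auto
  let ?k = "\<lambda>i x. x \<ominus>\<^bsub>F i\<^esub> \<gamma> i x"
  let ?h = "\<lambda>i s x. ?k (Suc i) x \<ominus>\<^bsub>F (Suc i)\<^esub> s (d (Suc i) x)"
  let ?im = "\<lambda>i. d (Suc i) ` carrier (F (Suc i))"
  let ?Q = "\<lambda>i s. s \<in> mod_hom R (F i) (F (Suc i)) \<and> (\<forall>x\<in>carrier (F (Suc i)). ?h i s x \<in> ?im (Suc i))"
  have k_hom: "?k i \<in> mod_hom R (F i) (F i)" for i by (intro mod_hom_diff F(1) id g)
  have h_hom: "?h i s \<in> mod_hom R (F (Suc i)) (F (Suc i))" if "s \<in> mod_hom R (F i) (F (Suc i))" for i s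
    by (intro mod_hom_diff F(1) k_hom mod_hom_comp[OF F(3) that])
  have self: "y \<ominus>\<^bsub>N\<^esub> y = \<zero>\<^bsub>N\<^esub>" if "abelian_group N" "y \<in> carrier N" for y and N :: "('a, 'z) module"
    using that by (simp add: abelian_group.r_neg abelian_group.minus_eq)
  \<comment> \<open>Serves both the start and the recursion: \<open>\<kappa>\<close> is the identity
    minus \<open>\<gamma>\<close>, corrected by the previous homotopy. On boundaries the correction
    vanishes, which makes the next correction a cycle.\<close>
  have step: "\<exists>t. ?Q i t \<and> (\<forall>x\<in>carrier (F i). d (Suc i) (t x) = \<kappa> x)"
    if \<kappa>: "\<kappa> \<in> mod_hom R (F i) (F i)" and im: "\<And>x. x \<in> carrier (F i) \<Longrightarrow> \<kappa> x \<in> ?im i"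
      and \<kappa>d: "\<And>x. x \<in> carrier (F (Suc i)) \<Longrightarrow> \<kappa> (d (Suc i) x) = ?k i (d (Suc i) x)" for i \<kappa>
  proof -
    from lifting_ex[OF l \<kappa> F(3) im] obtain t where t: "t \<in> mod_hom R (F i) (F (Suc i))"
      and dt: "\<forall>x\<in>carrier (F i). d (Suc i) (t x) = \<kappa> x" by (rule bexE)
    have "?h i t x \<in> ?im (Suc i)" if x: "x \<in> carrier (F (Suc i))" for x
    proof (rule F(7)[OF mod_homD(1)[OF h_hom[OF t] x]])
      have dx: "d (Suc i) x \<in> carrier (F i)" by (rule mod_homD(1)[OF F(3) x])
      have "d (Suc i) (?h i t x) = d (Suc i) (?k (Suc i) x) \<ominus>\<^bsub>F i\<^esub> d (Suc i) (t (d (Suc i) x))"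
        by (rule mod_hom_minus[OF F(1) F(1) F(3) mod_homD(1)[OF k_hom x] mod_homD(1)[OF t dx]])
      also have "\<dots> = ?k i (d (Suc i) x) \<ominus>\<^bsub>F i\<^esub> ?k i (d (Suc i) x)"
        by (simp only: mod_hom_minus[OF F(1) F(1) F(3) x mod_homD(1)[OF g x]] gS[OF x] bspec[OF dt dx] \<kappa>d[OF x])
      also have "\<dots> = \<zero>\<^bsub>F i\<^esub>" by (rule self[OF module_abelian_group[OF F(1)] mod_homD(1)[OF k_hom dx]])
      finally show "d (Suc i) (?h i t x) = \<zero>\<^bsub>F i\<^esub>" .
    qed
    then show ?thesis using t dt by blast
  qed
  have k0: "?k 0 x \<in> ?im 0" if x: "x \<in> carrier (F 0)" for x
  proof (rule F(5)[OF mod_homD(1)[OF k_hom x]])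
    have "e (?k 0 x) = e x \<ominus>\<^bsub>M\<^esub> e x"
      using mod_hom_minus[OF F(1) M F(2) x mod_homD(1)[OF g x]] g0[OF x] by (simp only:)
    then show "e (?k 0 x) = \<zero>\<^bsub>M\<^esub>"
      using self[OF module_abelian_group[OF M] mod_homD(1)[OF F(2) x]] by (simp only:)
  qed
  have "\<exists>s. ?Q 0 s" using step[OF k_hom k0 refl] by blast
  moreover have "\<exists>t. ?Q (Suc i) t \<and> (\<forall>x\<in>carrier (F (Suc i)). d (Suc (Suc i)) (t x) = ?h i s x)" if s: "?Q i s" for s i
  proof (rule step)
    have s1: "s \<in> mod_hom R (F i) (F (Suc i))" using s by simp
    show "?h i s \<in> mod_hom R (F (Suc i)) (F (Suc i))" by (rule h_hom[OF s1])
    show "?h i s x \<in> ?im (Suc i)" if "x \<in> carrier (F (Suc i))" for x using s that by simp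
    show "?h i s (d (Suc (Suc i)) x) = ?k (Suc i) (d (Suc (Suc i)) x)" if x: "x \<in> carrier (F (Suc (Suc i)))" for x
      by (simp only: F(8)[OF x] mod_hom_zero[OF F(1) F(1) s1]
          abelian_group.minus_zero_right[OF module_abelian_group[OF F(1)] mod_homD(1)[OF k_hom mod_homD(1)[OF F(3) x]]])
  qed
  ultimately obtain s where "\<forall>i. ?Q i (s i) \<and> (\<forall>x\<in>carrier (F (Suc i)). d (Suc (Suc i)) (s (Suc i) x) = ?h i (s i) x)"
    using dependent_nat_choice[of ?Q "\<lambda>i s t. \<forall>x\<in>carrier (F (Suc i)). d (Suc (Suc i)) (t x) = ?h i s x"] by blast
  then show ?thesis by blast
qed

text \<open>Comparison maps to the finite projective resolution and back compose to a map homotopic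
  to the identity. Above degree \<open>n\<close> this composite factors through zero, so there the
  homotopy is a contraction.\<close>

lemma finite_proj_dim_contracting:
  fixes d :: "nat \<Rightarrow> ('x \<Rightarrow> 'a) \<Rightarrow> ('x \<Rightarrow> 'a)"
  assumes R: "cring R" and M: "module R M" and F: "resolution R M (\<lambda>i. free_mod R (X i)) d e"
    and pd: "finite_proj_dim TYPE('p) R M"
  shows "\<exists>s n. (\<forall>i. s i \<in> mod_hom R (free_mod R (X i)) (free_mod R (X (Suc i)))) \<and>
    (\<forall>i\<ge>n. \<forall>x\<in>carrier (free_mod R (X (Suc i))).
      d (Suc (Suc i)) (s (Suc i) x) \<oplus>\<^bsub>free_mod R (X (Suc i))\<^esub> s i (d (Suc i) x) = x)"
proof -
  obtain P :: "nat \<Rightarrow> ('a, 'p) module" and \<delta> \<eta> n where P: "resolution R M P \<delta> \<eta>"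
    and proj: "\<And>i. projective R (P i)" and zero: "\<And>i. i > n \<Longrightarrow> carrier (P i) = {\<zero>\<^bsub>P i\<^esub>}"
    using pd unfolding finite_proj_dim_def by blast
  note F' = resolutionD[OF F] and P' = resolutionD[OF P]
  let ?F = "\<lambda>i. free_mod R (X i)"
  obtain \<alpha> where \<alpha>: "\<And>i. \<alpha> i \<in> mod_hom R (?F i) (P i)" "\<And>x. x \<in> carrier (?F 0) \<Longrightarrow> \<eta> (\<alpha> 0 x) = e x"
    "\<And>i x. x \<in> carrier (?F (Suc i)) \<Longrightarrow> \<delta> (Suc i) (\<alpha> (Suc i) x) = \<alpha> i (d (Suc i) x)"
    using comparison_map[OF M F P lifting_free[OF R P'(1) M] lifting_free[OF R P'(1) P'(1)]] by blast
  obtain \<beta> where \<beta>: "\<And>i. \<beta> i \<in> mod_hom R (P i) (?F i)" "\<And>x. x \<in> carrier (P 0) \<Longrightarrow> e (\<beta> 0 x) = \<eta> x"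
    "\<And>i x. x \<in> carrier (P (Suc i)) \<Longrightarrow> d (Suc i) (\<beta> (Suc i) x) = \<beta> i (\<delta> (Suc i) x)"
    using comparison_map[OF M P F lifting_projective[OF R proj F'(1) M] lifting_projective[OF R proj F'(1) F'(1)]] by blast
  have g0: "e (\<beta> 0 (\<alpha> 0 x)) = e x" if "x \<in> carrier (?F 0)" for x
    using \<beta>(2)[OF mod_homD(1)[OF \<alpha>(1) that]] \<alpha>(2)[OF that] by simp
  have gS: "d (Suc i) (\<beta> (Suc i) (\<alpha> (Suc i) x)) = \<beta> i (\<alpha> i (d (Suc i) x))" if "x \<in> carrier (?F (Suc i))" for i x
    using \<beta>(3)[OF mod_homD(1)[OF \<alpha>(1) that]] \<alpha>(3)[OF that] by simp
  obtain s where s: "\<And>i. s i \<in> mod_hom R (?F i) (?F (Suc i))"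
    "\<And>i x. x \<in> carrier (?F (Suc i)) \<Longrightarrow> d (Suc (Suc i)) (s (Suc i) x) =
        x \<ominus>\<^bsub>?F (Suc i)\<^esub> \<beta> (Suc i) (\<alpha> (Suc i) x) \<ominus>\<^bsub>?F (Suc i)\<^esub> s i (d (Suc i) x)"
    using comparison_homotopy[where \<gamma> = "\<lambda>i x. \<beta> i (\<alpha> i x)",
        OF M F lifting_free[OF R F'(1) F'(1)] mod_hom_comp[OF \<alpha>(1) \<beta>(1)] g0 gS] by blast
  have "d (Suc (Suc i)) (s (Suc i) x) \<oplus>\<^bsub>?F (Suc i)\<^esub> s i (d (Suc i) x) = x"
    if i: "i \<ge> n" and x: "x \<in> carrier (?F (Suc i))" for i x
  proof -
    interpret abelian_group "?F (Suc i)" by (rule module_abelian_group[OF F'(1)])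
    have "\<alpha> (Suc i) x = \<zero>\<^bsub>P (Suc i)\<^esub>" using mod_homD(1)[OF \<alpha>(1) x] zero[of "Suc i"] i by simp
    then have z: "\<beta> (Suc i) (\<alpha> (Suc i) x) = \<zero>\<^bsub>?F (Suc i)\<^esub>"
      using mod_hom_zero[OF P'(1) F'(1) \<beta>(1)] by simp
    have sx: "s i (d (Suc i) x) \<in> carrier (?F (Suc i))" by (rule mod_homD(1)[OF s(1) mod_homD(1)[OF F'(3) x]])
    have "d (Suc (Suc i)) (s (Suc i) x) = x \<ominus>\<^bsub>?F (Suc i)\<^esub> s i (d (Suc i) x)"
      unfolding s(2)[OF x] z by (simp only: minus_zero_right[OF x])
    then show ?thesis using x sx by (simp add: minus_eq a_assoc l_neg)
  qed
  then show ?thesis using s(1) by blast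
qed

section \<open>A universal commutative ring\<close>

text \<open>The type-class ring \<open>'a uring\<close> of terms with variables in \<open>'a\<close>, modulo the identities that
  hold in all commutative rings with elements of type \<open>'a\<close> and in the integers (the latter only to
  ensure \<open>0 \<noteq> 1\<close>), maps onto every commutative ring with elements of type \<open>'a\<close>. This replaces
  a ring given by a carrier set by a type-class ring modulo an ideal.\<close>

datatype 'a rexp = RVar 'a | RZero | ROne | RAdd "'a rexp" "'a rexp" | RMul "'a rexp" "'a rexp" | RNeg "'a rexp"

primrec rexp_val :: "('a, 'e) ring_scheme \<Rightarrow> ('a \<Rightarrow> 'a) \<Rightarrow> 'a rexp \<Rightarrow> 'a" where
  "rexp_val S v (RVar x) = v x"
| "rexp_val S v RZero = \<zero>\<^bsub>S\<^esub>"
| "rexp_val S v ROne = \<one>\<^bsub>S\<^esub>"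
| "rexp_val S v (RAdd a b) = rexp_val S v a \<oplus>\<^bsub>S\<^esub> rexp_val S v b"
| "rexp_val S v (RMul a b) = rexp_val S v a \<otimes>\<^bsub>S\<^esub> rexp_val S v b"
| "rexp_val S v (RNeg a) = \<ominus>\<^bsub>S\<^esub> rexp_val S v a"

primrec rexp_int :: "('a \<Rightarrow> int) \<Rightarrow> 'a rexp \<Rightarrow> int" where
  "rexp_int v (RVar x) = v x"
| "rexp_int v RZero = 0"
| "rexp_int v ROne = 1"
| "rexp_int v (RAdd a b) = rexp_int v a + rexp_int v b"
| "rexp_int v (RMul a b) = rexp_int v a * rexp_int v b"
| "rexp_int v (RNeg a) = - rexp_int v a"

lemma rexp_val_closed [simp]:
  assumes "cring S" "\<And>x. v x \<in> carrier S" shows "rexp_val S v a \<in> carrier S"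
proof -
  interpret cring S by fact
  show ?thesis by (induction a) (simp_all add: assms)
qed

definition rexp_eq :: "'a rexp \<Rightarrow> 'a rexp \<Rightarrow> bool" where
  "rexp_eq a b \<longleftrightarrow>
     (\<forall>(S :: 'a ring) v. cring S \<longrightarrow> (\<forall>x. v x \<in> carrier S) \<longrightarrow> rexp_val S v a = rexp_val S v b) \<and>
     (\<forall>v. rexp_int v a = rexp_int v b)"

quotient_type 'a uring = "'a rexp" / rexp_eq
  by (rule equivpI) (auto simp: rexp_eq_def reflp_def symp_def transp_def)

instantiation uring :: (type) comm_ring_1
begin

lift_definition zero_uring :: "'a uring" is RZero .
lift_definition one_uring :: "'a uring" is ROne .
lift_definition plus_uring :: "'a uring \<Rightarrow> 'a uring \<Rightarrow> 'a uring" is RAdd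
  by (auto simp: rexp_eq_def)
lift_definition times_uring :: "'a uring \<Rightarrow> 'a uring \<Rightarrow> 'a uring" is RMul
  by (auto simp: rexp_eq_def)
lift_definition uminus_uring :: "'a uring \<Rightarrow> 'a uring" is RNeg
  by (auto simp: rexp_eq_def)
lift_definition minus_uring :: "'a uring \<Rightarrow> 'a uring \<Rightarrow> 'a uring" is "\<lambda>a b. RAdd a (RNeg b)"
  by (auto simp: rexp_eq_def)

instance
proof
  note cr = cring.axioms(1)[THEN ring.is_abelian_group]
  have l_distr: "(x \<oplus>\<^bsub>S\<^esub> y) \<otimes>\<^bsub>S\<^esub> z = x \<otimes>\<^bsub>S\<^esub> z \<oplus>\<^bsub>S\<^esub> y \<otimes>\<^bsub>S\<^esub> z"
    if "cring S" "x \<in> carrier S" "y \<in> carrier S" "z \<in> carrier S" for S :: "'a ring" and x y z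
  proof -
    interpret cring S by fact
    show ?thesis using that by (simp add: l_distr)
  qed
  fix a b c :: "'a uring"
  show "a * b * c = a * (b * c)"
    by transfer (auto simp: rexp_eq_def monoid.m_assoc[OF ring.is_monoid[OF cring.axioms(1)]])
  show "a * b = b * a"
    by transfer (auto simp: rexp_eq_def comm_monoid.m_comm[OF cring.axioms(2)])
  show "1 * a = a"
    by transfer (auto simp: rexp_eq_def monoid.l_one[OF ring.is_monoid[OF cring.axioms(1)]])
  show "a + b + c = a + (b + c)"
    by transfer (auto simp: rexp_eq_def abelian_monoid.a_assoc[OF abelian_group.axioms(1)[OF cr]])
  show "a + b = b + a"
    by transfer (auto simp: rexp_eq_def abelian_monoid.a_comm[OF abelian_group.axioms(1)[OF cr]])
  show "0 + a = a"
    by transfer (auto simp: rexp_eq_def abelian_monoid.l_zero[OF abelian_group.axioms(1)[OF cr]])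
  show "- a + a = 0"
    by transfer (auto simp: rexp_eq_def abelian_group.l_neg[OF cr])
  show "a - b = a + - b"
    by transfer (auto simp: rexp_eq_def)
  show "(a + b) * c = a * c + b * c"
    by transfer (auto simp: rexp_eq_def l_distr algebra_simps)
  show "(0::'a uring) \<noteq> 1"
    by transfer (auto simp: rexp_eq_def)
qed

end

locale type_ring_surj = cring S for S :: "('b, 'e) ring_scheme" (structure) +
  fixes h :: "'p::comm_ring_1 \<Rightarrow> 'b"
  assumes h_zero: "h 0 = \<zero>" and h_one: "h 1 = \<one>"
    and h_add: "h (a + b) = h a \<oplus> h b" and h_mult: "h (a * b) = h a \<otimes> h b"
    and h_surj: "range h = carrier S"

lemma uring_surj:
  fixes S :: "('a, 'e) ring_scheme"
  assumes S: "cring S"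
  shows "\<exists>h :: 'a uring \<Rightarrow> 'a. type_ring_surj S h"
proof -
  \<comment> \<open>\<open>rexp_eq\<close> quantifies over plain ring records, so the extension
    fields of \<open>S\<close> are dropped first.\<close>
  define S' :: "'a ring" where
    "S' = \<lparr>carrier = carrier S, mult = mult S, one = one S, zero = zero S, add = add S\<rparr>"
  interpret S: cring S by fact
  have "cring S'"
  proof (rule cringI)
    show "abelian_group S'"
      by (rule abelian_groupI) (auto simp: S'_def S.a_ac intro!: bexI[of _ "\<ominus>\<^bsub>S\<^esub> _"] S.l_neg)
    show "comm_monoid S'"
      by (rule comm_monoidI) (auto simp: S'_def S.m_ac)
  qed (auto simp: S'_def S.l_distr)
  define v where "v x = (if x \<in> carrier S then x else \<zero>\<^bsub>S\<^esub>)" for x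
  have v: "v x \<in> carrier S'" for x
    using cring.cring_simprules(2)[OF S] by (simp add: v_def S'_def)
  define h where "h a = rexp_val S' v (rep_uring a)" for a
  have h_abs: "h (abs_uring a) = rexp_val S' v a" for a
  proof -
    have "rexp_eq (rep_uring (abs_uring a)) a"
      by (rule Quotient3_rep_abs[OF Quotient3_uring]) (simp add: rexp_eq_def)
    then show ?thesis using \<open>cring S'\<close> v by (simp add: h_def rexp_eq_def)
  qed
  have "type_ring_surj S h"
  proof
    show "h 0 = \<zero>\<^bsub>S\<^esub>" "h 1 = \<one>\<^bsub>S\<^esub>"
      by (simp_all add: zero_uring.abs_eq one_uring.abs_eq h_abs S'_def)
    show "h (a + b) = h a \<oplus>\<^bsub>S\<^esub> h b" "h (a * b) = h a \<otimes>\<^bsub>S\<^esub> h b" for a b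
      by (induction a; induction b; simp add: plus_uring.abs_eq times_uring.abs_eq h_abs, simp add: S'_def)+
    show "range h = carrier S"
    proof
      show "range h \<subseteq> carrier S"
        using rexp_val_closed[OF \<open>cring S'\<close> v] by (auto simp: h_def S'_def)
      show "carrier S \<subseteq> range h"
      proof
        fix x assume "x \<in> carrier S"
        then have "h (abs_uring (RVar x)) = x" by (simp add: h_abs v_def)
        then show "x \<in> range h" by (metis rangeI)
      qed
    qed
  qed
  then show ?thesis by blast
qed

context type_ring_surj begin

definition ker :: "'p set" where "ker = {a. h a = \<zero>}"

text \<open>A choice of preimages, not a homomorphism; what is built from it is additive and linear
  modulo \<open>ker\<close> only.\<close>

definition sec :: "'b \<Rightarrow> 'p" where "sec s = (SOME a. h a = s)"

lemma h_closed [simp]: "h a \<in> carrier S"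
  using h_surj by blast

lemma h_sec: "s \<in> carrier S \<Longrightarrow> h (sec s) = s"
  unfolding sec_def by (rule someI_ex) (use h_surj in \<open>metis rangeE\<close>)

lemma h_uminus: "h (- a) = \<ominus> h a"
proof -
  have "h (- a) \<oplus> h a = \<zero>" by (simp flip: h_add add: h_zero)
  then show ?thesis by (simp add: minus_equality)
qed

lemma h_diff: "h (a - b) = h a \<ominus> h b"
  using h_add[of a "- b"] by (simp add: h_uminus minus_eq)

lemma h_eq_iff: "h a = h b \<longleftrightarrow> a - b \<in> ker"
  by (simp add: ker_def h_diff)

lemma ker_ideal: "rideal ker"
  by (auto simp: rideal_def ker_def h_zero h_add h_mult)

lemma vimage_ideal:
  assumes "ideal J S" shows "rideal {a. h a \<in> J}"
proof -
  interpret J: ideal J S by fact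
  show ?thesis by (auto simp: rideal_def h_zero h_add h_mult J.I_l_closed)
qed

lemma h_sum: "finite A \<Longrightarrow> h (\<Sum>x\<in>A. g x) = (\<Oplus>x\<in>A. h (g x))"
  by (induction A rule: finite_induct) (simp_all add: h_zero h_add)

lemma h_prod: "finite A \<Longrightarrow> h (\<Prod>x\<in>A. g x) = (\<Otimes>x\<in>A. h (g x))"
  by (induction A rule: finite_induct) (simp_all add: h_one h_mult)

lemma h_Det: "h (Det r A) = det_leibniz S r (\<lambda>i j. h (A i j))"
proof -
  have "h (Det r A) = (\<Oplus>s\<in>{s. s permutes {..<r}}. h (of_int (sign s) * (\<Prod>i<r. A i (s i))))"
    unfolding Det_def by (rule h_sum) (rule finite_permutations, simp)
  also have "\<dots> = det_leibniz S r (\<lambda>i j. h (A i j))"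
    unfolding det_leibniz_def
    by (rule finsum_cong') (auto simp: sign_def h_uminus h_prod)
  finally show ?thesis .
qed

text \<open>The cut-off to zero outside \<open>K\<close> makes the image an element of the free
  module, where equality of functions is equality of families.\<close>

definition vecm :: "'x set \<Rightarrow> ('x \<Rightarrow> 'p) \<Rightarrow> 'x \<Rightarrow> 'b" where
  "vecm K v = (\<lambda>q. if q \<in> K then h (v q) else \<zero>)"

definition mat_map :: "nat set \<Rightarrow> nat set \<Rightarrow> (nat \<Rightarrow> nat \<Rightarrow> 'p) \<Rightarrow> (nat \<Rightarrow> 'b) \<Rightarrow> nat \<Rightarrow> 'b" where
  "mat_map K L A v = vecm L (colmul K A (\<lambda>q. sec (v q)))"

lemma vecm_carrier: "finite K \<Longrightarrow> vecm K v \<in> carrier (free_mod S K)"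
proof -
  assume "finite K"
  moreover have "{q. vecm K v q \<noteq> \<zero>} \<subseteq> K" by (auto simp: vecm_def)
  ultimately show ?thesis by (auto simp: free_mod_def vecm_def dest: finite_subset)
qed

lemma vecm_sec: "v \<in> carrier (free_mod S K) \<Longrightarrow> vecm K (\<lambda>q. sec (v q)) = v"
  by (auto simp: vecm_def free_mod_def h_sec)

lemma vecm_eq_iff: "vecm K v = vecm K w \<longleftrightarrow> (\<forall>q\<in>K. v q - w q \<in> ker)"
  by (auto simp: vecm_def fun_eq_iff h_eq_iff[symmetric])

lemma vecm_zero_iff: "vecm K v = \<zero>\<^bsub>free_mod S K\<^esub> \<longleftrightarrow> (\<forall>q\<in>K. v q \<in> ker)"
  by (auto simp: vecm_def fun_eq_iff free_mod_def ker_def)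

lemma vecm_add: "vecm K (\<lambda>q. v q + w q) = vecm K v \<oplus>\<^bsub>free_mod S K\<^esub> vecm K w"
  by (auto simp: vecm_def free_mod_def h_add)

lemma vecm_scale: "vecm K (\<lambda>q. a * v q) = h a \<odot>\<^bsub>free_mod S K\<^esub> vecm K v"
  by (auto simp: vecm_def free_mod_def h_mult)

lemma vecm_unit: "q \<in> K \<Longrightarrow> unit_vec S q = vecm K (\<lambda>p. if p = q then 1 else 0)"
  by (auto simp: vecm_def unit_vec_def h_zero h_one)

lemma sec_vecm: "q \<in> K \<Longrightarrow> sec (vecm K v q) - v q \<in> ker"
  by (simp add: vecm_def h_eq_iff[symmetric] h_sec)

lemma mat_map_vecm: "mat_map K L A (vecm K v) = vecm L (colmul K A v)"
  unfolding mat_map_def vecm_eq_iff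
proof
  fix q
  have "(\<Sum>k\<in>K. A q k * sec (vecm K v k)) - (\<Sum>k\<in>K. A q k * v k) \<in> ker"
    by (rule rideal_sum_diff[OF ker_ideal]) (metis right_diff_distrib sec_vecm rideal_mult[OF ker_ideal])
  then show "colmul K A (\<lambda>q. sec (vecm K v q)) q - colmul K A v q \<in> ker"
    by (simp add: colmul_def)
qed

lemma carrier_vecm:
  assumes "v \<in> carrier (free_mod S K)" obtains v' where "v = vecm K v'"
  using vecm_sec[OF assms] by metis

lemma mat_map_hom:
  assumes "finite K" "finite L"
  shows "mat_map K L A \<in> mod_hom S (free_mod S K) (free_mod S L)"
proof (rule mod_homI)
  show "mat_map K L A v \<in> carrier (free_mod S L)" for v
    unfolding mat_map_def by (rule vecm_carrier[OF assms(2)])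
next
  fix v w assume "v \<in> carrier (free_mod S K)" "w \<in> carrier (free_mod S K)"
  then obtain v' w' where e: "v = vecm K v'" "w = vecm K w'" by (metis carrier_vecm)
  have "colmul K A (\<lambda>q. v' q + w' q) = (\<lambda>q. colmul K A v' q + colmul K A w' q)"
    by (simp add: colmul_def algebra_simps sum.distrib fun_eq_iff)
  then show "mat_map K L A (v \<oplus>\<^bsub>free_mod S K\<^esub> w) = mat_map K L A v \<oplus>\<^bsub>free_mod S L\<^esub> mat_map K L A w"
    unfolding e by (simp flip: vecm_add add: mat_map_vecm)
next
  fix a v assume "a \<in> carrier S" "v \<in> carrier (free_mod S K)"
  then obtain a' v' where e: "v = vecm K v'" "a = h a'" by (metis carrier_vecm h_sec)
  have "colmul K A (\<lambda>q. a' * v' q) = (\<lambda>q. a' * colmul K A v' q)"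
    by (simp add: colmul_def algebra_simps sum_distrib_left fun_eq_iff)
  then show "mat_map K L A (a \<odot>\<^bsub>free_mod S K\<^esub> v) = a \<odot>\<^bsub>free_mod S L\<^esub> mat_map K L A v"
    unfolding e by (simp flip: vecm_scale add: mat_map_vecm)
qed

lemma mat_map_unit:
  assumes "finite K" "q \<in> K"
  shows "mat_map K L A (unit_vec S q) = vecm L (\<lambda>p. A p q)"
proof -
  have "colmul K A (\<lambda>p. if p = q then 1 else 0) p = A p q" for p
  proof -
    have "(\<Sum>k\<in>K. A p k * (if k = q then 1 else 0)) = (\<Sum>k\<in>K. if k = q then A p k else 0)"
      by (rule sum.cong) auto
    then show ?thesis using assms by (simp add: colmul_def)
  qed
  then have "colmul K A (\<lambda>p. if p = q then 1 else 0) = (\<lambda>p. A p q)" by blast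
  then show ?thesis unfolding vecm_unit[OF assms(2)] mat_map_vecm by (rule arg_cong)
qed

end

section \<open>Local rings and quotients\<close>

lemma (in noetherian_ring) ascending_ideals_stable:
  assumes "\<And>t. ideal (A t) R" and inc: "\<And>t. A t \<subseteq> A (Suc t)"
  shows "\<exists>T :: nat. \<forall>t\<ge>T. A t = A T"
proof -
  have mono: "A t \<subseteq> A t'" if "t \<le> t'" for t t' using lift_Suc_mono_le[of A, OF inc that] .
  have "subset.chain {I. ideal I R} (range A)"
    unfolding subset_chain_def
  proof (intro conjI ballI)
    show "range A \<subseteq> {I. ideal I R}" using assms(1) by auto
    fix X Y assume "X \<in> range A" "Y \<in> range A"
    then obtain t t' where "X = A t" "Y = A t'" by auto
    then show "X \<subseteq> Y \<or> Y \<subseteq> X" using mono[of t t'] mono[of t' t] linear[of t t'] by metis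
  qed
  from ideal_chain_is_trivial[OF _ this] obtain T where T: "\<Union>(range A) = A T" by auto
  have "A t = A T" if "t \<ge> T" for t
  proof
    show "A T \<subseteq> A t" by (rule mono[OF that])
    show "A t \<subseteq> A T" using T by blast
  qed
  then show ?thesis by blast
qed

text \<open>In a Noetherian ring a nonempty chain of ideals contains its union, which is the upper
  bound for Zorn's lemma.\<close>

lemma (in noetherian_ring) maximalideal_above:
  assumes J: "ideal J R" "J \<noteq> carrier R"
  shows "\<exists>M. maximalideal M R \<and> J \<subseteq> M"
proof -
  let ?A = "{I. ideal I R \<and> J \<subseteq> I \<and> I \<noteq> carrier R}"
  have "\<exists>M\<in>?A. \<forall>X\<in>?A. M \<subseteq> X \<longrightarrow> X = M"
  proof (rule subset_Zorn)
    fix C assume C: "subset.chain ?A C"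
    show "\<exists>U\<in>?A. \<forall>X\<in>C. X \<subseteq> U"
    proof (cases "C = {}")
      case True
      have "J \<in> ?A" using J by simp
      then show ?thesis using True by (intro bexI[of _ J]) simp_all
    next
      case False
      have CA: "C \<subseteq> ?A" and chain: "\<forall>X\<in>C. \<forall>Y\<in>C. X \<subseteq> Y \<or> Y \<subseteq> X"
        using C unfolding subset_chain_def by simp_all
      have "subset.chain {I. ideal I R} C"
        unfolding subset_chain_def using CA by (intro conjI chain) auto
      from ideal_chain_is_trivial[OF False this] have "\<Union>C \<in> ?A" by (rule subsetD[OF CA])
      then show ?thesis by (intro bexI[of _ "\<Union>C"]) auto
    qed
  qed
  then obtain M where M: "M \<in> ?A" "\<forall>X\<in>?A. M \<subseteq> X \<longrightarrow> X = M" by (rule bexE)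
  have "maximalideal M R"
  proof (rule maximalidealI)
    show "ideal M R" "carrier R \<noteq> M" using M(1) by auto
    show "X = M \<or> X = carrier R" if "ideal X R" "M \<subseteq> X" for X
    proof (rule disjCI)
      assume "X \<noteq> carrier R"
      then have "X \<in> ?A" using that M(1) by auto
      then show "X = M" using M(2) that(2) by simp
    qed
  qed
  then show ?thesis using M(1) by auto
qed

lemma carrier_Quot: "x \<in> carrier (S Quot I) \<Longrightarrow> \<exists>s\<in>carrier S. x = I +>\<^bsub>S\<^esub> s"
  by (auto simp: FactRing_def A_RCOSETS_def')

lemma local_noetherianD:
  assumes "local_noetherian S"
  shows "cring S" "noetherian_ring S" "maximalideal (max_ideal S) S"
    "\<And>M. maximalideal M S \<Longrightarrow> M = max_ideal S"
proof -
  show "cring S" "noetherian_ring S" using assms by (auto simp: local_noetherian_def)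
  have ex: "\<exists>!I. maximalideal I S" using assms by (auto simp: local_noetherian_def)
  show "maximalideal (max_ideal S) S" unfolding max_ideal_def by (rule theI'[OF ex])
  then show "\<And>M. maximalideal M S \<Longrightarrow> M = max_ideal S" using ex by blast
qed

lemma local_ideal_subset:
  assumes "local_noetherian S" "ideal J S" "J \<noteq> carrier S"
  shows "J \<subseteq> max_ideal S"
  using noetherian_ring.maximalideal_above[OF local_noetherianD(2)[OF assms(1)] assms(2,3)]
    local_noetherianD(4)[OF assms(1)] by blast

lemma local_unit:
  assumes S: "local_noetherian S" and x: "x \<in> carrier S" "x \<notin> max_ideal S"
  shows "\<exists>y\<in>carrier S. x \<otimes>\<^bsub>S\<^esub> y = \<one>\<^bsub>S\<^esub>"
proof -
  interpret cring S by (rule local_noetherianD(1)[OF S])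
  have "cgenideal S x = carrier S"
    using local_ideal_subset[OF S cgenideal_ideal[OF x(1)]] cgenideal_self[OF x(1)] x(2) by blast
  then have "\<one>\<^bsub>S\<^esub> \<in> cgenideal S x" using one_closed by (simp only:)
  then obtain y where y: "y \<in> carrier S" "\<one>\<^bsub>S\<^esub> = y \<otimes>\<^bsub>S\<^esub> x" by (auto simp: cgenideal_def)
  then show ?thesis using m_comm[OF x(1) y(1)] by (intro bexI[of _ y]) simp_all
qed

text \<open>\<open>max_ideal R\<close> is a definite description, so nothing is known about it
  before uniqueness is shown. The image of \<open>max_ideal S\<close> contains every proper ideal of
  the quotient, because elements outside it are units.\<close>

lemma quotient_local:
  assumes S: "local_noetherian S" and I: "ideal I S" "I \<noteq> carrier S"
  defines "R \<equiv> S Quot I"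
  shows "ideal (max_ideal R) R" "\<one>\<^bsub>R\<^esub> \<notin> max_ideal R"
    "\<And>x. x \<in> carrier R \<Longrightarrow> x \<notin> max_ideal R \<Longrightarrow> \<exists>y\<in>carrier R. x \<otimes>\<^bsub>R\<^esub> y = \<one>\<^bsub>R\<^esub>"
proof -
  interpret S: cring S by (rule local_noetherianD(1)[OF S])
  interpret I: ideal I S by (rule I(1))
  interpret R: cring R unfolding R_def by (rule I.quotient_is_cring[OF S.is_cring])
  interpret h: ring_hom_ring S R "(+>\<^bsub>S\<^esub>) I" unfolding R_def by (rule I.rcos_ring_hom_ring)
  interpret n: maximalideal "max_ideal S" S by (rule local_noetherianD(3)[OF S])
  let ?N = "(+>\<^bsub>S\<^esub>) I ` max_ideal S"
  have In: "I \<subseteq> max_ideal S" by (rule local_ideal_subset[OF S I])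
  have N: "ideal ?N R" unfolding R_def by (rule S.ring_ideal_imp_quot_ideal[OF I(1) n.is_ideal])
  have carr: "\<exists>s\<in>carrier S. x = I +>\<^bsub>S\<^esub> s" if "x \<in> carrier R" for x
    by (rule carrier_Quot) (use that in \<open>simp only: R_def\<close>)
  have eq: "s \<in> max_ideal S" if s: "s \<in> carrier S" "I +>\<^bsub>S\<^esub> s \<in> ?N" for s
  proof -
    from s(2) obtain t where t: "t \<in> max_ideal S" "I +>\<^bsub>S\<^esub> s = I +>\<^bsub>S\<^esub> t" by auto
    have "s \<in> I +>\<^bsub>S\<^esub> t" using I.a_rcos_self[OF s(1)] t(2) by simp
    then obtain i where "i \<in> I" "s = i \<oplus>\<^bsub>S\<^esub> t" by (auto simp: a_r_coset_def')
    then show ?thesis using In t(1) n.a_closed by blast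
  qed
  have one: "\<one>\<^bsub>R\<^esub> \<notin> ?N"
  proof
    assume "\<one>\<^bsub>R\<^esub> \<in> ?N"
    then have "I +>\<^bsub>S\<^esub> \<one>\<^bsub>S\<^esub> \<in> ?N" using h.hom_one by simp
    then have "\<one>\<^bsub>S\<^esub> \<in> max_ideal S" using eq[of "\<one>\<^bsub>S\<^esub>"] by simp
    then show False using n.I_notcarr n.one_imp_carrier by simp
  qed
  have unit: "\<exists>y\<in>carrier R. x \<otimes>\<^bsub>R\<^esub> y = \<one>\<^bsub>R\<^esub>" if x: "x \<in> carrier R" "x \<notin> ?N" for x
  proof -
    obtain s where s: "s \<in> carrier S" "x = I +>\<^bsub>S\<^esub> s" using carr x(1) by blast
    then have "s \<notin> max_ideal S" using x(2) by blast
    from local_unit[OF S s(1) this] obtain t where t: "t \<in> carrier S" "s \<otimes>\<^bsub>S\<^esub> t = \<one>\<^bsub>S\<^esub>" by blast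
    have "x \<otimes>\<^bsub>R\<^esub> (I +>\<^bsub>S\<^esub> t) = \<one>\<^bsub>R\<^esub>" using s t by (simp flip: h.hom_mult)
    then show ?thesis using h.hom_closed[OF t(1)] by blast
  qed
  have sub: "J \<subseteq> ?N" if J: "ideal J R" "J \<noteq> carrier R" for J
  proof
    fix x assume x: "x \<in> J"
    interpret J: ideal J R by (rule J(1))
    show "x \<in> ?N"
    proof (rule ccontr)
      assume "x \<notin> ?N"
      then obtain y where "y \<in> carrier R" "x \<otimes>\<^bsub>R\<^esub> y = \<one>\<^bsub>R\<^esub>" using unit J.Icarr[OF x] by blast
      then have "\<one>\<^bsub>R\<^esub> \<in> J" using J.I_r_closed[OF x] by metis
      then show False using J.one_imp_carrier J(2) by blast
    qed
  qed
  have "maximalideal ?N R"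
  proof (rule maximalidealI[OF N])
    show "carrier R \<noteq> ?N" using one R.one_closed by blast
    show "J = ?N \<or> J = carrier R" if "ideal J R" "?N \<subseteq> J" for J
      using sub[OF that(1)] that(2) by blast
  qed
  moreover have "M = ?N" if M: "maximalideal M R" for M
  proof -
    interpret M: maximalideal M R by (rule M)
    have "M \<subseteq> ?N" using sub[OF M.is_ideal] M.I_notcarr by blast
    moreover have "?N \<noteq> carrier R" using one R.one_closed by blast
    moreover have "?N \<subseteq> carrier R" using ideal.Icarr[OF N] by blast
    ultimately show ?thesis using M.I_maximal[OF N] by blast
  qed
  ultimately have max: "max_ideal R = ?N" unfolding max_ideal_def by (rule the_equality)
  show "ideal (max_ideal R) R" "\<one>\<^bsub>R\<^esub> \<notin> max_ideal R" unfolding max by (fact N, fact one)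
  show "\<exists>y\<in>carrier R. x \<otimes>\<^bsub>R\<^esub> y = \<one>\<^bsub>R\<^esub>" if "x \<in> carrier R" "x \<notin> max_ideal R" for x
    using unit that unfolding max by blast
qed

context type_ring_surj begin

lemma image_ideal:
  assumes J: "rideal J" shows "ideal (h ` J) S"
proof (rule idealI[OF ring_axioms])
  show "subgroup (h ` J) (add_monoid S)"
  proof (rule add.subgroupI)
    show "h ` J \<subseteq> carrier S" by auto
    show "h ` J \<noteq> {}" using rideal_0[OF J] by blast
    show "\<ominus> x \<in> h ` J" if x: "x \<in> h ` J" for x
    proof -
      from x obtain a where a: "x = h a" "a \<in> J" by (rule imageE)
      show ?thesis unfolding a(1) h_uminus[symmetric] by (rule imageI[OF rideal_minus[OF J a(2)]])
    qed
    show "x \<oplus> y \<in> h ` J" if x: "x \<in> h ` J" and y: "y \<in> h ` J" for x y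
    proof -
      from x obtain a where a: "x = h a" "a \<in> J" by (rule imageE)
      from y obtain b where b: "y = h b" "b \<in> J" by (rule imageE)
      show ?thesis unfolding a(1) b(1) h_add[symmetric] by (rule imageI[OF rideal_add[OF J a(2) b(2)]])
    qed
  qed
  have 1: "x \<otimes> a \<in> h ` J" if a: "a \<in> h ` J" and x: "x \<in> carrier S" for a x
  proof -
    from a obtain a' where a': "a = h a'" "a' \<in> J" by (rule imageE)
    have "x \<otimes> a = h (sec x * a')" by (simp only: h_mult h_sec[OF x] a'(1))
    then show ?thesis using imageI[OF rideal_mult[OF J a'(2)], of h "sec x"] by (simp only:)
  qed
  show "x \<otimes> a \<in> h ` J" if "a \<in> h ` J" "x \<in> carrier S" for a x by (rule 1[OF that])
  show "a \<otimes> x \<in> h ` J" if "a \<in> h ` J" "x \<in> carrier S" for a x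
    using 1[OF that] that m_comm[of a x] by auto
qed

text \<open>Ideals correspond under the surjection \<open>h\<close> because every
  \<open>gens_ideal\<close> contains its kernel.\<close>

lemma genideal_take_iff:
  assumes fs: "set fs \<subseteq> carrier S" and f: "\<And>l. l < length fs \<Longrightarrow> h (f l) = fs ! l" and j: "j \<le> length fs"
  shows "h a \<in> genideal S (set (take j fs)) \<longleftrightarrow> a \<in> ideal_gens.gens_ideal ker f j"
proof -
  interpret g: ideal_gens ker f by unfold_locales (rule ker_ideal)
  let ?G = "genideal S (set (take j fs))"
  have sub: "set (take j fs) \<subseteq> carrier S" by (rule order.trans[OF set_take_subset fs])
  have G: "ideal ?G S" by (rule genideal_ideal[OF sub])
  have set: "set (take j fs) = (\<lambda>l. h (f l)) ` {..<j}"
    unfolding nth_image[OF j, symmetric] lessThan_atLeast0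
  proof (rule image_cong[OF refl])
    fix l assume "l \<in> {0..<j}"
    then have "l < length fs" using j by simp
    then show "fs ! l = h (f l)" by (rule f[symmetric])
  qed
  show ?thesis
  proof
    assume a: "h a \<in> ?G"
    have "?G \<subseteq> h ` g.gens_ideal j"
    proof (rule genideal_minimal[OF image_ideal[OF g.gens_ideal_ideal]])
      show "set (take j fs) \<subseteq> h ` g.gens_ideal j"
        unfolding set by (intro image_subsetI imageI g.gens_ideal_gen) simp
    qed
    from subsetD[OF this a] obtain a' where a': "h a = h a'" "a' \<in> g.gens_ideal j" by (rule imageE)
    from a'(1) have "a - a' \<in> g.gens_ideal j" unfolding h_eq_iff by (rule g.I0_gens_ideal)
    from rideal_cong[OF g.gens_ideal_ideal this] a'(2) show "a \<in> g.gens_ideal j" by (simp only:)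
  next
    assume "a \<in> g.gens_ideal j"
    then obtain b where "a - (\<Sum>l<j. f l * b l) \<in> ker" unfolding g.gens_ideal_def by blast
    then have b: "h a = h (\<Sum>l<j. f l * b l)" unfolding h_eq_iff .
    have "(\<Sum>l<j. f l * b l) \<in> {a. h a \<in> ?G}"
    proof (rule rideal_sum[OF vimage_ideal[OF G]], rule rideal_mult'[OF vimage_ideal[OF G]])
      fix l assume "l \<in> {..<j}"
      then have "h (f l) \<in> set (take j fs)" unfolding set by blast
      from subsetD[OF genideal_self[OF sub] this] show "f l \<in> {a. h a \<in> ?G}" by (rule CollectI)
    qed
    then have "h (\<Sum>l<j. f l * b l) \<in> ?G" by (rule CollectD)
    then show "h a \<in> ?G" unfolding b .
  qed
qed

end

section \<open>Vanishing of cohomology for finite projective dimension\<close>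

locale reg_surj = type_ring_surj S h + reg_ideal "type_ring_surj.ker S h" f m c
  for S :: "('b, 'e) ring_scheme" (structure) and h :: "'p::comm_ring_1 \<Rightarrow> 'b"
    and f :: "nat \<Rightarrow> 'p" and m :: "'p set" and c :: nat
begin

text \<open>A surjective augmentation, defined on all functions rather than on \<open>F 0\<close>,
  so that passing to the cone merely reindexes the argument.\<close>

definition aug :: "('b, 'm) module \<Rightarrow> ((nat \<Rightarrow> 'p) \<Rightarrow> 'm) \<Rightarrow> bool" where
  "aug M e \<longleftrightarrow> (\<forall>v. e v \<in> carrier M) \<and> (\<forall>v w. e (\<lambda>q. v q + w q) = e v \<oplus>\<^bsub>M\<^esub> e w) \<and>
     (\<forall>a v. e (\<lambda>q. a * v q) = h a \<odot>\<^bsub>M\<^esub> e v) \<and> (\<forall>x\<in>carrier M. \<exists>v. e v = x)"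

lemma aug_shift: "aug M e \<Longrightarrow> aug M (\<lambda>v. e (\<lambda>q. v (2 * q)))"
  unfolding aug_def
proof (intro conjI ballI; (elim conjE)?)
  fix x assume "x \<in> carrier M" "\<forall>x\<in>carrier M. \<exists>v. e v = x"
  then obtain v where "e v = x" by blast
  then show "\<exists>v. e (\<lambda>q. v (2 * q)) = x" by (intro exI[of _ "\<lambda>k. v (k div 2)"]) simp
qed auto

text \<open>Expansion in the standard basis for a functional that respects sums and multiples modulo
  \<open>m\<close> only, as happens to functionals built from \<open>sec\<close>.\<close>

lemma functional_expand:
  fixes Psi :: "(nat \<Rightarrow> 'b) \<Rightarrow> 'p"
  assumes K: "finite K"
    and add: "\<And>v w. v \<in> carrier (free_mod S K) \<Longrightarrow> w \<in> carrier (free_mod S K) \<Longrightarrow>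
      Psi (v \<oplus>\<^bsub>free_mod S K\<^esub> w) - (Psi v + Psi w) \<in> m"
    and scale: "\<And>a v. v \<in> carrier (free_mod S K) \<Longrightarrow> Psi (h a \<odot>\<^bsub>free_mod S K\<^esub> v) - a * Psi v \<in> m"
  shows "Psi (vecm K v) - (\<Sum>p\<in>K. v p * Psi (unit_vec S p)) \<in> m"
proof -
  let ?F = "free_mod S K"
  have "Psi (vecm K (\<lambda>q. if q \<in> Y then v q else 0)) - (\<Sum>p\<in>Y. v p * Psi (unit_vec S p)) \<in> m" if "finite Y" "Y \<subseteq> K" for Y
    using that
  proof (induction Y)
    case empty
    have "vecm K (\<lambda>q. 0 * 0) = h 0 \<odot>\<^bsub>?F\<^esub> vecm K (\<lambda>q. 0)" by (rule vecm_scale)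
    then have "Psi (vecm K (\<lambda>q. 0)) - 0 * Psi (vecm K (\<lambda>q. 0)) \<in> m"
      using scale[OF vecm_carrier[OF K, of "\<lambda>q. 0"], of 0] by simp
    then show ?case by simp
  next
    case (insert x Y)
    have x: "x \<in> K" using insert by simp
    let ?v = "vecm K (\<lambda>q. if q \<in> Y then v q else 0)" and ?u = "unit_vec S x"
    have u: "?u = vecm K (\<lambda>p. if p = x then 1 else 0)" by (rule vecm_unit[OF x])
    have uc: "?u \<in> carrier ?F" unfolding u by (rule vecm_carrier[OF K])
    have sc: "h (v x) \<odot>\<^bsub>?F\<^esub> ?u = vecm K (\<lambda>p. v x * (if p = x then 1 else 0))" unfolding u by (rule vecm_scale[symmetric])
    have "(\<lambda>q. if q \<in> insert x Y then v q else 0)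
        = (\<lambda>q. (if q \<in> Y then v q else 0) + v x * (if q = x then 1 else 0))"
      using insert.hyps by (auto simp: fun_eq_iff)
    then have "vecm K (\<lambda>q. if q \<in> insert x Y then v q else 0) = ?v \<oplus>\<^bsub>?F\<^esub> (h (v x) \<odot>\<^bsub>?F\<^esub> ?u)"
      unfolding sc by (simp only: vecm_add)
    moreover have "Psi (?v \<oplus>\<^bsub>?F\<^esub> (h (v x) \<odot>\<^bsub>?F\<^esub> ?u)) - (Psi ?v + Psi (h (v x) \<odot>\<^bsub>?F\<^esub> ?u)) \<in> m"
      by (rule add[OF vecm_carrier[OF K]]) (unfold sc, rule vecm_carrier[OF K])
    moreover have "Psi (h (v x) \<odot>\<^bsub>?F\<^esub> ?u) - v x * Psi ?u \<in> m" by (rule scale[OF uc])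
    moreover have "Psi ?v - (\<Sum>p\<in>Y. v p * Psi (unit_vec S p)) \<in> m" using insert by auto
    ultimately have "(Psi (vecm K (\<lambda>q. if q \<in> insert x Y then v q else 0)) - (Psi ?v + Psi (h (v x) \<odot>\<^bsub>?F\<^esub> ?u)))
       + ((Psi (h (v x) \<odot>\<^bsub>?F\<^esub> ?u) - v x * Psi ?u) + (Psi ?v - (\<Sum>p\<in>Y. v p * Psi (unit_vec S p)))) \<in> m"
      by (intro rideal_add[OF m, of "_ - _"] rideal_add[OF m, of "_ - _" "_ - _"]) simp_all
    then show ?case using insert.hyps by (simp add: algebra_simps)
  qed
  from this[OF K order.refl] have "Psi (vecm K (\<lambda>q. if q \<in> K then v q else 0)) - (\<Sum>p\<in>K. v p * Psi (unit_vec S p)) \<in> m" .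
  moreover have "vecm K (\<lambda>q. if q \<in> K then v q else 0) = vecm K v" by (simp add: vecm_def fun_eq_iff)
  ultimately show ?thesis by simp
qed

text \<open>Composing a cocycle \<open>x\<close> with \<open>d s + s d = id\<close> leaves
  \<open>(x s) d\<close>, a coboundary. The contraction \<open>s\<close> acts on modules over
  \<open>S\<close>, so \<open>x\<close> becomes a functional through \<open>sec\<close> and all
  identities hold modulo \<open>m\<close>.\<close>

lemma finite_proj_dim_vanishing:
  fixes M :: "('b, 'm) module" and e :: "(nat \<Rightarrow> 'p) \<Rightarrow> 'm"
  assumes M: "module S M" and pd: "finite_proj_dim TYPE('q) S M"
    and c: "cdg 0 B D T" and ex: "exact_from 0 B D"
    and e0: "\<And>v. e v = \<zero>\<^bsub>M\<^esub> \<longleftrightarrow> v \<in> im0 0 B D" and aug: "aug M e"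
  shows "\<exists>N. \<forall>n>N. cocycles B D n \<subseteq> coboundaries B D n"
proof -
  interpret M: module S M by (rule M)
  define X where "X i = B (int i)" for i :: nat
  define A where "A i = D (int i)" for i :: nat
  have fin: "finite (X i)" for i using c by (simp add: cdg_def X_def)
  have B1: "B (int i + 1) = X (Suc i)" "B (int i + 2) = X (Suc (Suc i))" "D (int i + 1) = A (Suc i)" for i
    by (simp_all add: X_def A_def add.commute)
  have AA: "matmul (X (Suc i)) (A i) (A (Suc i)) p q \<in> ker" if "p \<in> X i" "q \<in> X (Suc (Suc i))" for i p q
    using c that unfolding cdg_def by (fastforce simp: B1 X_def[symmetric] A_def[symmetric] dest: spec[of _ "int i"])
  have exX: "\<exists>w. \<forall>p\<in>X (Suc i). v p - colmul (X (Suc (Suc i))) (A (Suc i)) w p \<in> ker"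
    if "\<forall>p\<in>X i. colmul (X (Suc i)) (A i) v p \<in> ker" for i v
    using ex that unfolding exact_from_def gens_ideal_0
    by (fastforce simp: B1 X_def[symmetric] A_def[symmetric] dest: spec[of _ "int i"])
  have im0: "v \<in> im0 0 B D \<longleftrightarrow> (\<exists>w. \<forall>p\<in>X 0. v p - colmul (X 1) (A 0) w p \<in> ker)" for v
    by (simp add: im0_def gens_ideal_0 X_def A_def)
  have e_closed: "e v \<in> carrier M" and e_add: "e (\<lambda>q. v q + w q) = e v \<oplus>\<^bsub>M\<^esub> e w"
    and e_scale: "e (\<lambda>q. a * v q) = h a \<odot>\<^bsub>M\<^esub> e v" and e_surj: "x \<in> carrier M \<Longrightarrow> \<exists>v. e v = x" for v w a x
    using aug by (auto simp: aug_def)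
  \<comment> \<open>The difference vector vanishes on \<open>X 0\<close> modulo \<open>ker\<close>,
    so it lies in \<open>im0\<close> with witness zero.\<close>
  have e_cong: "e v = e w" if "\<forall>q\<in>X 0. v q - w q \<in> ker" for v w
  proof -
    have "e (\<lambda>q. v q - w q) = \<zero>\<^bsub>M\<^esub>"
      unfolding e0 im0 using that by (intro exI[of _ "\<lambda>_. 0"]) (simp add: colmul_def)
    then show ?thesis using e_add[of "\<lambda>q. v q - w q" w] e_closed[of w] by simp
  qed
  define d where "d i = (case i of 0 \<Rightarrow> (\<lambda>v. v) | Suc k \<Rightarrow> mat_map (X (Suc k)) (X k) (A k))" for i
  have dS: "d (Suc k) = mat_map (X (Suc k)) (X k) (A k)" for k by (simp add: d_def)
  define E where "E v = e (\<lambda>q. sec (v q))" for v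
  have E_vecm: "E (vecm (X 0) v) = e v" for v
    unfolding E_def by (rule e_cong) (auto intro: sec_vecm)
  let ?F = "\<lambda>i. free_mod S (X i)"
  have res: "resolution S M ?F d E"
    unfolding resolution_def
  proof (intro conjI allI)
    show "module S (?F i)" for i by (rule free_mod_module[OF is_cring])
    show "E \<in> mod_hom S (?F 0) M"
    proof (rule mod_homI)
      show "E v \<in> carrier M" for v by (simp add: E_def e_closed)
      show "E (v \<oplus>\<^bsub>?F 0\<^esub> w) = E v \<oplus>\<^bsub>M\<^esub> E w" if "v \<in> carrier (?F 0)" "w \<in> carrier (?F 0)" for v w
      proof -
        from that obtain v' w' where v': "v = vecm (X 0) v'" "w = vecm (X 0) w'" by (metis carrier_vecm)
        show ?thesis unfolding v' by (simp flip: vecm_add add: E_vecm e_add)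
      qed
      show "E (a \<odot>\<^bsub>?F 0\<^esub> v) = a \<odot>\<^bsub>M\<^esub> E v" if "a \<in> carrier S" "v \<in> carrier (?F 0)" for a v
      proof -
        from that obtain v' a' where v': "v = vecm (X 0) v'" "a = h a'" by (metis carrier_vecm h_sec)
        show ?thesis unfolding v' by (simp flip: vecm_scale add: E_vecm e_scale)
      qed
    qed
    show "d (Suc i) \<in> mod_hom S (?F (Suc i)) (?F i)" for i
      unfolding dS by (rule mat_map_hom[OF fin fin])
    show "E ` carrier (?F 0) = carrier M"
    proof
      show "E ` carrier (?F 0) \<subseteq> carrier M" by (auto simp: E_def e_closed)
      show "carrier M \<subseteq> E ` carrier (?F 0)"
        using e_surj E_vecm vecm_carrier[OF fin] by (metis imageI subsetI)
    qed
    show "d 1 ` carrier (?F 1) = a_kernel (?F 0) M E"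
    proof (intro equalityI subsetI)
      fix x assume "x \<in> d 1 ` carrier (?F 1)"
      then obtain w where w: "x = vecm (X 0) (colmul (X 1) (A 0) w)"
        by (metis (no_types, lifting) imageE One_nat_def dS carrier_vecm mat_map_vecm)
      have "colmul (X 1) (A 0) w \<in> im0 0 B D" unfolding im0 by (intro exI[of _ w]) (simp add: rideal_0[OF ker_ideal])
      then have "E x = \<zero>\<^bsub>M\<^esub>" unfolding w E_vecm e0 .
      then show "x \<in> a_kernel (?F 0) M E"
        using vecm_carrier[OF fin] by (simp add: a_kernel_def kernel_def w)
    next
      fix x assume "x \<in> a_kernel (?F 0) M E"
      then have x: "x \<in> carrier (?F 0)" "E x = \<zero>\<^bsub>M\<^esub>" by (auto simp: a_kernel_def kernel_def)
      from carrier_vecm[OF x(1)] obtain v where v: "x = vecm (X 0) v" .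
      from x(2) obtain w where "\<forall>p\<in>X 0. v p - colmul (X 1) (A 0) w p \<in> ker"
        unfolding v E_vecm e0 im0 by blast
      then have "x = d 1 (vecm (X 1) w)"
        unfolding v One_nat_def dS mat_map_vecm vecm_eq_iff by simp
      then show "x \<in> d 1 ` carrier (?F 1)" using vecm_carrier[OF fin] by blast
    qed
    show "d (Suc (Suc i)) ` carrier (?F (Suc (Suc i))) = a_kernel (?F (Suc i)) (?F i) (d (Suc i))" for i
    proof (intro equalityI subsetI)
      fix x assume "x \<in> d (Suc (Suc i)) ` carrier (?F (Suc (Suc i)))"
      then obtain y where y: "x = d (Suc (Suc i)) y" "y \<in> carrier (?F (Suc (Suc i)))" by blast
      from carrier_vecm[OF y(2)] obtain w where w: "y = vecm (X (Suc (Suc i))) w" .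
      have x: "x = vecm (X (Suc i)) (colmul (X (Suc (Suc i))) (A (Suc i)) w)"
        unfolding y(1) w dS mat_map_vecm ..
      have "d (Suc i) x = \<zero>\<^bsub>?F i\<^esub>"
        unfolding x dS mat_map_vecm vecm_zero_iff colmul_colmul
        by (auto simp: colmul_def intro!: rideal_sum[OF ker_ideal] rideal_mult'[OF ker_ideal] AA)
      then show "x \<in> a_kernel (?F (Suc i)) (?F i) (d (Suc i))"
        using vecm_carrier[OF fin] by (simp add: a_kernel_def kernel_def x)
    next
      fix x assume "x \<in> a_kernel (?F (Suc i)) (?F i) (d (Suc i))"
      then have x: "x \<in> carrier (?F (Suc i))" "d (Suc i) x = \<zero>\<^bsub>?F i\<^esub>" by (auto simp: a_kernel_def kernel_def)
      from carrier_vecm[OF x(1)] obtain v where v: "x = vecm (X (Suc i)) v" .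
      from x(2) obtain w where "\<forall>p\<in>X (Suc i). v p - colmul (X (Suc (Suc i))) (A (Suc i)) w p \<in> ker"
        using exX unfolding v dS mat_map_vecm vecm_zero_iff by blast
      then have "x = d (Suc (Suc i)) (vecm (X (Suc (Suc i))) w)"
        unfolding v dS mat_map_vecm vecm_eq_iff .
      then show "x \<in> d (Suc (Suc i)) ` carrier (?F (Suc (Suc i)))" using vecm_carrier[OF fin] by blast
    qed
  qed
  from finite_proj_dim_contracting[OF is_cring M res pd]
  obtain s n where s': "\<forall>i. s i \<in> mod_hom S (?F i) (?F (Suc i))"
    and contr': "\<forall>i\<ge>n. \<forall>x\<in>carrier (?F (Suc i)).
      d (Suc (Suc i)) (s (Suc i) x) \<oplus>\<^bsub>?F (Suc i)\<^esub> s i (d (Suc i) x) = x"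
    by (elim exE conjE)
  note s = spec[OF s']
  have contr: "d (Suc (Suc i)) (s (Suc i) x) \<oplus>\<^bsub>?F (Suc i)\<^esub> s i (d (Suc i) x) = x"
    if "n \<le> i" "x \<in> carrier (?F (Suc i))" for i x
    by (rule contr'[THEN spec, THEN mp, THEN bspec, OF that])
  have main: "\<exists>y. \<forall>q\<in>X (Suc i). x q - rowmul (X i) y (A i) q \<in> m"
    if i: "i \<ge> n" and x: "\<forall>q\<in>X (Suc (Suc i)). rowmul (X (Suc i)) x (A (Suc i)) q \<in> m" for i x
  proof -
    define Phi where "Phi v = (\<Sum>q\<in>X (Suc i). x q * sec (v q))" for v
    have Phi_vecm: "Phi (vecm (X (Suc i)) v) - (\<Sum>q\<in>X (Suc i). x q * v q) \<in> m" for v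
      unfolding Phi_def by (rule sum_mult_cong) (rule subsetD[OF I0_m sec_vecm])
    have Phi_add: "Phi (v \<oplus>\<^bsub>?F (Suc i)\<^esub> w) - (Phi v + Phi w) \<in> m"
      if "v \<in> carrier (?F (Suc i))" "w \<in> carrier (?F (Suc i))" for v w
    proof -
      from that obtain v' w' where v': "v = vecm (X (Suc i)) v'" "w = vecm (X (Suc i)) w'" by (metis carrier_vecm)
      have "Phi (vecm (X (Suc i)) (\<lambda>q. v' q + w' q)) - (\<Sum>q\<in>X (Suc i). x q * (v' q + w' q))
         - ((Phi v - (\<Sum>q\<in>X (Suc i). x q * v' q)) + (Phi w - (\<Sum>q\<in>X (Suc i). x q * w' q))) \<in> m"
        unfolding v' by (rule rideal_diff[OF m Phi_vecm rideal_add[OF m Phi_vecm Phi_vecm]])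
      then show ?thesis
        unfolding v' vecm_add by (simp add: distrib_left sum.distrib algebra_simps)
    qed
    have Phi_scale: "Phi (h a \<odot>\<^bsub>?F (Suc i)\<^esub> v) - a * Phi v \<in> m" if "v \<in> carrier (?F (Suc i))" for a v
    proof -
      from that obtain v' where v': "v = vecm (X (Suc i)) v'" by (metis carrier_vecm)
      have "Phi (vecm (X (Suc i)) (\<lambda>q. a * v' q)) - (\<Sum>q\<in>X (Suc i). x q * (a * v' q))
         - a * (Phi v - (\<Sum>q\<in>X (Suc i). x q * v' q)) \<in> m"
        unfolding v' by (rule rideal_diff[OF m Phi_vecm rideal_mult[OF m Phi_vecm]])
      then show ?thesis
        unfolding v' vecm_scale by (simp add: right_diff_distrib sum_distrib_left mult.left_commute)
    qed
    \<comment> \<open>This is \<open>x s\<close>; its values on the unit vectors form the cochain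
      whose coboundary is \<open>x\<close>.\<close>
    define Psi where "Psi v = Phi (s i v)" for v
    note si = mod_homD[OF s[of i]]
    have Psi: "Psi (vecm (X i) v) - (\<Sum>p\<in>X i. v p * Psi (unit_vec S p)) \<in> m" for v
      by (rule functional_expand[OF fin]) (simp_all add: Psi_def si Phi_add Phi_scale)
    have "x q - rowmul (X i) (\<lambda>p. Psi (unit_vec S p)) (A i) q \<in> m" if q: "q \<in> X (Suc i)" for q
    proof -
      let ?u = "unit_vec S q"
      have u: "?u \<in> carrier (?F (Suc i))" by (rule unit_vec_carrier[OF is_cring q])
      have su: "s (Suc i) ?u \<in> carrier (?F (Suc (Suc i)))" by (rule mod_homD(1)[OF s u])
      from carrier_vecm[OF su] obtain w where w: "s (Suc i) ?u = vecm (X (Suc (Suc i))) w" .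
      have ds: "d (Suc (Suc i)) (s (Suc i) ?u) = vecm (X (Suc i)) (colmul (X (Suc (Suc i))) (A (Suc i)) w)"
        unfolding w dS mat_map_vecm ..
      have du: "d (Suc i) ?u = vecm (X i) (\<lambda>p. A i p q)" unfolding dS by (rule mat_map_unit[OF fin q])
      have duc: "d (Suc i) ?u \<in> carrier (?F i)" unfolding du by (rule vecm_carrier[OF fin])
      have 1: "Phi ?u - x q \<in> m"
      proof -
        have "(\<Sum>p\<in>X (Suc i). x p * (if p = q then 1 else 0)) = (\<Sum>p\<in>X (Suc i). if p = q then x p else 0)"
          by (rule sum.cong) auto
        then show ?thesis
          using Phi_vecm[of "\<lambda>p. if p = q then 1 else 0"] q fin unfolding vecm_unit[OF q] by simp
      qed
      have 2: "Phi (d (Suc (Suc i)) (s (Suc i) ?u)) \<in> m"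
      proof -
        have "(\<Sum>p\<in>X (Suc i). x p * colmul (X (Suc (Suc i))) (A (Suc i)) w p)
          = (\<Sum>k\<in>X (Suc (Suc i)). rowmul (X (Suc i)) x (A (Suc i)) k * w k)"
          unfolding colmul_def rowmul_def sum_distrib_left sum_distrib_right
          by (subst sum.swap) (simp add: mult.assoc)
        also have "(\<Sum>k\<in>X (Suc (Suc i)). rowmul (X (Suc i)) x (A (Suc i)) k * w k) \<in> m" by (rule rideal_sum[OF m], rule rideal_mult'[OF m]) (rule bspec[OF x])
        finally show ?thesis
          unfolding ds by (simp only: rideal_cong[OF m Phi_vecm])
      qed
      have 3: "Psi (d (Suc i) ?u) - rowmul (X i) (\<lambda>p. Psi (unit_vec S p)) (A i) q \<in> m"
        using Psi[of "\<lambda>p. A i p q"] unfolding du by (simp add: rowmul_def mult.commute)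
      have 4: "Phi ?u - (Phi (d (Suc (Suc i)) (s (Suc i) ?u)) + Psi (d (Suc i) ?u)) \<in> m"
        using Phi_add[of "d (Suc (Suc i)) (s (Suc i) ?u)" "s i (d (Suc i) ?u)"] contr[OF i u]
          vecm_carrier[OF fin] si(1)[OF duc] by (simp add: ds Psi_def)
      have "(Phi ?u - (Phi (d (Suc (Suc i)) (s (Suc i) ?u)) + Psi (d (Suc i) ?u))) - (Phi ?u - x q)
         + Phi (d (Suc (Suc i)) (s (Suc i) ?u)) + (Psi (d (Suc i) ?u) - rowmul (X i) (\<lambda>p. Psi (unit_vec S p)) (A i) q) \<in> m"
        by (intro rideal_add[OF m rideal_add[OF m rideal_diff[OF m 4 1] 2] 3])
      then show ?thesis by simp
    qed
    then show ?thesis by blast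
  qed
  have "cocycles B D k \<subseteq> coboundaries B D k" if k: "k > int n" for k
  proof
    define i where "i = nat k - 1"
    have ki: "k = int (Suc i)" "i \<ge> n" using k by (auto simp: i_def)
    have idx: "B k = X (Suc i)" "B (k + 1) = X (Suc (Suc i))" "D k = A (Suc i)" "B (k - 1) = X i" "D (k - 1) = A i"
      by (simp_all add: ki(1) X_def A_def add.commute)
    fix x assume "x \<in> cocycles B D k"
    then show "x \<in> coboundaries B D k" using main[OF ki(2), of x] by (simp add: cocycles_def coboundaries_def idx)
  qed
  then show ?thesis by blast
qed

end

section \<open>Periodicity\<close>

lemma (in ideal) rcos_zero_iff:
  assumes "s \<in> carrier R"
  shows "I +> s = \<zero>\<^bsub>R Quot I\<^esub> \<longleftrightarrow> s \<in> I"
proof -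
  have "\<zero>\<^bsub>R Quot I\<^esub> = I" by (simp add: FactRing_def)
  then show ?thesis using a_rcos_self[OF assms] a_rcos_const[of s] by auto
qed

lemma type_ring_surj_Quot:
  assumes h: "type_ring_surj S h" and I: "ideal I S"
  shows "type_ring_surj (S Quot I) (\<lambda>a. I +>\<^bsub>S\<^esub> h a)"
proof -
  interpret S: type_ring_surj S h by (rule h)
  interpret I: ideal I S by (rule I)
  interpret q: ring_hom_ring S "S Quot I" "(+>\<^bsub>S\<^esub>) I" by (rule I.rcos_ring_hom_ring)
  interpret R: cring "S Quot I" by (rule I.quotient_is_cring[OF S.is_cring])
  show ?thesis
  proof
    show "I +>\<^bsub>S\<^esub> h 0 = \<zero>\<^bsub>S Quot I\<^esub>" by (simp only: S.h_zero q.hom_zero)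
    show "I +>\<^bsub>S\<^esub> h 1 = \<one>\<^bsub>S Quot I\<^esub>" by (simp only: S.h_one q.hom_one)
    show "I +>\<^bsub>S\<^esub> h (a + b) = (I +>\<^bsub>S\<^esub> h a) \<oplus>\<^bsub>S Quot I\<^esub> (I +>\<^bsub>S\<^esub> h b)" for a b
      by (simp only: S.h_add q.hom_add S.h_closed)
    show "I +>\<^bsub>S\<^esub> h (a * b) = (I +>\<^bsub>S\<^esub> h a) \<otimes>\<^bsub>S Quot I\<^esub> (I +>\<^bsub>S\<^esub> h b)" for a b
      by (simp only: S.h_mult q.hom_mult S.h_closed)
    show "range (\<lambda>a. I +>\<^bsub>S\<^esub> h a) = carrier (S Quot I)"
    proof (intro equalityI subsetI)
      fix x assume "x \<in> range (\<lambda>a. I +>\<^bsub>S\<^esub> h a)"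
      then obtain a where "x = I +>\<^bsub>S\<^esub> h a" by (rule rangeE)
      then show "x \<in> carrier (S Quot I)" using q.hom_closed[OF S.h_closed] by (simp only:)
    next
      fix x assume "x \<in> carrier (S Quot I)"
      from carrier_Quot[OF this] obtain s where s: "s \<in> carrier S" "x = I +>\<^bsub>S\<^esub> s" by (rule bexE)
      then have "x = I +>\<^bsub>S\<^esub> h (S.sec s)" by (simp only: S.h_sec)
      then show "x \<in> range (\<lambda>a. I +>\<^bsub>S\<^esub> h a)" by (rule range_eqI)
    qed
  qed
qed

lemma restrict_scalars_module:
  assumes S: "cring S" and h: "ring_hom_ring S R h" and M: "module R M"
  shows "module S (restrict_scalars h M)"
proof -
  interpret h: ring_hom_ring S R h by (rule h)
  interpret M: module R M by (rule M)
  have "abelian_group (restrict_scalars h M)"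
    by (rule abelian_groupI)
      (auto simp: restrict_scalars_def M.M.a_ac intro!: bexI[of _ "\<ominus>\<^bsub>M\<^esub> _"] M.M.l_neg)
  then show ?thesis
    by (rule moduleI[OF S])
      (auto simp: restrict_scalars_def M.smult_l_distr M.smult_r_distr M.smult_assoc1)
qed

lemma (in cring) det_leibniz_cong:
  assumes "\<And>i j. i < r \<Longrightarrow> j < r \<Longrightarrow> A i j = C i j" "\<And>i j. i < r \<Longrightarrow> j < r \<Longrightarrow> C i j \<in> carrier R"
  shows "det_leibniz R r A = det_leibniz R r C"
proof -
  have prod: "(\<Otimes>i\<in>{..<r}. A i (s i)) = (\<Otimes>i\<in>{..<r}. C i (s i))"
    "(\<Otimes>i\<in>{..<r}. C i (s i)) \<in> carrier R" if "s permutes {..<r}" for s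
  proof -
    have si: "s i < r" if "i < r" for i using permutes_in_image[OF \<open>s permutes {..<r}\<close>, of i] that by simp
    show "(\<Otimes>i\<in>{..<r}. A i (s i)) = (\<Otimes>i\<in>{..<r}. C i (s i))"
      by (rule finprod_cong') (use assms si in auto)
    show "(\<Otimes>i\<in>{..<r}. C i (s i)) \<in> carrier R"
      by (rule finprod_closed) (use assms si in auto)
  qed
  show ?thesis unfolding det_leibniz_def
    by (rule finsum_cong') (use prod in auto)
qed

text \<open>From \<open>K\<close> on, the sets of each parity form an ascending chain;
  \<open>acc\<close> is applied to the two chains \<open>A (K + e + 2 * t)\<close> with
  \<open>e\<close> equal to 0 or 1.\<close>

lemma two_periodic:
  fixes A :: "nat \<Rightarrow> 'x set"
  assumes inc: "\<And>k. k \<ge> K \<Longrightarrow> A k \<subseteq> A (k + 2)"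
    and acc: "\<And>g. (\<And>t. A (g t) \<subseteq> A (g (Suc t))) \<Longrightarrow> \<exists>T. \<forall>t\<ge>T. A (g t) = A (g T)"
  shows "\<exists>N. \<forall>k\<ge>N. A k = A (k + 2)"
proof -
  have "\<forall>e. \<exists>T. \<forall>t\<ge>T. A (K + e + 2 * t) = A (K + e + 2 * T)"
  proof (rule allI, rule acc)
    show "A (K + e + 2 * t) \<subseteq> A (K + e + 2 * Suc t)" for e t
      using inc[of "K + e + 2 * t"] by (simp add: add.assoc)
  qed
  from choice[OF this] obtain T where T': "\<forall>e. \<forall>t\<ge>T e. A (K + e + 2 * t) = A (K + e + 2 * T e)" by (rule exE)
  have T: "A (K + e + 2 * t) = A (K + e + 2 * T e)" if "t \<ge> T e" for e t
    by (rule T'[THEN spec, THEN spec, THEN mp, OF that])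
  have "A k = A (k + 2)" if k: "k \<ge> K + 2 * max (T 0) (T 1) + 1" for k
  proof -
    define e t where "e = (k - K) mod 2" and "t = (k - K) div 2"
    have ek: "k = K + e + 2 * t" using k by (simp add: e_def t_def)
    have "e = 0 \<or> e = 1" by (auto simp: e_def)
    moreover have "t \<ge> max (T 0) (T 1)" using k unfolding t_def by linarith
    ultimately have t: "t \<ge> T e" by auto
    show ?thesis using T[OF t] T[of e "Suc t"] t by (simp add: ek)
  qed
  then show ?thesis by blast
qed

text \<open>The preimages of the \<open>A t\<close> in \<open>S\<close> form an ascending chain of
  ideals and determine the \<open>A t\<close>.\<close>

lemma quotient_ascending_ideals_stable:
  assumes S: "noetherian_ring S" and I: "ideal I S"
    and A: "\<And>t. ideal (A t) (S Quot I)" and inc: "\<And>t. A t \<subseteq> A (Suc t)"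
  shows "\<exists>T :: nat. \<forall>t\<ge>T. A t = A T"
proof -
  interpret S: noetherian_ring S by (rule S)
  interpret I: ideal I S by (rule I)
  interpret q: ring_hom_ring S "S Quot I" "(+>\<^bsub>S\<^esub>) I" by (rule I.rcos_ring_hom_ring)
  define V where "V t = {s \<in> carrier S. I +>\<^bsub>S\<^esub> s \<in> A t}" for t
  have V: "ideal (V t) S" for t unfolding V_def by (rule q.ideal_vimage[OF A])
  have "V t \<subseteq> V (Suc t)" for t unfolding V_def using inc by blast
  from S.ascending_ideals_stable[of V, OF V this]
  obtain T where T: "\<forall>t\<ge>T. V t = V T" by (rule exE)
  have img: "A t = (+>\<^bsub>S\<^esub>) I ` V t" for t
  proof (intro equalityI subsetI)
    fix x assume x: "x \<in> A t"
    have "x \<in> carrier (S Quot I)" by (rule ideal.Icarr[OF A x])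
    from carrier_Quot[OF this] obtain s where "s \<in> carrier S" "x = I +>\<^bsub>S\<^esub> s" by (rule bexE)
    then show "x \<in> (+>\<^bsub>S\<^esub>) I ` V t" using x unfolding V_def by (intro image_eqI[of _ _ s]) simp_all
  next
    fix x assume "x \<in> (+>\<^bsub>S\<^esub>) I ` V t"
    then obtain s where "x = I +>\<^bsub>S\<^esub> s" "s \<in> V t" by (rule imageE)
    then show "x \<in> A t" unfolding V_def by simp
  qed
  have "A t = A T" if "t \<ge> T" for t
    using arg_cong[OF T[THEN spec, THEN mp, OF that], of "\<lambda>X. (+>\<^bsub>S\<^esub>) I ` X"]
    unfolding img[symmetric] .
  then show ?thesis by blast
qed

lemma (in type_ring_surj) minors_eq:
  assumes A: "\<And>p q. p < k \<Longrightarrow> q < n \<Longrightarrow> h (A p q) = C p q"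
  shows "minors S r k n C = {h (Det r (\<lambda>i j. A (g i) (g' j))) | g g'.
    g \<in> {..<r} \<rightarrow> {..<k} \<and> strict_mono_on {..<r} g \<and> g' \<in> {..<r} \<rightarrow> {..<n} \<and> strict_mono_on {..<r} g'}"
proof -
  have eq: "det_leibniz S r (\<lambda>i j. C (g i) (g' j)) = h (Det r (\<lambda>i j. A (g i) (g' j)))"
    if "g \<in> {..<r} \<rightarrow> {..<k}" "g' \<in> {..<r} \<rightarrow> {..<n}" for g g'
    unfolding h_Det by (rule det_leibniz_cong) (use that in \<open>auto intro!: A[symmetric]\<close>)
  show ?thesis unfolding minors_def
  proof (rule Collect_cong, rule ex_cong1, rule ex_cong1)
    fix x g g'
    let ?P = "g \<in> {..<r} \<rightarrow> {..<k} \<and> strict_mono_on {..<r} g \<and> g' \<in> {..<r} \<rightarrow> {..<n} \<and> strict_mono_on {..<r} g'"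
    show "(x = det_leibniz S r (\<lambda>i j. C (g i) (g' j)) \<and> ?P) = (x = h (Det r (\<lambda>i j. A (g i) (g' j))) \<and> ?P)"
    proof (cases ?P)
      case True
      then have "det_leibniz S r (\<lambda>i j. C (g i) (g' j)) = h (Det r (\<lambda>i j. A (g i) (g' j)))"
        by (elim conjE) (rule eq)
      then show ?thesis by (simp only:)
    next
      case False then show ?thesis by (simp only: simp_thms)
    qed
  qed
qed

lemma minors_empty: "r > k \<or> r > n \<Longrightarrow> minors S r k n C = {}"
proof -
  have "\<not> (g \<in> {..<r} \<rightarrow> {..<k} \<and> strict_mono_on {..<r} g)" if "r > k" for g :: "nat \<Rightarrow> nat" and k
  proof
    assume g: "g \<in> {..<r} \<rightarrow> {..<k} \<and> strict_mono_on {..<r} g"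
    then have "inj_on g {..<r}" using strict_mono_on_imp_inj_on by blast
    then have "card {..<r} \<le> card {..<k}" by (rule card_inj_on_le) (use g in auto)
    then show False using that by simp
  qed
  note none = this
  assume "r > k \<or> r > n"
  then show "minors S r k n C = {}"
  proof
    assume "r > k" from none[OF this] show ?thesis unfolding minors_def by blast
  next
    assume "r > n" from none[OF this] show ?thesis unfolding minors_def by blast
  qed
qed

text \<open>If \<open>r\<close> exceeds a rank there are no minors, and the empty set generates the
  zero ideal; the last two cases of the definition thus become one.\<close>

lemma minor_ideal_eq:
  assumes "cring R"
  shows "minor_ideal R b d r (Suc i) = (if b (Suc i) = 0 \<or> b i = 0 then carrier R
    else genideal R (minors R r (b i) (b (Suc i)) (\<lambda>p q. d (Suc i) (unit_vec R q) p)))"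
proof -
  interpret cring R by fact
  have "genideal R {} = {\<zero>\<^bsub>R\<^esub>}"
  proof
    show "genideal R {} \<subseteq> {\<zero>\<^bsub>R\<^esub>}" by (rule genideal_minimal[OF zeroideal]) simp
    show "{\<zero>\<^bsub>R\<^esub>} \<subseteq> genideal R {}"
      using additive_subgroup.zero_closed[OF ideal.axioms(1)[OF genideal_ideal[of "{}"]]] by simp
  qed
  then show ?thesis
    by (simp add: minor_ideal_def minors_empty)
qed

lemma regular_seq_regular:
  assumes reg: "regular_seq S fs" and S: "cring S" and j: "j < length fs" and x: "x \<in> carrier S"
    and mem: "fs ! j \<otimes>\<^bsub>S\<^esub> x \<in> genideal S (set (take j fs))"
  shows "x \<in> genideal S (set (take j fs))"
proof -
  interpret S: cring S by (rule S)
  let ?J = "genideal S (set (take j fs))"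
  have fs: "set fs \<subseteq> carrier S" using reg by (simp add: regular_seq_def)
  have fj: "fs ! j \<in> carrier S" by (rule subsetD[OF fs nth_mem[OF j]])
  interpret J: ideal ?J S by (rule S.genideal_ideal[OF order.trans[OF set_take_subset fs]])
  interpret q: ring_hom_ring S "S Quot ?J" "(+>\<^bsub>S\<^esub>) ?J" by (rule J.rcos_ring_hom_ring)
  have "(?J +>\<^bsub>S\<^esub> fs ! j) \<otimes>\<^bsub>S Quot ?J\<^esub> (?J +>\<^bsub>S\<^esub> x) = ?J +>\<^bsub>S\<^esub> (fs ! j \<otimes>\<^bsub>S\<^esub> x)"
    by (rule q.hom_mult[OF fj x, symmetric])
  also have "\<dots> = \<zero>\<^bsub>S Quot ?J\<^esub>"
    using J.rcos_zero_iff[OF S.m_closed[OF fj x]] mem by simp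
  finally have "?J +>\<^bsub>S\<^esub> x = \<zero>\<^bsub>S Quot ?J\<^esub>"
    using reg j q.hom_closed[OF x] unfolding regular_seq_def Let_def by simp
  then show ?thesis using J.rcos_zero_iff[OF x] by simp
qed

theorem theorem3p23:
  fixes S :: "('a, 'e) ring_scheme"
    and fs :: "'a list"
    and R :: "'a set ring"
    and M :: "('a set, 'm) module"
    and b :: "nat \<Rightarrow> nat"
    and d :: "nat \<Rightarrow> (nat \<Rightarrow> 'a set) \<Rightarrow> (nat \<Rightarrow> 'a set)"
    and \<epsilon> :: "(nat \<Rightarrow> 'a set) \<Rightarrow> 'm"
    and r :: nat
  assumes "local_noetherian S"
    and "regular_seq S fs"
    and "R = S Quot (genideal S (set fs))"
    and "module R M"
    and "fin_gen R M"
    and "finite_proj_dim TYPE('p) S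
           (restrict_scalars (\<lambda>s. genideal S (set fs) +>\<^bsub>S\<^esub> s) M)"
    and "minimal_free_resolution R M b d \<epsilon>"
    and "r > 0"
  shows "\<exists>N. \<forall>k\<ge>N. minor_ideal R b d r k = minor_ideal R b d r (k + 2)"
proof -

  \<comment> \<open>The two rings and their common type-class cover\<close>
  have S: "cring S" by (rule local_noetherianD(1)[OF assms(1)])
  interpret S: cring S by (rule S)
  define I where "I = genideal S (set fs)"
  have R: "R = S Quot I" unfolding I_def by (rule assms(3))
  have fs: "set fs \<subseteq> carrier S" using assms(2) by (simp add: regular_seq_def)
  have I: "ideal I S" unfolding I_def by (rule S.genideal_ideal[OF fs])
  have I_proper: "I \<noteq> carrier S" using assms(2) by (simp add: regular_seq_def I_def)
  interpret I: ideal I S by (rule I)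
  have q: "ring_hom_ring S R ((+>\<^bsub>S\<^esub>) I)" unfolding R by (rule I.rcos_ring_hom_ring)
  note local = quotient_local[OF assms(1) I I_proper, folded R]
  obtain h :: "'a uring \<Rightarrow> 'a" where h: "type_ring_surj S h" using uring_surj[OF S] by (rule exE)
  interpret H: type_ring_surj S h by (rule h)
  define w where "w a = I +>\<^bsub>S\<^esub> h a" for a
  interpret W: type_ring_surj R w
    using type_ring_surj_Quot[OF h I] unfolding R w_def .
  define f where "f l = H.sec (fs ! l)" for l
  have f: "h (f l) = fs ! l" if "l < length fs" for l
    unfolding f_def by (rule H.h_sec[OF subsetD[OF fs nth_mem[OF that]]])
  define c where "c = length fs"
  \<comment> \<open>Pulled back from \<open>R\<close>, because minimality is stated with
    \<open>max_ideal R\<close>.\<close>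
  define m where "m = {a. w a \<in> max_ideal R}"
  have m: "rideal m" unfolding m_def by (rule W.vimage_ideal[OF local(1)])
  have gens_ideal: "h a \<in> genideal S (set (take j fs)) \<longleftrightarrow> a \<in> ideal_gens.gens_ideal H.ker f j" if "j \<le> c" for a j
    using H.genideal_take_iff[OF fs f that[unfolded c_def]] .
  have w_zero: "w a = \<zero>\<^bsub>R\<^esub> \<longleftrightarrow> h a \<in> I" for a
    unfolding w_def R by (rule I.rcos_zero_iff[OF H.h_closed])
  have max_zero: "\<zero>\<^bsub>R\<^esub> \<in> max_ideal R"
    by (rule additive_subgroup.zero_closed[OF ideal.axioms(1)[OF local(1)]])
  have I_m: "a \<in> m" if "h a \<in> I" for a
    using that max_zero unfolding m_def w_zero[symmetric] by simp
  \<comment> \<open>Invertibility modulo the kernel onto \<open>R\<close>, which is stronger than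
    modulo \<open>m\<close>; it later cancels the factor produced by
    \<open>minors_step\<close>.\<close>
  have m_max: "\<exists>a'. a * a' - 1 \<in> W.ker" if "a \<notin> m" for a
  proof -
    have "w a \<notin> max_ideal R" using that by (simp add: m_def)
    from local(3)[OF W.h_closed this] obtain y where y: "y \<in> carrier R" "w a \<otimes>\<^bsub>R\<^esub> y = \<one>\<^bsub>R\<^esub>" by (rule bexE)
    have "w (a * W.sec y) = w 1" by (simp only: W.h_mult W.h_sec[OF y(1)] y(2) W.h_one)
    then show ?thesis unfolding W.h_eq_iff by (rule exI)
  qed
  have W_ker_m: "W.ker \<subseteq> m"
    by (intro subsetI I_m) (simp add: W.ker_def w_zero)
  have "reg_ideal H.ker f m c"
  proof
    show "rideal H.ker" by (rule H.ker_ideal)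
    show "rideal m" by (rule m)
    show "H.ker \<subseteq> m" by (intro subsetI I_m) (simp add: H.ker_def I.zero_closed)
    show "f l \<in> m" if "l < c" for l
    proof (rule I_m)
      have "fs ! l \<in> set fs" using that by (simp add: c_def)
      from subsetD[OF S.genideal_self[OF fs] this] show "h (f l) \<in> I"
        using f[of l] that by (simp add: I_def c_def)
    qed
    show "1 \<notin> m" using local(2) by (simp add: m_def W.h_one)
    show "\<exists>a'. a * a' - 1 \<in> m" if "a \<notin> m" for a
    proof -
      from m_max[OF that] obtain a' where "a * a' - 1 \<in> W.ker" by (rule exE)
      from subsetD[OF W_ker_m this] show ?thesis by (rule exI)
    qed
    show "a \<in> ideal_gens.gens_ideal H.ker f j" if "j < c" "f j * a \<in> ideal_gens.gens_ideal H.ker f j" for j a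
    proof -
      have j: "j < length fs" "j \<le> c" using that(1) by (simp_all add: c_def)
      have "h (f j * a) \<in> genideal S (set (take j fs))" using that(2) unfolding gens_ideal[OF j(2)] .
      then have "fs ! j \<otimes>\<^bsub>S\<^esub> h a \<in> genideal S (set (take j fs))" by (simp only: H.h_mult f[OF j(1)])
      from regular_seq_regular[OF assms(2) S j(1) H.h_closed this]
      show ?thesis unfolding gens_ideal[OF j(2)] .
    qed
  qed
  then interpret P: reg_ideal H.ker f m c .
  interpret Q: reg_surj S h f m c ..
  have ker_eq: "W.ker = P.gens_ideal c"
  proof (rule Set.set_eqI)
    fix a
    have "a \<in> W.ker \<longleftrightarrow> h a \<in> genideal S (set (take c fs))"
      by (simp add: W.ker_def w_zero I_def c_def)
    then show "a \<in> W.ker \<longleftrightarrow> a \<in> P.gens_ideal c" using gens_ideal[of c a] by simp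
  qed

  \<comment> \<open>Lifting the minimal resolution to matrices\<close>
  define X where "X i = {..<b i}" for i
  \<comment> \<open>\<open>A i\<close> lifts the matrix of \<open>d (Suc i)\<close>: matrices are
    indexed by the degree of their target. Accordingly \<open>G i\<close> below belongs to the minor
    ideal of index \<open>Suc i\<close>.\<close>
  define A where "A i p q = W.sec (d (Suc i) (unit_vec R q) p)" for i p q
  \<comment> \<open>Integer degrees with zero modules below 0: the cone shifts a summand by one, and
    repeated division by an operator ends in negative degrees.\<close>
  define B where "B n = (if n < 0 then {} else X (nat n))" for n :: int
  define D where "D n = A (nat n)" for n :: int
  have X: "finite (X i)" for i by (simp add: X_def)
  have B_nat: "B (int i) = X i" "D (int i) = A i" for i by (simp_all add: B_def D_def)
  have B_simps: "B (int i + 1) = X (Suc i)" "B (int i + 2) = X (Suc (Suc i))" "B (int i + 3) = X (Suc (Suc (Suc i)))"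
    "D (int i + 1) = A (Suc i)" "D (int i + 2) = A (Suc (Suc i))" for i
    using B_nat[of "Suc i"] B_nat[of "Suc (Suc i)"] B_nat[of "Suc (Suc (Suc i))"] by (simp_all add: add.commute)
  let ?F = "\<lambda>i. free_mod R (X i)"
  have res: "resolution R M ?F d \<epsilon>" and
    min: "\<And>i v p. v \<in> carrier (?F (Suc i)) \<Longrightarrow> p \<in> X i \<Longrightarrow> d (Suc i) v p \<in> max_ideal R"
    using assms(7) unfolding minimal_free_resolution_def X_def by auto
  note F = resolutionD[OF res]
  have d_unit: "d (Suc i) (unit_vec R q) = W.vecm (X i) (\<lambda>p. A i p q)" if "q \<in> X (Suc i)" for i q
    unfolding A_def
    by (rule W.vecm_sec[symmetric], rule mod_homD(1)[OF F(3) unit_vec_carrier[OF W.is_cring that]])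
  have wA: "w (A i p q) = d (Suc i) (unit_vec R q) p" if "p \<in> X i" "q \<in> X (Suc i)" for i p q
    using that by (simp add: d_unit W.vecm_def)
  have d_mat: "d (Suc i) v = W.mat_map (X (Suc i)) (X i) (A i) v" if v: "v \<in> carrier (?F (Suc i))" for i v
    by (rule free_mod_hom_cong[OF W.is_cring F(3) W.mat_map_hom[OF X X] F(1) _ v])
      (simp add: d_unit W.mat_map_unit[OF X])
  have d_vecm: "d (Suc i) (W.vecm (X (Suc i)) v) = W.vecm (X i) (colmul (X (Suc i)) (A i) v)" for i v
    by (simp only: d_mat[OF W.vecm_carrier[OF X]] W.mat_map_vecm)
  have AA: "matmul (X (Suc i)) (A i) (A (Suc i)) p q \<in> W.ker" if p: "p \<in> X i" and q: "q \<in> X (Suc (Suc i))" for i p q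
  proof -
    have "d (Suc i) (d (Suc (Suc i)) (unit_vec R q)) = \<zero>\<^bsub>?F i\<^esub>"
      by (rule F(8)[OF unit_vec_carrier[OF W.is_cring q]])
    then have "\<forall>p\<in>X i. colmul (X (Suc i)) (A i) (\<lambda>p. A (Suc i) p q) p \<in> W.ker"
      unfolding d_unit[OF q] d_vecm W.vecm_zero_iff .
    from bspec[OF this p] show ?thesis by (simp add: colmul_def matmul_def)
  qed
  obtain T where c: "P.cdg c B D T"
  proof -
    have "\<exists>T. P.cdg c B D T"
    proof (rule P.cdg_exists)
      show "finite (B n)" "n < 0 \<Longrightarrow> B n = {}" for n by (simp_all add: B_def X)
      show "matmul (B (n + 1)) (D n) (D (n + 1)) p q \<in> P.gens_ideal c" if "p \<in> B n" "q \<in> B (n + 2)" for n p q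
      proof -
        have "n \<ge> 0" using that(1) by (auto simp: B_def split: if_splits)
        then obtain i where n: "n = int i" by (rule nonneg_int_cases)
        show ?thesis using AA[of p i q] that unfolding n B_simps B_nat ker_eq by simp
      qed
    qed simp
    then show thesis using that by (rule exE)
  qed
  have ex: "P.exact_from c B D" unfolding P.exact_from_def
  proof (intro allI impI)
    fix n :: int and v assume "0 \<le> n" and v: "\<forall>p\<in>B n. colmul (B (n + 1)) (D n) v p \<in> P.gens_ideal c"
    then obtain i where n: "n = int i" by (auto elim: nonneg_int_cases)
    let ?x = "W.vecm (X (Suc i)) v"
    have "d (Suc i) ?x = \<zero>\<^bsub>?F i\<^esub>"
      using v unfolding n B_simps B_nat d_vecm W.vecm_zero_iff ker_eq .
    from F(7)[OF W.vecm_carrier[OF X] this] obtain y where y: "?x = d (Suc (Suc i)) y" "y \<in> carrier (?F (Suc (Suc i)))"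
      by (rule imageE)
    from W.carrier_vecm[OF y(2)] obtain u where u: "y = W.vecm (X (Suc (Suc i))) u" .
    have "\<forall>p\<in>X (Suc i). v p - colmul (X (Suc (Suc i))) (A (Suc i)) u p \<in> P.gens_ideal c"
      using y(1) unfolding u d_vecm W.vecm_eq_iff ker_eq .
    then show "\<exists>w. \<forall>p\<in>B (n + 1). v p - colmul (B (n + 2)) (D (n + 1)) w p \<in> P.gens_ideal c"
      unfolding n B_simps by (rule exI[of _ u])
  qed

  \<comment> \<open>The module over \<open>S\<close> and its augmentation\<close>
  define e where "e v = \<epsilon> (W.vecm (X 0) v)" for v
  define M' where "M' = restrict_scalars ((+>\<^bsub>S\<^esub>) I) M"
  have M': "module S M'" unfolding M'_def by (rule restrict_scalars_module[OF S q assms(4)])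
  have pd: "finite_proj_dim TYPE('p) S M'"
    using assms(6) unfolding M'_def I_def .
  have e0: "e v = \<zero>\<^bsub>M'\<^esub> \<longleftrightarrow> v \<in> P.im0 c B D" for v
  proof
    assume "e v = \<zero>\<^bsub>M'\<^esub>"
    then have "\<epsilon> (W.vecm (X 0) v) = \<zero>\<^bsub>M\<^esub>" by (simp add: e_def M'_def restrict_scalars_def)
    from F(5)[OF W.vecm_carrier[OF X] this] obtain y where y: "W.vecm (X 0) v = d (Suc 0) y" "y \<in> carrier (?F (Suc 0))"
      by (rule imageE)
    from W.carrier_vecm[OF y(2)] obtain u where u: "y = W.vecm (X (Suc 0)) u" .
    have "\<forall>p\<in>X 0. v p - colmul (X (Suc 0)) (A 0) u p \<in> P.gens_ideal c"
      using y(1) unfolding u d_vecm W.vecm_eq_iff ker_eq .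
    then show "v \<in> P.im0 c B D"
      using B_nat[of 0] B_nat(1)[of 1] unfolding P.im0_def by (intro CollectI exI[of _ u]) simp
  next
    assume "v \<in> P.im0 c B D"
    then obtain u where "\<forall>p\<in>X 0. v p - colmul (X (Suc 0)) (A 0) u p \<in> W.ker"
      using B_nat[of 0] B_nat(1)[of 1] unfolding P.im0_def ker_eq by auto
    then have "W.vecm (X 0) v = d (Suc 0) (W.vecm (X (Suc 0)) u)"
      unfolding d_vecm W.vecm_eq_iff .
    then have "\<epsilon> (W.vecm (X 0) v) = \<zero>\<^bsub>M\<^esub>" using F(6)[OF W.vecm_carrier[OF X]] by (simp only:)
    then show "e v = \<zero>\<^bsub>M'\<^esub>" by (simp add: e_def M'_def restrict_scalars_def)
  qed
  have aug: "Q.aug M' e" unfolding Q.aug_def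
  proof (intro conjI allI ballI)
    note eps = mod_homD[OF F(2)] and vc = W.vecm_carrier[OF X]
    show "e v \<in> carrier M'" for v
      using eps(1)[OF vc] by (simp add: e_def M'_def restrict_scalars_def)
    show "e (\<lambda>q. v q + v' q) = e v \<oplus>\<^bsub>M'\<^esub> e v'" for v v'
      using eps(2)[OF vc vc] by (simp add: e_def M'_def restrict_scalars_def W.vecm_add)
    show "e (\<lambda>q. a * v q) = h a \<odot>\<^bsub>M'\<^esub> e v" for a v
      using eps(3)[OF W.h_closed vc] by (simp add: e_def M'_def restrict_scalars_def W.vecm_scale w_def)
    show "\<exists>v. e v = x" if "x \<in> carrier M'" for x
    proof -
      have "x \<in> \<epsilon> ` carrier (?F 0)" using that F(4) by (simp add: M'_def restrict_scalars_def)
      then obtain y where y: "x = \<epsilon> y" "y \<in> carrier (?F 0)" by (rule imageE)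
      from W.carrier_vecm[OF y(2)] obtain v where "y = W.vecm (X 0) v" .
      then have "e v = x" by (simp only: e_def y(1))
      then show ?thesis by (rule exI[of _ v])
    qed
  qed

  \<comment> \<open>Noetherian cohomology and the bound on its socle\<close>
  have acc: "graded_op.gacc (P.cocycles B D) (P.coboundaries B D) vscale (act B T) c"
    by (rule P.gacc_resolution[where P = "Q.aug M'" and z = "\<zero>\<^bsub>M'\<^esub>" and e = e, OF _ Q.aug_shift c ex e0 aug])
      (rule Q.finite_proj_dim_vanishing[OF M' pd])
  have Dm: "D n p q \<in> m" if "p \<in> B n" "q \<in> B (n + 1)" for n p q
  proof -
    have "n \<ge> 0" using that(1) by (auto simp: B_def split: if_splits)
    then obtain i where n: "n = int i" by (rule nonneg_int_cases)
    have p: "p \<in> X i" and q: "q \<in> X (Suc i)" using that unfolding n B_simps B_nat .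
    from min[OF unit_vec_carrier[OF W.is_cring q] p] show ?thesis
      unfolding n B_nat m_def using wA[OF p q] by simp
  qed
  from P.socle_bounded[OF c acc Dm] obtain K0 where
    K0: "\<forall>n>K0. \<forall>x. (\<forall>l<c. \<forall>q\<in>B (n + 2). act B T l n x q \<in> m) \<longrightarrow> (\<forall>q\<in>B n. x q \<in> m)" by (rule exE)
  \<comment> \<open>The summand 1 ensures \<open>K0 < int i\<close> for all \<open>i >= K\<close>,
    also when \<open>K0\<close> is negative.\<close>
  define K where "K = nat K0 + 1"
  have soc: "\<forall>q\<in>B n. x q \<in> m" if "n > K0" "\<And>l q. l < c \<Longrightarrow> q \<in> B (n + 2) \<Longrightarrow> act B T l n x q \<in> m" for n x
    using K0 that by simp
  have KK: "K0 < int i" if "i \<ge> K" for i using that by (simp add: K_def)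

  \<comment> \<open>Inclusion of the minor ideals two steps apart\<close>
  define G where "G i = genideal R (minors R r (b i) (b (Suc i)) (\<lambda>p q. d (Suc i) (unit_vec R q) p))" for i
  have minors: "minors R r (b i) (b (Suc i)) (\<lambda>p q. d (Suc i) (unit_vec R q) p) =
      {w (Det r (\<lambda>k l. A i (g k) (g' l))) | g g'.
        g \<in> {..<r} \<rightarrow> {..<b i} \<and> strict_mono_on {..<r} g \<and> g' \<in> {..<r} \<rightarrow> {..<b (Suc i)} \<and> strict_mono_on {..<r} g'}" for i
    by (rule W.minors_eq) (simp add: wA X_def)
  have minors_carrier: "minors R r (b i) (b (Suc i)) (\<lambda>p q. d (Suc i) (unit_vec R q) p) \<subseteq> carrier R" for i
    unfolding minors by auto
  have G: "ideal (G i) R" for i unfolding G_def by (rule W.genideal_ideal[OF minors_carrier])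
  have G_inc: "G i \<subseteq> G (i + 2)" if i: "i \<ge> K" for i
  proof -
    define J where "J = {a. w a \<in> G (i + 2)}"
    interpret G: ideal "G (i + 2)" R by (rule G)
    have J: "rideal J" unfolding J_def by (rule W.vimage_ideal[OF G])
    have kJ: "P.gens_ideal c \<subseteq> J" unfolding ker_eq[symmetric] J_def W.ker_def using G.zero_closed by auto
    have mem: "Det r (\<lambda>k l. A i (g k) (g' l)) \<in> J"
      if g: "g \<in> {..<r} \<rightarrow> X i" and g': "g' \<in> {..<r} \<rightarrow> X (Suc i)" for g g'
    proof -
      \<comment> \<open>The generators of \<open>G\<close> use increasing selections, while
        \<open>minors_step\<close> asks for arbitrary ones.\<close>
      have min2: "Det r (\<lambda>k l. A (Suc (Suc i)) (g k) (g' l)) \<in> J"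
        if "g \<in> {..<r} \<rightarrow> X (Suc (Suc i))" "g' \<in> {..<r} \<rightarrow> X (Suc (Suc (Suc i)))" for g g'
      proof (rule Det_minors_mem[OF J _ that])
        fix g g' assume "g \<in> {..<r} \<rightarrow> X (Suc (Suc i))" "strict_mono_on {..<r} g"
          "g' \<in> {..<r} \<rightarrow> X (Suc (Suc (Suc i)))" "strict_mono_on {..<r} g'"
        then have "w (Det r (\<lambda>k l. A (i + 2) (g k) (g' l))) \<in>
            minors R r (b (i + 2)) (b (Suc (i + 2))) (\<lambda>p q. d (Suc (i + 2)) (unit_vec R q) p)"
          unfolding minors X_def by (intro CollectI exI[of _ g] exI[of _ g']) simp
        from subsetD[OF W.genideal_self[OF minors_carrier] this]
        show "Det r (\<lambda>k l. A (Suc (Suc i)) (g k) (g' l)) \<in> J" unfolding J_def G_def by simp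
      qed
      have "\<exists>a. a \<notin> m \<and> a * Det r (\<lambda>k l. D (int i) (g k) (g' l)) \<in> J"
        by (rule P.minors_step[OF c Dm soc less_imp_le[OF KK[OF i]] J kJ])
          (use g g' min2 in \<open>simp_all add: B_simps B_nat\<close>)
      then obtain a where a: "a \<notin> m" "a * Det r (\<lambda>k l. A i (g k) (g' l)) \<in> J"
        unfolding B_nat by (elim exE conjE)
      from m_max[OF a(1)] obtain a' where a': "a * a' - 1 \<in> W.ker" by (rule exE)
      let ?x = "Det r (\<lambda>k l. A i (g k) (g' l))"
      \<comment> \<open>\<open>a\<close> is a unit modulo the kernel onto \<open>R\<close>, and
        \<open>J\<close> contains that kernel, so \<open>a\<close> can be cancelled.\<close>
      have "a' * (a * ?x) - (a * a' - 1) * ?x \<in> J"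
        by (rule rideal_diff[OF J rideal_mult[OF J a(2)] rideal_mult'[OF J subsetD[OF kJ]]])
          (use a' in \<open>simp add: ker_eq\<close>)
      then show ?thesis by (simp add: algebra_simps)
    qed
    show ?thesis unfolding G_def[of i]
    proof (rule W.genideal_minimal[OF G])
      show "minors R r (b i) (b (Suc i)) (\<lambda>p q. d (Suc i) (unit_vec R q) p) \<subseteq> G (i + 2)"
        using mem unfolding minors J_def X_def by auto
    qed
  qed
  \<comment> \<open>If the module two steps higher is zero, all operators kill every vector on
    \<open>B (int i)\<close>. The socle bound then puts the constant vector 1 into \<open>m\<close>,
    unless \<open>B (int i)\<close> is empty.\<close>
  have b_inc: "b (i + 2) \<noteq> 0" if i: "i \<ge> K" and nz: "b i \<noteq> 0" for i
  proof
    assume "b (i + 2) = 0"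
    then have "B (int i + 2) = {}" by (simp add: B_simps X_def)
    from soc[OF KK[OF i], of "\<lambda>_. 1"] this have "\<forall>q\<in>B (int i). (1 :: 'a uring) \<in> m" by simp
    then show False using nz P.one_m by (auto simp: B_nat X_def)
  qed

  \<comment> \<open>Stabilisation along each parity\<close>
  obtain N1 where N1: "\<forall>k\<ge>N1. G k = G (k + 2)"
  proof -
    have "\<exists>N. \<forall>k\<ge>N. G k = G (k + 2)"
    proof (rule two_periodic[where K = K and A = G, OF G_inc])
      show "\<exists>T. \<forall>t\<ge>T. G (g t) = G (g T)" if "\<And>t. G (g t) \<subseteq> G (g (Suc t))" for g
        using quotient_ascending_ideals_stable[OF local_noetherianD(2)[OF assms(1)] I, of "\<lambda>t. G (g t)"] G that
        unfolding R by simp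
    qed
    then show thesis using that by (rule exE)
  qed
  \<comment> \<open>Encodes the vanishing of a rank as a set, so that \<open>two_periodic\<close>
    also applies to it. Zero ranks matter because they turn the minor ideal into the unit
    ideal.\<close>
  define Bz where "Bz k = (if b k = 0 then {} else {()})" for k
  obtain N2 where N2: "\<forall>k\<ge>N2. Bz k = Bz (k + 2)"
  proof -
    have "\<exists>N. \<forall>k\<ge>N. Bz k = Bz (k + 2)"
    proof (rule two_periodic[where K = K and A = Bz])
      show "Bz k \<subseteq> Bz (k + 2)" if "k \<ge> K" for k using b_inc[OF that] by (simp add: Bz_def)
      show "\<exists>T. \<forall>t\<ge>T. Bz (g t) = Bz (g T)" if inc: "\<And>t. Bz (g t) \<subseteq> Bz (g (Suc t))" for g
      proof (cases "\<exists>T. Bz (g T) \<noteq> {}")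
        case True
        then obtain T where T: "Bz (g T) \<noteq> {}" by (rule exE)
        have "Bz (g t) = Bz (g T)" if "t \<ge> T" for t
          using lift_Suc_mono_le[of "\<lambda>t. Bz (g t)", OF inc that] T by (auto simp: Bz_def split: if_splits)
        then show ?thesis by (intro exI[of _ T] allI impI)
      next
        case False then show ?thesis by simp
      qed
    qed
    then show thesis using that by (rule exE)
  qed
  have b_per: "b k = 0 \<longleftrightarrow> b (k + 2) = 0" if "k \<ge> N2" for k
    using N2[THEN spec, THEN mp, OF that] by (simp add: Bz_def split: if_splits)
  show ?thesis
  proof (intro exI allI impI)
    \<comment> \<open>The \<open>Suc\<close> accounts for the shift between \<open>G i\<close> and
      the minor ideal of index \<open>Suc i\<close>.\<close>
    fix k assume k: "k \<ge> Suc (max N1 N2)"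
    then obtain i where i: "k = Suc i" "i \<ge> N1" "i \<ge> N2" by (cases k) auto
    have "G i = G (i + 2)" by (rule N1[THEN spec, THEN mp, OF i(2)])
    moreover have "b i = 0 \<longleftrightarrow> b (i + 2) = 0" "b (Suc i) = 0 \<longleftrightarrow> b (Suc i + 2) = 0"
      using b_per[of i] b_per[of "Suc i"] i(3) by simp_all
    ultimately have "minor_ideal R b d r (Suc i) = minor_ideal R b d r (Suc (i + 2))"
      unfolding minor_ideal_eq[OF W.is_cring] G_def[symmetric] by simp
    then show "minor_ideal R b d r k = minor_ideal R b d r (k + 2)" by (simp add: i(1))
  qed
qed

end
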